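(* Let $\Theta$ be a symmetric $(2,0)$ tensor of constant rank on a manifold $M$. Then $\Theta$ is integrable if and only if the distribution $\mathrm{Im}\,\Theta\subseteq TM$ is integrable.
   Context: Manifolds are smooth and connected; tensors (= tensor fields) are smooth. A $(2,0)$ tensor is twice contravariant (a section of $TM\otimes TM$). A tensor field $\Theta$ on $M$ is integrable if $\nabla\Theta=0$ for some torsion-free connection $\nabla$ on $M$. A distribution (vector subbundle of $TM$) is integrable if it is closed under Lie brackets of local sections. A symmetric $(2,0)$ tensor $\Theta$ is treated as the bundle morphism $T^*M\to TM$, $\xi\mapsto\Theta(\xi,\cdot)$, and $\mathrm{Im}\,\Theta$ is the image of this morphism, a vector subbundle of $TM$ when $\Theta$ has constant rank. *)

theory Defs
  imports "HOL-Analysis.Analysis"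
begin

section \<open>Smooth maps between normed spaces\<close>

text \<open>These predicates are meant for open \<open>S\<close> in a finite-dimensional space, where asking for
  all iterated directional derivatives \<open>\<lambda>x. Df(x) v\<close> gives the usual classes \<open>C\<^sup>k\<close>.\<close>

primrec Ck_on :: "nat \<Rightarrow> 'e::real_normed_vector set \<Rightarrow> ('e \<Rightarrow> 'f::real_normed_vector) \<Rightarrow> bool" where
  "Ck_on 0 S f \<longleftrightarrow> continuous_on S f"
| "Ck_on (Suc k) S f \<longleftrightarrow>
     (\<forall>x\<in>S. f differentiable (at x)) \<and> (\<forall>v. Ck_on k S (\<lambda>x. frechet_derivative f (at x) v))"

definition smooth_on :: "'e::real_normed_vector set \<Rightarrow> ('e \<Rightarrow> 'f::real_normed_vector) \<Rightarrow> bool" where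
  "smooth_on S f \<longleftrightarrow> (\<forall>k. Ck_on k S f)"


section \<open>Manifolds\<close>

text \<open>A chart is a pair of an open domain and a coordinate map; the values of the coordinate map
  outside the domain are irrelevant.\<close>

type_synonym ('a, 'e) chart = "'a set \<times> ('a \<Rightarrow> 'e)"

abbreviation chart_dom :: "('a, 'e) chart \<Rightarrow> 'a set" where
  "chart_dom c \<equiv> fst c"

abbreviation coord :: "('a, 'e) chart \<Rightarrow> 'a \<Rightarrow> 'e" where
  "coord c \<equiv> snd c"

abbreviation param :: "('a, 'e) chart \<Rightarrow> 'e \<Rightarrow> 'a" where
  "param c \<equiv> inv_into (chart_dom c) (coord c)"

definition is_chart :: "('a::topological_space, 'e::real_normed_vector) chart \<Rightarrow> bool" where
  "is_chart c \<longleftrightarrow> open (chart_dom c) \<and> open (coord c ` chart_dom c) \<and>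
     homeomorphism (chart_dom c) (coord c ` chart_dom c) (coord c) (param c)"

text \<open>The manifold is the whole type \<open>'a\<close>. The model space is a finite-dimensional inner product
  space rather than a type of class \<open>euclidean_space\<close>, because that class excludes dimension 0.\<close>

locale smooth_manifold =
  fixes A :: "('a::{t2_space, second_countable_topology}, 'e::real_inner) chart set"
  assumes finite_dim: "\<exists>B::'e set. finite B \<and> span B = UNIV"
    and connected: "connected (UNIV :: 'a set)"
    and charts: "\<And>c. c \<in> A \<Longrightarrow> is_chart c"
    and cover: "(\<Union>c\<in>A. chart_dom c) = UNIV"
    and compatible: "\<And>c d. c \<in> A \<Longrightarrow> d \<in> A \<Longrightarrow>
      smooth_on (coord c ` (chart_dom c \<inter> chart_dom d)) (coord d \<circ> param c)"

definition transition_deriv ::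
    "('a, 'e::real_normed_vector) chart \<Rightarrow> ('a, 'e) chart \<Rightarrow> 'a \<Rightarrow> 'e \<Rightarrow>\<^sub>L 'e" where
  "transition_deriv c d p = Blinfun (frechet_derivative (coord d \<circ> param c) (at (coord c p)))"

definition smooth_function :: "('a, 'e::real_normed_vector) chart set \<Rightarrow> ('a \<Rightarrow> real) \<Rightarrow> bool" where
  "smooth_function A f \<longleftrightarrow> (\<forall>c\<in>A. smooth_on (coord c ` chart_dom c) (\<lambda>x. f (param c x)))"


section \<open>Tensor fields\<close>

text \<open>A tensor field is given by its components in all charts of the atlas, subject to the
  transformation law: \<open>X c p\<close> is the coordinate expression in the chart \<open>c\<close> of the value at the
  point \<open>p\<close>. Tangent vectors at \<open>p\<close> are thus represented in \<open>'e\<close> and covectors in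
  \<open>'e \<Rightarrow>\<^sub>L real\<close>, which is the full algebraic dual because \<open>'e\<close> is finite-dimensional.
  Vector fields and one-forms are set to 0 wherever the chart is irrelevant, so that equality of
  fields is equality of functions.\<close>

type_synonym ('a, 'e) vfield = "('a, 'e) chart \<Rightarrow> 'a \<Rightarrow> 'e"
type_synonym ('a, 'e) form1 = "('a, 'e) chart \<Rightarrow> 'a \<Rightarrow> 'e \<Rightarrow>\<^sub>L real"
type_synonym ('a, 'e) tensor20 =
  "('a, 'e) chart \<Rightarrow> 'a \<Rightarrow> ('e \<Rightarrow>\<^sub>L real) \<Rightarrow> ('e \<Rightarrow>\<^sub>L real) \<Rightarrow> real"

definition vector_field_on ::
    "('a, 'e::real_normed_vector) chart set \<Rightarrow> 'a set \<Rightarrow> ('a, 'e) vfield \<Rightarrow> bool" where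
  "vector_field_on A U X \<longleftrightarrow>
     (\<forall>c\<in>A. smooth_on (coord c ` (chart_dom c \<inter> U)) (\<lambda>x. X c (param c x))) \<and>
     (\<forall>c\<in>A. \<forall>d\<in>A. \<forall>p \<in> chart_dom c \<inter> chart_dom d \<inter> U.
        X d p = blinfun_apply (transition_deriv c d p) (X c p)) \<and>
     (\<forall>c p. c \<notin> A \<or> p \<notin> chart_dom c \<inter> U \<longrightarrow> X c p = 0)"

abbreviation vector_field ::
    "('a, 'e::real_normed_vector) chart set \<Rightarrow> ('a, 'e) vfield \<Rightarrow> bool" where
  "vector_field A \<equiv> vector_field_on A UNIV"

definition one_form :: "('a, 'e::real_normed_vector) chart set \<Rightarrow> ('a, 'e) form1 \<Rightarrow> bool" where
  "one_form A \<xi> \<longleftrightarrow>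
     (\<forall>c\<in>A. \<forall>v. smooth_on (coord c ` chart_dom c) (\<lambda>x. blinfun_apply (\<xi> c (param c x)) v)) \<and>
     (\<forall>c\<in>A. \<forall>d\<in>A. \<forall>p \<in> chart_dom c \<inter> chart_dom d.
        \<xi> c p = \<xi> d p o\<^sub>L transition_deriv c d p) \<and>
     (\<forall>c p. c \<notin> A \<or> p \<notin> chart_dom c \<longrightarrow> \<xi> c p = 0)"

text \<open>Elements of \<open>T\<^sub>pM \<otimes> T\<^sub>pM\<close> are bilinear forms on the cotangent space.\<close>

definition tensor20_field :: "('a, 'e::real_normed_vector) chart set \<Rightarrow> ('a, 'e) tensor20 \<Rightarrow> bool" where
  "tensor20_field A \<Theta> \<longleftrightarrow>
     (\<forall>c\<in>A. \<forall>p\<in>chart_dom c. bilinear (\<Theta> c p)) \<and>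
     (\<forall>c\<in>A. \<forall>\<alpha> \<beta>. smooth_on (coord c ` chart_dom c) (\<lambda>x. \<Theta> c (param c x) \<alpha> \<beta>)) \<and>
     (\<forall>c\<in>A. \<forall>d\<in>A. \<forall>p \<in> chart_dom c \<inter> chart_dom d. \<forall>\<alpha> \<beta>.
        \<Theta> d p \<alpha> \<beta> = \<Theta> c p (\<alpha> o\<^sub>L transition_deriv c d p) (\<beta> o\<^sub>L transition_deriv c d p))"

definition symmetric_tensor20 ::
    "('a, 'e::real_normed_vector) chart set \<Rightarrow> ('a, 'e) tensor20 \<Rightarrow> bool" where
  "symmetric_tensor20 A \<Theta> \<longleftrightarrow> tensor20_field A \<Theta> \<and>
     (\<forall>c\<in>A. \<forall>p\<in>chart_dom c. \<forall>\<alpha> \<beta>. \<Theta> c p \<alpha> \<beta> = \<Theta> c p \<beta> \<alpha>)"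

text \<open>The bundle morphism \<open>\<alpha> \<mapsto> \<Theta>(\<alpha>, \<cdot>)\<close>, whose values are tangent vectors via the
  identification of the tangent space with its bidual.\<close>

definition tensor_morphism ::
    "('a, 'e::real_normed_vector) tensor20 \<Rightarrow> ('a, 'e) chart \<Rightarrow> 'a \<Rightarrow> ('e \<Rightarrow>\<^sub>L real) \<Rightarrow> 'e" where
  "tensor_morphism \<Theta> c p \<alpha> = (THE v. \<forall>\<beta>. blinfun_apply \<beta> v = \<Theta> c p \<alpha> \<beta>)"

definition tensor_image ::
    "('a, 'e::real_normed_vector) tensor20 \<Rightarrow> ('a, 'e) chart \<Rightarrow> 'a \<Rightarrow> 'e set" where
  "tensor_image \<Theta> c p = range (tensor_morphism \<Theta> c p)"

definition constant_rank :: "('a, 'e::real_normed_vector) chart set \<Rightarrow> ('a, 'e) tensor20 \<Rightarrow> bool" where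
  "constant_rank A \<Theta> \<longleftrightarrow> (\<exists>r. \<forall>c\<in>A. \<forall>p\<in>chart_dom c. dim (tensor_image \<Theta> c p) = r)"


section \<open>Lie brackets and integrable distributions\<close>

text \<open>The derivative \<open>X f\<close> at \<open>p\<close>, computed in a chart \<open>c\<close> around \<open>p\<close>; only the values of \<open>f\<close> on
  the domain of \<open>c\<close> matter, and for differentiable \<open>f\<close> the result does not depend on \<open>c\<close>.\<close>

definition vderiv ::
    "('a, 'e::real_normed_vector) vfield \<Rightarrow> ('a \<Rightarrow> real) \<Rightarrow> ('a, 'e) chart \<Rightarrow> 'a \<Rightarrow> real" where
  "vderiv X f c p = frechet_derivative (\<lambda>x. f (param c x)) (at (coord c p)) (X c p)"

definition lie_bracket ::
    "('a, 'e::real_normed_vector) vfield \<Rightarrow> ('a, 'e) vfield \<Rightarrow> ('a, 'e) vfield" where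
  "lie_bracket X Y c p =
     frechet_derivative (\<lambda>x. Y c (param c x)) (at (coord c p)) (X c p) -
     frechet_derivative (\<lambda>x. X c (param c x)) (at (coord c p)) (Y c p)"

definition section_of ::
    "('a, 'e) chart set \<Rightarrow> 'a set \<Rightarrow> (('a, 'e) chart \<Rightarrow> 'a \<Rightarrow> 'e set) \<Rightarrow> ('a, 'e) vfield \<Rightarrow> bool" where
  "section_of A U D X \<longleftrightarrow> (\<forall>c\<in>A. \<forall>p \<in> chart_dom c \<inter> U. X c p \<in> D c p)"

text \<open>Here \<open>D c p\<close> is the fibre at \<open>p\<close> of a distribution, expressed in the chart \<open>c\<close>.\<close>

definition integrable_distribution ::
    "('a::topological_space, 'e::real_normed_vector) chart set \<Rightarrow>
      (('a, 'e) chart \<Rightarrow> 'a \<Rightarrow> 'e set) \<Rightarrow> bool" where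
  "integrable_distribution A D \<longleftrightarrow>
     (\<forall>U X Y. open U \<longrightarrow> vector_field_on A U X \<longrightarrow> vector_field_on A U Y \<longrightarrow>
        section_of A U D X \<longrightarrow> section_of A U D Y \<longrightarrow> section_of A U D (lie_bracket X Y))"


section \<open>Connections and integrable tensors\<close>

text \<open>Homogeneity over the reals in the second argument is the Leibniz rule for constant \<open>f\<close>.\<close>

definition connection ::
    "('a, 'e::real_normed_vector) chart set \<Rightarrow>
      (('a, 'e) vfield \<Rightarrow> ('a, 'e) vfield \<Rightarrow> ('a, 'e) vfield) \<Rightarrow> bool" where
  "connection A N \<longleftrightarrow>
     (\<forall>X Y. vector_field A X \<longrightarrow> vector_field A Y \<longrightarrow> vector_field A (N X Y)) \<and>
     (\<forall>X X' Y. vector_field A X \<longrightarrow> vector_field A X' \<longrightarrow> vector_field A Y \<longrightarrow>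
        N (\<lambda>c p. X c p + X' c p) Y = (\<lambda>c p. N X Y c p + N X' Y c p)) \<and>
     (\<forall>X Y Y'. vector_field A X \<longrightarrow> vector_field A Y \<longrightarrow> vector_field A Y' \<longrightarrow>
        N X (\<lambda>c p. Y c p + Y' c p) = (\<lambda>c p. N X Y c p + N X Y' c p)) \<and>
     (\<forall>f X Y. smooth_function A f \<longrightarrow> vector_field A X \<longrightarrow> vector_field A Y \<longrightarrow>
        N (\<lambda>c p. f p *\<^sub>R X c p) Y = (\<lambda>c p. f p *\<^sub>R N X Y c p)) \<and>
     (\<forall>f X Y. smooth_function A f \<longrightarrow> vector_field A X \<longrightarrow> vector_field A Y \<longrightarrow>
        N X (\<lambda>c p. f p *\<^sub>R Y c p) = (\<lambda>c p. f p *\<^sub>R N X Y c p + vderiv X f c p *\<^sub>R Y c p))"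

definition torsion_free ::
    "('a, 'e::real_normed_vector) chart set \<Rightarrow>
      (('a, 'e) vfield \<Rightarrow> ('a, 'e) vfield \<Rightarrow> ('a, 'e) vfield) \<Rightarrow> bool" where
  "torsion_free A N \<longleftrightarrow>
     (\<forall>X Y. vector_field A X \<longrightarrow> vector_field A Y \<longrightarrow>
        (\<forall>c\<in>A. \<forall>p\<in>chart_dom c. N X Y c p - N Y X c p = lie_bracket X Y c p))"

text \<open>The induced connection on one-forms:
  \<open>(\<nabla>\<^sub>X \<xi>)(Y) = X(\<xi>(Y)) - \<xi>(\<nabla>\<^sub>X Y)\<close> for all vector fields \<open>Y\<close>.\<close>

definition cov_deriv_form ::
    "('a, 'e::real_normed_vector) chart set \<Rightarrow>
      (('a, 'e) vfield \<Rightarrow> ('a, 'e) vfield \<Rightarrow> ('a, 'e) vfield) \<Rightarrow>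
      ('a, 'e) vfield \<Rightarrow> ('a, 'e) form1 \<Rightarrow> ('a, 'e) form1" where
  "cov_deriv_form A N X \<xi> = (THE \<zeta>. one_form A \<zeta> \<and>
     (\<forall>Y. vector_field A Y \<longrightarrow> (\<forall>c\<in>A. \<forall>p\<in>chart_dom c.
        blinfun_apply (\<zeta> c p) (Y c p) =
          vderiv X (\<lambda>q. blinfun_apply (\<xi> c q) (Y c q)) c p - blinfun_apply (\<xi> c p) (N X Y c p))))"

text \<open>The value \<open>(\<nabla>\<^sub>X \<Theta>)(\<xi>, \<eta>)\<close> at \<open>p\<close>, by the Leibniz rule.\<close>

definition cov_deriv_tensor20 ::
    "('a, 'e::real_normed_vector) chart set \<Rightarrow>
      (('a, 'e) vfield \<Rightarrow> ('a, 'e) vfield \<Rightarrow> ('a, 'e) vfield) \<Rightarrow>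
      ('a, 'e) vfield \<Rightarrow> ('a, 'e) tensor20 \<Rightarrow> ('a, 'e) form1 \<Rightarrow> ('a, 'e) form1 \<Rightarrow>
      ('a, 'e) chart \<Rightarrow> 'a \<Rightarrow> real" where
  "cov_deriv_tensor20 A N X \<Theta> \<xi> \<eta> c p =
     vderiv X (\<lambda>q. \<Theta> c q (\<xi> c q) (\<eta> c q)) c p
     - \<Theta> c p (cov_deriv_form A N X \<xi> c p) (\<eta> c p)
     - \<Theta> c p (\<xi> c p) (cov_deriv_form A N X \<eta> c p)"

definition parallel ::
    "('a, 'e::real_normed_vector) chart set \<Rightarrow>
      (('a, 'e) vfield \<Rightarrow> ('a, 'e) vfield \<Rightarrow> ('a, 'e) vfield) \<Rightarrow> ('a, 'e) tensor20 \<Rightarrow> bool" where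
  "parallel A N \<Theta> \<longleftrightarrow>
     (\<forall>X \<xi> \<eta>. vector_field A X \<longrightarrow> one_form A \<xi> \<longrightarrow> one_form A \<eta> \<longrightarrow>
        (\<forall>c\<in>A. \<forall>p\<in>chart_dom c. cov_deriv_tensor20 A N X \<Theta> \<xi> \<eta> c p = 0))"

definition integrable_tensor :: "('a, 'e::real_normed_vector) chart set \<Rightarrow> ('a, 'e) tensor20 \<Rightarrow> bool" where
  "integrable_tensor A \<Theta> \<longleftrightarrow> (\<exists>N. connection A N \<and> torsion_free A N \<and> parallel A N \<Theta>)"

end

theory Submission imports Defs begin

text \<open>In a chart, identify covectors with vectors through the inner product of the model space, so
  that \<open>\<Theta>\<close> becomes a smooth family \<open>S\<close> of symmetric operators of constant rank. Locally there is a
  smooth family \<open>G\<close> of symmetric operators with \<open>S G S = S\<close>; then \<open>S G\<close> projects onto the image of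
  \<open>S\<close> and \<open>1 - G S\<close> onto its kernel, so sections of the image and of the kernel extend from a point.

  If \<open>\<nabla>\<Theta> = 0\<close> and \<open>\<eta>\<close> is a one-form with \<open>\<Theta>(\<eta>, \<cdot>) = 0\<close>, then
  \<open>\<eta>(\<nabla>\<^sub>X \<Theta>(\<upsilon>, \<cdot>)) = 0\<close> for all \<open>X\<close> and \<open>\<upsilon>\<close>: covariant derivatives of sections of the image stay in
  the image, and so does the bracket, as \<open>\<nabla>\<close> is torsion-free.

  Conversely no Frobenius coordinates are needed. In a chart, \<open>\<nabla>\<Theta> = 0\<close> together with vanishing
  torsion is a linear system for the Christoffel symbols at each point. It is solvable because the
  derivative of \<open>S\<close> vanishes on the kernel of \<open>S\<close> (constant rank) and because the image is
  involutive, and \<open>G\<close> gives a solution depending smoothly on the point. As the solutions form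
  an affine space, a partition of unity glues the local connections.\<close>

section \<open>Calculus of smooth maps\<close>

text \<open>The obstacle is that a connection acts on global fields only, while image and kernel of
  the tensor are controlled near a point. Local objects are therefore multiplied by a cut-off and
  extended by zero, and tensoriality has to be established before a covariant derivative can be read
  off at a point; this is also what makes the definite description in \<open>cov_deriv_form\<close>
  denote.

  Constant rank enters only through the construction of G. With P the orthogonal projection onto the
  image at one point p, the operator P S P + (1 - P) is invertible at p, hence nearby, and G is its
  inverse compressed by P. That S G S = S persists away from p says that the rank does not jump up
  there.

  In the linear system for the Christoffel symbols, pairing with the kernel prescribes the part
  transverse to the image as soon as the second argument lies in the image. Symmetry then becomes a
  genuine condition only when both arguments lie in the image, and that condition is involutivity.
  The part along the image carries no obstruction: it is the Levi-Civita computation for the metric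
  dual to S.\<close>

lemma frechet_derivative_cong_open:
  assumes "open S" "x \<in> S" "\<And>y. y \<in> S \<Longrightarrow> f y = g y"
  shows "frechet_derivative f (at x) = frechet_derivative g (at x)"
proof -
  have "(f has_derivative D) (at x) \<longleftrightarrow> (g has_derivative D) (at x)" for D
    using has_derivative_transform_within_open[of f D x UNIV S g]
      has_derivative_transform_within_open[of g D x UNIV S f] assms by metis
  then show ?thesis by (simp add: frechet_derivative_def)
qed

lemma differentiable_cong_open:
  assumes "open S" "x \<in> S" "\<And>y. y \<in> S \<Longrightarrow> f y = g y" "f differentiable (at x)"
  shows "g differentiable (at x)"
  using has_derivative_transform_within_open[of f _ x UNIV S g] assms
  unfolding differentiable_def by metis

lemma Ck_on_cong:
  assumes "open S" "\<And>x. x \<in> S \<Longrightarrow> f x = g x" "Ck_on k S f"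
  shows "Ck_on k S g"
  using assms(2,3)
proof (induction k arbitrary: f g)
  case 0
  then show ?case by (simp cong: continuous_on_cong)
next
  case (Suc k)
  have "g differentiable (at x)" if "x \<in> S" for x
    using differentiable_cong_open[OF assms(1) that, of f g] Suc.prems that by auto
  moreover have "Ck_on k S (\<lambda>x. frechet_derivative g (at x) v)" for v
  proof (rule Suc.IH[of "\<lambda>x. frechet_derivative f (at x) v"])
    show "frechet_derivative f (at x) v = frechet_derivative g (at x) v" if "x \<in> S" for x
      using frechet_derivative_cong_open[OF assms(1) that, of f g] Suc.prems(1) by simp
  qed (use Suc.prems in auto)
  ultimately show ?case by simp
qed

text \<open>Holds for arbitrary subsets, since all derivatives are taken in the ambient space and
  not within the set.\<close>

lemma Ck_on_subset: "Ck_on k S f \<Longrightarrow> T \<subseteq> S \<Longrightarrow> Ck_on k T f"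
  by (induction k arbitrary: f) (auto intro: continuous_on_subset)

lemma Ck_on_imp_continuous_on: "Ck_on k S f \<Longrightarrow> continuous_on S f"
  by (cases k) (auto intro!: continuous_at_imp_continuous_on differentiable_imp_continuous_within)

lemma Ck_on_Suc_imp: "Ck_on (Suc k) S f \<Longrightarrow> Ck_on k S f"
proof (induction k arbitrary: f)
  case 0
  then show ?case using Ck_on_imp_continuous_on[of "Suc 0" S f] by simp
next
  case (Suc k)
  have "Ck_on (Suc k) S (\<lambda>x. frechet_derivative f (at x) v)" for v
    using Suc.prems unfolding Ck_on.simps(2)[of "Suc k"] by blast
  then show ?case
    using Suc.IH Suc.prems unfolding Ck_on.simps(2)[of "Suc k"] Ck_on.simps(2)[of k S f] by blast
qed

lemma Ck_on_local:
  assumes "\<And>x. x \<in> S \<Longrightarrow> \<exists>U. open U \<and> x \<in> U \<and> Ck_on k U f"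
  shows "Ck_on k S f"
  using assms
proof (induction k arbitrary: f)
  case 0
  show ?case
    unfolding Ck_on.simps
  proof (rule continuous_at_imp_continuous_on, rule ballI)
    fix x assume "x \<in> S"
    with 0 obtain U where "open U" "x \<in> U" "continuous_on U f" by auto
    then show "isCont f x" by (simp add: continuous_on_eq_continuous_at)
  qed
next
  case (Suc k)
  have "Ck_on k S (\<lambda>x. frechet_derivative f (at x) v)" for v
    by (rule Suc.IH) (use Suc.prems in fastforce)
  moreover have "f differentiable (at x)" if "x \<in> S" for x
    using Suc.prems[OF that] by auto
  ultimately show ?case by simp
qed

lemma Ck_on_const: "Ck_on k S (\<lambda>x. c)"
  by (induction k arbitrary: c) auto

lemma frechet_derivative_add:
  assumes "f differentiable (at x)" "g differentiable (at x)"
  shows "frechet_derivative (\<lambda>x. f x + g x) (at x) v = frechet_derivative f (at x) v + frechet_derivative g (at x) v"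
  using frechet_derivative_at[OF has_derivative_add[OF assms[unfolded frechet_derivative_works]]] by metis

lemma Ck_on_add:
  assumes "open S" "Ck_on k S f" "Ck_on k S g"
  shows "Ck_on k S (\<lambda>x. f x + g x)"
  using assms(2,3)
proof (induction k arbitrary: f g)
  case 0
  then show ?case by (auto intro: continuous_intros)
next
  case (Suc k)
  have eq: "frechet_derivative (\<lambda>x. f x + g x) (at x) v
      = frechet_derivative f (at x) v + frechet_derivative g (at x) v" if "x \<in> S" for x v
    by (rule frechet_derivative_add) (use Suc.prems that in auto)
  have "Ck_on k S (\<lambda>x. frechet_derivative (\<lambda>x. f x + g x) (at x) v)" for v
    by (rule Ck_on_cong[OF assms(1) _ Suc.IH[of "\<lambda>x. frechet_derivative f (at x) v" "\<lambda>x. frechet_derivative g (at x) v"]])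
      (use Suc.prems eq in auto)
  then show ?case using Suc.prems by auto
qed

lemma frechet_derivative_bilinear:
  assumes "bounded_bilinear bop" "f differentiable (at x)" "g differentiable (at x)"
  shows "(\<lambda>x. bop (f x) (g x)) differentiable (at x)"
    and "frechet_derivative (\<lambda>x. bop (f x) (g x)) (at x) v
      = bop (frechet_derivative f (at x) v) (g x) + bop (f x) (frechet_derivative g (at x) v)"
proof -
  have *: "((\<lambda>x. bop (f x) (g x)) has_derivative
      (\<lambda>v. bop (f x) (frechet_derivative g (at x) v) + bop (frechet_derivative f (at x) v) (g x))) (at x)"
    by (rule bounded_bilinear.FDERIV[OF assms(1)]) (use assms(2,3) frechet_derivative_works in auto)
  show "(\<lambda>x. bop (f x) (g x)) differentiable (at x)"
    using * by (rule differentiableI)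
  show "frechet_derivative (\<lambda>x. bop (f x) (g x)) (at x) v
      = bop (frechet_derivative f (at x) v) (g x) + bop (f x) (frechet_derivative g (at x) v)"
    unfolding frechet_derivative_at[OF *, symmetric] by simp
qed

text \<open>One product rule serves scaling, inner products, and evaluation and composition of
  operators. The induction closes because the derivative is a sum of two products of the same
  shape.\<close>

lemma Ck_on_bilinear:
  assumes "bounded_bilinear bop" "open S" "Ck_on k S f" "Ck_on k S g"
  shows "Ck_on k S (\<lambda>x. bop (f x) (g x))"
  using assms(3,4)
proof (induction k arbitrary: f g)
  case 0
  then show ?case by (auto intro: bounded_bilinear.continuous_on[OF assms(1)])
next
  case (Suc k)
  note D = frechet_derivative_bilinear[OF assms(1)]
  have "Ck_on k S (\<lambda>x. frechet_derivative (\<lambda>x. bop (f x) (g x)) (at x) v)" for v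
  proof (rule Ck_on_cong[OF assms(2)])
    show "Ck_on k S (\<lambda>x. bop (frechet_derivative f (at x) v) (g x) + bop (f x) (frechet_derivative g (at x) v))"
      by (intro Ck_on_add assms Suc.IH) (use Suc.prems Ck_on_Suc_imp in auto)
    show "bop (frechet_derivative f (at x) v) (g x) + bop (f x) (frechet_derivative g (at x) v) =
        frechet_derivative (\<lambda>x. bop (f x) (g x)) (at x) v" if "x \<in> S" for x
      by (rule D(2)[symmetric]) (use Suc.prems that in auto)
  qed
  moreover have "(\<lambda>x. bop (f x) (g x)) differentiable (at x)" if "x \<in> S" for x
    by (rule D(1)) (use Suc.prems that in auto)
  ultimately show ?case by simp
qed

lemma Ck_on_bounded_linear:
  assumes "bounded_linear h"
  shows "Ck_on k S h"
proof (cases k)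
  case (Suc l)
  have "(h has_derivative h) (at x)" for x
    using bounded_linear.has_derivative[OF assms has_derivative_ident] .
  then have "frechet_derivative h (at x) = h" "h differentiable (at x)" for x
    using frechet_derivative_at by (metis, meson differentiableI)
  then show ?thesis by (simp add: Suc Ck_on_const)
qed (simp add: assms linear_continuous_on)

lemma smooth_on_cong:
  assumes "open S" "\<And>x. x \<in> S \<Longrightarrow> f x = g x" "smooth_on S f"
  shows "smooth_on S g"
  using assms Ck_on_cong unfolding smooth_on_def by blast

lemma smooth_on_subset: "smooth_on S f \<Longrightarrow> T \<subseteq> S \<Longrightarrow> smooth_on T f"
  using Ck_on_subset unfolding smooth_on_def by blast

lemma smooth_on_local:
  assumes "\<And>x. x \<in> S \<Longrightarrow> \<exists>U. open U \<and> x \<in> U \<and> smooth_on U f"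
  shows "smooth_on S f"
  unfolding smooth_on_def using assms Ck_on_local unfolding smooth_on_def by metis

lemma smooth_on_imp_continuous_on: "smooth_on S f \<Longrightarrow> continuous_on S f"
  unfolding smooth_on_def using Ck_on.simps(1) by blast

lemma smooth_on_imp_differentiable: "smooth_on S f \<Longrightarrow> x \<in> S \<Longrightarrow> f differentiable (at x)"
  unfolding smooth_on_def using Ck_on.simps(2) by blast

lemma smooth_on_frechet_derivative:
  "smooth_on S f \<Longrightarrow> smooth_on S (\<lambda>x. frechet_derivative f (at x) v)"
  unfolding smooth_on_def using Ck_on.simps(2) by blast

lemma smooth_on_const: "smooth_on S (\<lambda>x. c)"
  by (simp add: smooth_on_def Ck_on_const)

lemma smooth_on_add:
  "open S \<Longrightarrow> smooth_on S f \<Longrightarrow> smooth_on S g \<Longrightarrow> smooth_on S (\<lambda>x. f x + g x)"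
  by (simp add: smooth_on_def Ck_on_add)

lemma smooth_on_bilinear:
  "bounded_bilinear bop \<Longrightarrow> open S \<Longrightarrow> smooth_on S f \<Longrightarrow> smooth_on S g
    \<Longrightarrow> smooth_on S (\<lambda>x. bop (f x) (g x))"
  by (simp add: smooth_on_def Ck_on_bilinear)

lemmas smooth_on_scaleR = smooth_on_bilinear[OF bounded_bilinear_scaleR]
lemmas smooth_on_mult = smooth_on_bilinear[OF bounded_bilinear_mult]
lemmas smooth_on_inner = smooth_on_bilinear[OF bounded_bilinear_inner]
lemma smooth_on_bounded_linear: "bounded_linear h \<Longrightarrow> smooth_on S h"
  by (simp add: smooth_on_def Ck_on_bounded_linear)

lemma smooth_on_diff:
  assumes "open S" "smooth_on S f" "smooth_on S g" shows "smooth_on S (\<lambda>x. f x - g x)"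
  using smooth_on_add[OF assms(1,2) smooth_on_scaleR[OF assms(1) smooth_on_const[of _ "-1"] assms(3)]] by simp

lemma smooth_on_sum:
  "open S \<Longrightarrow> (\<And>i. i \<in> I \<Longrightarrow> smooth_on S (f i)) \<Longrightarrow> smooth_on S (\<lambda>x. \<Sum>i\<in>I. f i x)"
  by (induction I rule: infinite_finite_induct) (auto intro: smooth_on_const smooth_on_add)

section \<open>Finite-dimensional inner product spaces\<close>

text \<open>Orthonormality together with the expansion of every vector; in this form the zero space
  has the empty basis.\<close>

definition is_onb :: "'e::real_inner set \<Rightarrow> bool" where
  "is_onb B \<longleftrightarrow> finite B \<and> (\<forall>b\<in>B. \<forall>b'\<in>B. b \<bullet> b' = of_bool (b = b')) \<and>
     (\<forall>v. v = (\<Sum>b\<in>B. (v \<bullet> b) *\<^sub>R b))"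

lemma is_onb_real: "is_onb {1::real}"
  by (simp add: is_onb_def)

lemma orthonormal_span_expansion:
  fixes B :: "'e::real_inner set"
  assumes "finite B" "\<And>b b'. b \<in> B \<Longrightarrow> b' \<in> B \<Longrightarrow> b \<bullet> b' = of_bool (b = b')" "v \<in> span B"
  shows "v = (\<Sum>b\<in>B. (v \<bullet> b) *\<^sub>R b)"
proof -
  obtain c where v: "v = (\<Sum>b\<in>B. c b *\<^sub>R b)"
    using assms(1,3) by (auto simp: span_finite)
  have "v \<bullet> b = c b" if "b \<in> B" for b
  proof -
    have "v \<bullet> b = (\<Sum>b'\<in>B. c b' * (b' \<bullet> b))" by (simp add: v inner_sum_left)
    also have "\<dots> = (\<Sum>b'\<in>B. if b' = b then c b' else 0)"
      by (rule sum.cong) (use assms(2) that in auto)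
    finally show ?thesis using that assms(1) by simp
  qed
  then have "(\<Sum>b\<in>B. (v \<bullet> b) *\<^sub>R b) = (\<Sum>b\<in>B. c b *\<^sub>R b)"
    by (intro sum.cong) auto
  then show ?thesis using v by argo
qed

lemma orthonormal_basis_span:
  fixes B :: "'e::real_inner set"
  assumes "finite B"
  obtains C where "finite C" "span C = span B" "\<And>b b'. b \<in> C \<Longrightarrow> b' \<in> C \<Longrightarrow> b \<bullet> b' = of_bool (b = b')"
proof -
  obtain C where C: "finite C" "span C = span B" "pairwise orthogonal C"
    using basis_orthogonal[OF assms] by blast
  \<comment> \<open>Orthogonalisation may leave the zero vector in \<open>C\<close>; it has to go
    before normalising.\<close>
  define C' where "C' = (\<lambda>v. v /\<^sub>R norm v) ` (C - {0})"
  have "span C' = span C"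
  proof (rule subset_antisym)
    show "span C' \<subseteq> span C"
      by (rule span_minimal) (auto simp: C'_def intro: span_mul span_base)
    show "span C \<subseteq> span C'"
    proof (rule span_minimal)
      show "C \<subseteq> span C'"
      proof
        fix v assume "v \<in> C"
        show "v \<in> span C'"
        proof (cases "v = 0")
          case False
          then have "v = norm v *\<^sub>R (v /\<^sub>R norm v)" "v /\<^sub>R norm v \<in> C'"
            using \<open>v \<in> C\<close> by (auto simp: C'_def)
          then show ?thesis by (metis span_base span_mul)
        qed (simp add: span_zero)
      qed
    qed simp
  qed
  moreover have "b \<bullet> b' = of_bool (b = b')" if "b \<in> C'" "b' \<in> C'" for b b'
  proof -
    obtain v v' where v: "v \<in> C" "v \<noteq> 0" "b = v /\<^sub>R norm v" "v' \<in> C" "v' \<noteq> 0" "b' = v' /\<^sub>R norm v'"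
      using \<open>b \<in> C'\<close> \<open>b' \<in> C'\<close> unfolding C'_def by blast
    show ?thesis
    proof (cases "v = v'")
      case True
      then show ?thesis using v by (simp add: dot_square_norm power2_eq_square)
    next
      case False
      then have "v \<bullet> v' = 0" using C(3) v by (auto simp: pairwise_def orthogonal_def)
      then have "b \<bullet> b' = 0" "b \<bullet> b = 1" using v by (auto simp: dot_square_norm power2_eq_square)
      then show ?thesis by auto
    qed
  qed
  ultimately show thesis using that[of C'] C by (auto simp: C'_def)
qed

lemma ex_onb:
  assumes "\<exists>B::'e::real_inner set. finite B \<and> span B = UNIV"
  shows "\<exists>B::'e set. is_onb B"
proof -
  obtain B :: "'e set" where "finite B" "span B = UNIV" using assms by blast
  then obtain C :: "'e set" where C: "finite C" "span C = UNIV" "\<And>b b'. b \<in> C \<Longrightarrow> b' \<in> C \<Longrightarrow> b \<bullet> b' = of_bool (b = b')"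
    by (metis orthonormal_basis_span)
  then have "v = (\<Sum>b\<in>C. (v \<bullet> b) *\<^sub>R b)" for v
    by (intro orthonormal_span_expansion) auto
  with C show ?thesis unfolding is_onb_def by blast
qed

lemma is_onb_expand: "is_onb B \<Longrightarrow> v = (\<Sum>b\<in>B. (v \<bullet> b) *\<^sub>R b)"
  by (simp add: is_onb_def)

lemma linear_onb:
  assumes "is_onb B" "linear h"
  shows "h v = (\<Sum>b\<in>B. (v \<bullet> b) *\<^sub>R h b)"
proof -
  have "h v = h (\<Sum>b\<in>B. (v \<bullet> b) *\<^sub>R b)" by (rule arg_cong[OF is_onb_expand[OF assms(1)]])
  also have "\<dots> = (\<Sum>b\<in>B. (v \<bullet> b) *\<^sub>R h b)"
    by (simp add: linear_sum[OF assms(2)] linear_scale[OF assms(2)])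
  finally show ?thesis .
qed

lemma onb_eqI:
  assumes "is_onb B" "\<And>b. b \<in> B \<Longrightarrow> v \<bullet> b = w \<bullet> b"
  shows "v = w"
proof -
  have "(\<Sum>b\<in>B. (v \<bullet> b) *\<^sub>R b) = (\<Sum>b\<in>B. (w \<bullet> b) *\<^sub>R b)"
    by (rule sum.cong) (use assms(2) in auto)
  then show ?thesis using is_onb_expand[OF assms(1)] by metis
qed

lemma linear_imp_bounded_linear_onb:
  fixes h :: "'e::real_inner \<Rightarrow> 'f::real_normed_vector"
  assumes "is_onb (B::'e set)" "linear h"
  shows "bounded_linear h"
proof -
  have "norm (h v) \<le> norm v * (\<Sum>b\<in>B. norm b * norm (h b))" for v
  proof -
    have "norm (h v) \<le> (\<Sum>b\<in>B. norm ((v \<bullet> b) *\<^sub>R h b))"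
      by (subst linear_onb[OF assms]) (rule norm_sum)
    also have "\<dots> \<le> (\<Sum>b\<in>B. norm v * (norm b * norm (h b)))"
    proof (rule sum_mono)
      fix b
      have "\<bar>v \<bullet> b\<bar> * norm (h b) \<le> (norm v * norm b) * norm (h b)"
        by (intro mult_right_mono Cauchy_Schwarz_ineq2) auto
      then show "norm ((v \<bullet> b) *\<^sub>R h b) \<le> norm v * (norm b * norm (h b))" by (simp add: mult.assoc)
    qed
    finally show ?thesis by (simp add: sum_distrib_left)
  qed
  then show ?thesis
    using assms(2) by (intro bounded_linear_intro[of h]) (auto simp: linear_iff)
qed

section \<open>Chain rule and smoothness along varying directions\<close>

lemma frechet_derivative_compose_onb:
  assumes B: "is_onb B" and "g differentiable (at x)" "f differentiable (at (g x))"
  shows "frechet_derivative (\<lambda>x. f (g x)) (at x) v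
    = (\<Sum>b\<in>B. (frechet_derivative g (at x) v \<bullet> b) *\<^sub>R frechet_derivative f (at (g x)) b)"
proof -
  have "frechet_derivative (\<lambda>x. f (g x)) (at x) v = frechet_derivative f (at (g x)) (frechet_derivative g (at x) v)"
    using frechet_derivative_compose[OF assms(2,3)] by (simp add: o_def)
  then show ?thesis by (rule trans[OF _ linear_onb[OF B linear_frechet_derivative[OF assms(3)]]])
qed

text \<open>\<open>Ck_on\<close> speaks of derivatives in fixed directions, whereas the chain rule
  differentiates f in the direction Dg(x) v, which moves with x. Expanding this direction in an
  orthonormal basis leaves fixed directions with scalar coefficients.\<close>

lemma Ck_on_compose:
  fixes g :: "'d::real_normed_vector \<Rightarrow> 'e::real_inner"
  assumes B: "is_onb (B::'e set)" and "open S" "open T" "g ` S \<subseteq> T" "Ck_on k S g" "Ck_on k T f"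
  shows "Ck_on k S (\<lambda>x. f (g x))"
  using assms(5,6)
proof (induction k arbitrary: f)
  case 0
  then show ?case using assms(4) by (auto intro: continuous_on_compose2)
next
  case (Suc k)
  have diff: "g differentiable (at x)" "f differentiable (at (g x))" if "x \<in> S" for x
    using Suc.prems that assms(4) by auto
  have "Ck_on k S (\<lambda>x. frechet_derivative (\<lambda>x. f (g x)) (at x) v)" for v
  proof (rule Ck_on_cong[OF assms(2)])
    have "finite B" using B by (simp add: is_onb_def)
    then show "Ck_on k S (\<lambda>x. \<Sum>b\<in>B. (frechet_derivative g (at x) v \<bullet> b) *\<^sub>R frechet_derivative f (at (g x)) b)"
    proof (induction B)
      case (insert b F)
      have "Ck_on k S (\<lambda>x. (frechet_derivative g (at x) v \<bullet> b) *\<^sub>R frechet_derivative f (at (g x)) b)"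
        by (intro Ck_on_bilinear[OF bounded_bilinear_scaleR] Ck_on_bilinear[OF bounded_bilinear_inner]
            Ck_on_const Suc.IH assms)
          (use Suc.prems Ck_on_Suc_imp in auto)
      with insert show ?case by (auto intro: Ck_on_add assms(2))
    qed (simp add: Ck_on_const)
  qed (use frechet_derivative_compose_onb[OF B diff] in auto)
  moreover have "(\<lambda>x. f (g x)) differentiable (at x)" if "x \<in> S" for x
    using differentiable_chain_at[OF diff[OF that]] by (simp add: o_def)
  ultimately show ?case by simp
qed

lemma smooth_on_compose:
  fixes g :: "'d::real_normed_vector \<Rightarrow> 'e::real_inner"
  assumes "is_onb (B::'e set)" "open S" "open T" "g ` S \<subseteq> T" "smooth_on S g" "smooth_on T f"
  shows "smooth_on S (\<lambda>x. f (g x))"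
  using assms(5,6) Ck_on_compose[OF assms(1-4)] unfolding smooth_on_def by metis

lemma smooth_on_frechet_derivative_field:
  fixes f :: "'e::real_inner \<Rightarrow> 'f::real_normed_vector"
  assumes "is_onb (B::'e set)" "open S" "smooth_on S f" "smooth_on S X"
  shows "smooth_on S (\<lambda>x. frechet_derivative f (at x) (X x))"
proof (rule smooth_on_cong[OF assms(2)])
  show "smooth_on S (\<lambda>x. \<Sum>b\<in>B. (X x \<bullet> b) *\<^sub>R frechet_derivative f (at x) b)"
    by (intro smooth_on_sum smooth_on_scaleR smooth_on_inner smooth_on_const smooth_on_frechet_derivative assms)
  show "(\<Sum>b\<in>B. (X x \<bullet> b) *\<^sub>R frechet_derivative f (at x) b) = frechet_derivative f (at x) (X x)" if "x \<in> S" for x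
    by (rule linear_onb[OF assms(1) linear_frechet_derivative[OF smooth_on_imp_differentiable[OF assms(3) that]], symmetric])
qed

section \<open>Symmetry of second derivatives\<close>

lemma DERIV_along_line:
  fixes f :: "'e::real_normed_vector \<Rightarrow> real"
  assumes "f differentiable (at (c + s *\<^sub>R u))"
  shows "((\<lambda>s. f (c + s *\<^sub>R u)) has_real_derivative frechet_derivative f (at (c + s *\<^sub>R u)) u) (at s)"
proof -
  let ?D = "frechet_derivative f (at (c + s *\<^sub>R u))"
  have D: "(f has_derivative ?D) (at (c + s *\<^sub>R u))"
    using assms frechet_derivative_works by blast
  have "((\<lambda>s. f (c + s *\<^sub>R u)) has_derivative (\<lambda>h. ?D (h *\<^sub>R u))) (at s)"
    by (rule has_derivative_compose[of "\<lambda>s. c + s *\<^sub>R u" _ s UNIV f ?D]) (auto intro!: derivative_eq_intros D)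
  moreover have "?D (h *\<^sub>R u) = ?D u * h" for h
    using linear_frechet_derivative[OF assms] by (simp add: linear_scale)
  ultimately show ?thesis by (simp add: has_field_derivative_def)
qed

text \<open>The mean value theorem twice: along u for the difference of f at two points that differ
  by h v, then along v for the resulting difference of first derivatives.\<close>

lemma second_difference_mean_value:
  fixes f :: "'e::real_normed_vector \<Rightarrow> real"
  assumes f: "Ck_on (Suc (Suc 0)) S f" and "h > 0"
    and S: "\<And>s t. 0 \<le> s \<Longrightarrow> s \<le> h \<Longrightarrow> 0 \<le> t \<Longrightarrow> t \<le> h \<Longrightarrow> x + s *\<^sub>R u + t *\<^sub>R v \<in> S"
  obtains s t where "0 < s" "s < h" "0 < t" "t < h"
    "f (x + h *\<^sub>R u + h *\<^sub>R v) - f (x + h *\<^sub>R u) - (f (x + h *\<^sub>R v) - f x) =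
      h * (h * frechet_derivative (\<lambda>y. frechet_derivative f (at y) u) (at (x + s *\<^sub>R u + t *\<^sub>R v)) v)"
proof -
  let ?f' = "\<lambda>y. frechet_derivative f (at y) u"
  have d1: "f differentiable (at y)" and d2: "?f' differentiable (at y)" if "y \<in> S" for y
    using f that by auto
  have "((\<lambda>s. f (x + h *\<^sub>R v + s *\<^sub>R u) - f (x + s *\<^sub>R u)) has_real_derivative
      ?f' (x + h *\<^sub>R v + s *\<^sub>R u) - ?f' (x + s *\<^sub>R u)) (at s)" if "0 \<le> s" "s \<le> h" for s
    using S[of s h] S[of s 0] that \<open>h > 0\<close>
    by (intro DERIV_diff DERIV_along_line d1) (auto simp: algebra_simps)
  from MVT2[OF \<open>h > 0\<close> this] obtain s where s: "0 < s" "s < h"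
    "f (x + h *\<^sub>R v + h *\<^sub>R u) - f (x + h *\<^sub>R u) - (f (x + h *\<^sub>R v) - f x)
      = h * (?f' (x + h *\<^sub>R v + s *\<^sub>R u) - ?f' (x + s *\<^sub>R u))" by auto
  have "((\<lambda>t. ?f' (x + s *\<^sub>R u + t *\<^sub>R v)) has_real_derivative
      frechet_derivative ?f' (at (x + s *\<^sub>R u + t *\<^sub>R v)) v) (at t)" if "0 \<le> t" "t \<le> h" for t
    using S[of s t] s that by (intro DERIV_along_line d2) auto
  from MVT2[OF \<open>h > 0\<close> this] obtain t where t: "0 < t" "t < h"
    "?f' (x + s *\<^sub>R u + h *\<^sub>R v) - ?f' (x + s *\<^sub>R u) = h * frechet_derivative ?f' (at (x + s *\<^sub>R u + t *\<^sub>R v)) v"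
    by auto
  show thesis
    by (rule that[OF s(1,2) t(1,2)]) (use s(3) t(3) in \<open>simp add: algebra_simps\<close>)
qed

text \<open>The second difference over a small parallelogram does not depend on the order of its
  sides, so the two mixed derivatives agree at two points near x. Continuity of both carries the
  agreement to x.\<close>

lemma frechet_derivative_commute_real:
  fixes f :: "'e::real_normed_vector \<Rightarrow> real"
  assumes "open S" "x \<in> S" "Ck_on (Suc (Suc 0)) S f"
  shows "frechet_derivative (\<lambda>y. frechet_derivative f (at y) u) (at x) v
    = frechet_derivative (\<lambda>y. frechet_derivative f (at y) v) (at x) u" (is "?A x = ?B x")
proof (rule ccontr)
  assume ne: "?A x \<noteq> ?B x"
  \<comment> \<open>Half the supposed gap: two errors below it cannot add up to the gap.\<close>
  define \<epsilon> where "\<epsilon> = \<bar>?A x - ?B x\<bar> / 2"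
  have "\<epsilon> > 0" using ne by (simp add: \<epsilon>_def)
  have "continuous_on S ?A" "continuous_on S ?B" using assms(3) by auto
  then have cont: "isCont ?A x" "isCont ?B x" using assms by (auto simp: continuous_on_eq_continuous_at)
  have ed: "\<exists>d>0. \<forall>y. dist y x < d \<longrightarrow> dist (g y) (g x) < \<epsilon>" if "isCont g x" for g :: "'e \<Rightarrow> real"
    using that \<open>\<epsilon> > 0\<close> unfolding continuous_at_eps_delta by blast
  obtain d1 where d1: "d1 > 0" "\<And>y. dist y x < d1 \<Longrightarrow> dist (?A y) (?A x) < \<epsilon>"
    using ed[OF cont(1)] by blast
  obtain d2 where d2: "d2 > 0" "\<And>y. dist y x < d2 \<Longrightarrow> dist (?B y) (?B x) < \<epsilon>"
    using ed[OF cont(2)] by blast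
  note d = d1 d2
  obtain d3 where d3: "d3 > 0" "ball x d3 \<subseteq> S" using assms(1,2) openE by blast
  \<comment> \<open>Small enough that the parallelogram lies in S and in both continuity
    neighbourhoods. The summand 1 keeps the denominator positive when u and v vanish and makes the
    distance bound strict.\<close>
  define h where "h = min d1 (min d2 d3) / (norm u + norm v + 1)"
  have "0 < norm u + norm v + 1" by (simp add: add_nonneg_pos)
  then have "h > 0" using d d3 by (auto simp: h_def)
  have close: "dist (x + s *\<^sub>R u + t *\<^sub>R v) x < min d1 (min d2 d3)" if "0 \<le> s" "s \<le> h" "0 \<le> t" "t \<le> h" for s t
  proof -
    have "dist (x + s *\<^sub>R u + t *\<^sub>R v) x \<le> s * norm u + t * norm v"
      using norm_triangle_ineq[of "s *\<^sub>R u" "t *\<^sub>R v"] that by (simp add: dist_norm)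
    also have "\<dots> \<le> h * norm u + h * norm v" using that by (intro add_mono mult_right_mono) auto
    also have "\<dots> < h * (norm u + norm v + 1)" using \<open>h > 0\<close> by (simp add: algebra_simps)
    also have "\<dots> = min d1 (min d2 d3)" using \<open>0 < norm u + norm v + 1\<close> by (simp add: h_def)
    finally show ?thesis .
  qed
  obtain s t where st: "0 < s" "s < h" "0 < t" "t < h"
    "f (x + h *\<^sub>R u + h *\<^sub>R v) - f (x + h *\<^sub>R u) - (f (x + h *\<^sub>R v) - f x) = h * (h * ?A (x + s *\<^sub>R u + t *\<^sub>R v))"
    by (rule second_difference_mean_value[OF assms(3) \<open>h > 0\<close>, of x u v])
      (use close d3(2) in \<open>force simp: dist_commute\<close>)
  have close': "x + s *\<^sub>R v + t *\<^sub>R u \<in> S" if "0 \<le> s" "s \<le> h" "0 \<le> t" "t \<le> h" for s t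
    using close[of t s] that d3(2) by (force simp: dist_commute algebra_simps)
  obtain s' t' where st': "0 < s'" "s' < h" "0 < t'" "t' < h"
    "f (x + h *\<^sub>R v + h *\<^sub>R u) - f (x + h *\<^sub>R v) - (f (x + h *\<^sub>R u) - f x) = h * (h * ?B (x + s' *\<^sub>R v + t' *\<^sub>R u))"
    by (rule second_difference_mean_value[OF assms(3) \<open>h > 0\<close> close']) auto
  have "h * (h * ?A (x + s *\<^sub>R u + t *\<^sub>R v)) = h * (h * ?B (x + s' *\<^sub>R v + t' *\<^sub>R u))"
    using st(5) st'(5) by (simp add: algebra_simps)
  then have "?A (x + s *\<^sub>R u + t *\<^sub>R v) = ?B (x + s' *\<^sub>R v + t' *\<^sub>R u)" using \<open>h > 0\<close> by simp
  moreover have "dist (?A (x + s *\<^sub>R u + t *\<^sub>R v)) (?A x) < \<epsilon>"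
    using close[of s t] st by (intro d(2)) auto
  moreover have "dist (?B (x + s' *\<^sub>R v + t' *\<^sub>R u)) (?B x) < \<epsilon>"
    using close[of t' s'] st' by (intro d(4)) (auto simp: algebra_simps)
  ultimately have "dist (?A x) (?B x) < \<epsilon> + \<epsilon>"
    using dist_triangle_less_add[of "?A x" "?A (x + s *\<^sub>R u + t *\<^sub>R v)" \<epsilon> "?B x" \<epsilon>] by (simp add: dist_commute)
  then show False by (simp add: dist_real_def \<epsilon>_def)
qed

lemma frechet_derivative_inner_left:
  assumes "f differentiable (at x)"
  shows "(\<lambda>y. f y \<bullet> b) differentiable (at x)"
    and "frechet_derivative (\<lambda>y. f y \<bullet> b) (at x) v = frechet_derivative f (at x) v \<bullet> b"
  using frechet_derivative_bilinear[OF bounded_bilinear_inner assms, of "\<lambda>_. b"] by auto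

lemma frechet_derivative_commute:
  fixes f :: "'e::real_normed_vector \<Rightarrow> 'f::real_inner"
  assumes "is_onb (B::'f set)" "open S" "x \<in> S" "smooth_on S f"
  shows "frechet_derivative (\<lambda>y. frechet_derivative f (at y) u) (at x) v
    = frechet_derivative (\<lambda>y. frechet_derivative f (at y) v) (at x) u"
proof (rule onb_eqI[OF assms(1)])
  fix b
  have *: "frechet_derivative (\<lambda>y. frechet_derivative f (at y) u) (at x) v \<bullet> b
    = frechet_derivative (\<lambda>y. frechet_derivative (\<lambda>y. f y \<bullet> b) (at y) u) (at x) v" for u v
  proof -
    have "frechet_derivative (\<lambda>y. frechet_derivative f (at y) u) (at x) v \<bullet> b
      = frechet_derivative (\<lambda>y. frechet_derivative f (at y) u \<bullet> b) (at x) v"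
      by (rule frechet_derivative_inner_left(2)[symmetric])
        (rule smooth_on_imp_differentiable[OF smooth_on_frechet_derivative[OF assms(4)] assms(3)])
    also have "frechet_derivative (\<lambda>y. frechet_derivative f (at y) u \<bullet> b) (at x)
      = frechet_derivative (\<lambda>y. frechet_derivative (\<lambda>y. f y \<bullet> b) (at y) u) (at x)"
      by (rule frechet_derivative_cong_open[OF assms(2,3)])
        (rule frechet_derivative_inner_left(2)[symmetric], rule smooth_on_imp_differentiable[OF assms(4)])
    finally show ?thesis .
  qed
  have "Ck_on (Suc (Suc 0)) S (\<lambda>y. f y \<bullet> b)"
    using smooth_on_inner[OF assms(2,4) smooth_on_const] unfolding smooth_on_def by blast
  then show "frechet_derivative (\<lambda>y. frechet_derivative f (at y) u) (at x) v \<bullet> b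
    = frechet_derivative (\<lambda>y. frechet_derivative f (at y) v) (at x) u \<bullet> b"
    unfolding * by (rule frechet_derivative_commute_real[OF assms(2,3)])
qed

section \<open>Inversion of operators\<close>

text \<open>A product of two factors vanishing at x is of second order even if one factor is merely
  continuous. It is needed for the increment of an inverse whose differentiability is still
  unknown.\<close>

lemma has_derivative_bilinear_null:
  fixes f :: "'a::real_normed_vector \<Rightarrow> 'b::real_normed_vector"
    and g :: "'a \<Rightarrow> 'c::real_normed_vector" and bop :: "'b \<Rightarrow> 'c \<Rightarrow> 'd::real_normed_vector"
  assumes "bounded_bilinear bop" "isCont f x" "f x = 0" "g differentiable (at x)" "g x = 0"
  shows "((\<lambda>y. bop (f y) (g y)) has_derivative (\<lambda>v. 0)) (at x)"
proof -
  interpret bounded_bilinear bop by fact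
  obtain D where D: "(g has_derivative D) (at x)" using assms(4) differentiable_def by blast
  obtain K where K: "K > 0" "\<And>a b. norm (bop a b) \<le> norm a * norm b * K" using pos_bounded by blast
  obtain M where M: "M > 0" "\<And>v. norm (D v) \<le> norm v * M"
    using bounded_linear.pos_bounded[OF has_derivative_bounded_linear[OF D]] by blast
  have lim: "((\<lambda>y. norm (g y - D (y - x)) / norm (y - x)) \<longlongrightarrow> 0) (at x)"
    using D assms(5) unfolding has_derivative_iff_norm by simp
  have "(f \<longlongrightarrow> 0) (at x)" using assms(2,3) by (simp add: isCont_def)
  then have fl: "((\<lambda>y. norm (f y)) \<longlongrightarrow> 0) (at x)" by (rule tendsto_norm_zero)
  have "((\<lambda>y. norm (f y) * (norm (g y - D (y - x)) / norm (y - x) + M) * K) \<longlongrightarrow> 0 * (0 + M) * K) (at x)"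
    by (intro tendsto_intros lim fl)
  then have lim': "((\<lambda>y. norm (f y) * (norm (g y - D (y - x)) / norm (y - x) + M) * K) \<longlongrightarrow> 0) (at x)"
    by simp
  have "norm (norm (bop (f y) (g y)) / norm (y - x))
      \<le> norm (f y) * (norm (g y - D (y - x)) / norm (y - x) + M) * K" if "y \<noteq> x" for y
  proof -
    have pos: "norm (y - x) > 0" using that by simp
    have "norm (g y) \<le> norm (g y - D (y - x)) + norm (y - x) * M"
      using norm_triangle_ineq[of "g y - D (y - x)" "D (y - x)"] M(2)[of "y - x"] by simp
    then have "norm (g y) \<le> (norm (g y - D (y - x)) / norm (y - x) + M) * norm (y - x)"
      using pos by (simp add: add_divide_distrib ring_distribs mult.commute)
    then have "norm (f y) * norm (g y) * K \<le> norm (f y) * ((norm (g y - D (y - x)) / norm (y - x) + M) * norm (y - x)) * K"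
      using K(1) by (intro mult_right_mono mult_left_mono) auto
    with K(2)[of "f y" "g y"] have "norm (bop (f y) (g y)) \<le> norm (f y) * (norm (g y - D (y - x)) / norm (y - x) + M) * K * norm (y - x)"
      by (simp add: mult_ac)
    then show ?thesis using pos by (simp add: pos_divide_le_eq)
  qed
  then have "\<forall>\<^sub>F y in at x. norm (norm (bop (f y) (g y)) / norm (y - x))
      \<le> norm (f y) * (norm (g y - D (y - x)) / norm (y - x) + M) * K"
    by (simp add: eventually_at_filter)
  from Lim_null_comparison[OF this lim']
  have "((\<lambda>y. norm (bop (f y) (g y)) / norm (y - x)) \<longlongrightarrow> 0) (at x)" .
  then show ?thesis unfolding has_derivative_iff_norm by (simp add: assms zero_left zero_right)
qed

context
  fixes T J :: "'d::real_normed_vector \<Rightarrow> 'e::real_normed_vector \<Rightarrow>\<^sub>L 'e" and S K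
  assumes S: "open S" and inv: "\<And>x. x \<in> S \<Longrightarrow> J x o\<^sub>L T x = id_blinfun" "\<And>x. x \<in> S \<Longrightarrow> T x o\<^sub>L J x = id_blinfun"
    and bound: "\<And>x. x \<in> S \<Longrightarrow> norm (J x) \<le> K"
begin

text \<open>The resolvent identity; with the uniform bound on J it gives continuity, and then the
  derivative, of the inverse.\<close>

lemma blinfun_inverse_diff:
  assumes "x \<in> S" "y \<in> S"
  shows "J y - J x = - (J y o\<^sub>L ((T y - T x) o\<^sub>L J x))"
proof (rule blinfun_eqI)
  fix v
  have "J y (T y w) = w" "T x (J x w) = w" for w
    using inv(1)[OF assms(2)] inv(2)[OF assms(1)] by (metis blinfun_apply_blinfun_compose id_blinfun.rep_eq id_apply)+
  then show "(J y - J x) v = (- (J y o\<^sub>L ((T y - T x) o\<^sub>L J x))) v"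
    by (simp add: blinfun.bilinear_simps)
qed

lemma continuous_on_blinfun_inverse:
  assumes "continuous_on S T"
  shows "continuous_on S J"
proof (rule continuous_at_imp_continuous_on, rule ballI)
  fix x assume x: "x \<in> S"
  have "(T \<longlongrightarrow> T x) (at x)" using assms S x by (simp add: continuous_on_eq_continuous_at isCont_def)
  then have "((\<lambda>y. norm (T y - T x)) \<longlongrightarrow> 0) (at x)" by (intro tendsto_norm_zero LIM_zero)
  then have lim: "((\<lambda>y. K * norm (T y - T x) * K) \<longlongrightarrow> K * 0 * K) (at x)" by (intro tendsto_intros)
  have K0: "K \<ge> 0" using bound[OF x] norm_ge_zero order_trans by blast
  have "norm (J y - J x) \<le> K * norm (T y - T x) * K" if "y \<in> S" for y
  proof -
    have "norm (J y - J x) \<le> norm (J y) * (norm (T y - T x) * norm (J x))"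
      unfolding blinfun_inverse_diff[OF x that] norm_minus_cancel
      by (rule order_trans[OF norm_blinfun_compose mult_left_mono[OF norm_blinfun_compose]]) simp
    also have "\<dots> \<le> K * (norm (T y - T x) * K)"
      using bound[OF x] bound[OF that] K0 by (intro mult_mono mult_left_mono) auto
    finally show ?thesis by (simp add: mult.assoc)
  qed
  moreover have "eventually (\<lambda>y. y \<in> S) (at x)" using S x by (simp add: eventually_at_in_open')
  ultimately have "eventually (\<lambda>y. norm (J y - J x) \<le> K * norm (T y - T x) * K) (at x)"
    by (auto elim: eventually_mono)
  from Lim_null_comparison[OF this] lim show "isCont J x" by (simp add: isCont_def LIM_zero_iff)
qed

text \<open>In the resolvent identity the left factor J y is split into J x and J y - J x. The first
  part is affine in T and yields the derivative; the second is a product of two vanishing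
  factors.\<close>

lemma has_derivative_blinfun_inverse:
  assumes "x \<in> S" "T differentiable (at x)" "isCont J x"
  shows "(J has_derivative (\<lambda>v. - (J x o\<^sub>L (frechet_derivative T (at x) v o\<^sub>L J x)))) (at x)"
proof -
  have dT: "((\<lambda>y. (T y - T x) o\<^sub>L J x) has_derivative (\<lambda>v. frechet_derivative T (at x) v o\<^sub>L J x)) (at x)"
    using bounded_linear.has_derivative[OF bounded_bilinear.bounded_linear_left[OF bounded_bilinear_blinfun_compose]
        has_derivative_diff[OF assms(2)[unfolded frechet_derivative_works] has_derivative_const[of "T x"]]] by simp
  have "((\<lambda>y. J x o\<^sub>L ((T y - T x) o\<^sub>L J x)) has_derivative (\<lambda>v. J x o\<^sub>L (frechet_derivative T (at x) v o\<^sub>L J x))) (at x)"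
    by (rule bounded_linear.has_derivative[OF bounded_bilinear.bounded_linear_right[OF bounded_bilinear_blinfun_compose] dT])
  moreover have "((\<lambda>y. (J y - J x) o\<^sub>L ((T y - T x) o\<^sub>L J x)) has_derivative (\<lambda>v. 0)) (at x)"
    by (rule has_derivative_bilinear_null[OF bounded_bilinear_blinfun_compose])
      (use dT differentiableI assms(3) in \<open>auto intro: continuous_intros\<close>)
  ultimately have "((\<lambda>y. J x + - (J x o\<^sub>L ((T y - T x) o\<^sub>L J x)) + - ((J y - J x) o\<^sub>L ((T y - T x) o\<^sub>L J x))) has_derivative
     (\<lambda>v. 0 + - (J x o\<^sub>L (frechet_derivative T (at x) v o\<^sub>L J x)) + - 0)) (at x)"
    by (intro has_derivative_add has_derivative_minus has_derivative_const)
  then have "((\<lambda>y. J x + - (J x o\<^sub>L ((T y - T x) o\<^sub>L J x)) + - ((J y - J x) o\<^sub>L ((T y - T x) o\<^sub>L J x))) has_derivative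
     (\<lambda>v. - (J x o\<^sub>L (frechet_derivative T (at x) v o\<^sub>L J x)))) (at x)" by simp
  then show ?thesis
  proof (rule has_derivative_transform_within_open[OF _ S assms(1)])
    fix y assume "y \<in> S"
    show "J x + - (J x o\<^sub>L ((T y - T x) o\<^sub>L J x)) + - ((J y - J x) o\<^sub>L ((T y - T x) o\<^sub>L J x)) = J y"
      using blinfun_inverse_diff[OF assms(1) \<open>y \<in> S\<close>]
      unfolding bounded_bilinear.diff_left[OF bounded_bilinear_blinfun_compose, of "J y" "J x"]
      by (metis (no_types, lifting) add.commute add.inverse_inverse add_uminus_conv_diff diff_add_cancel minus_diff_eq group_cancel.sub1 add_diff_cancel_left' diff_diff_eq2)
  qed
qed

text \<open>The derivative of J is a product of J and a derivative of T, so J gains one order of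
  smoothness at each step of the induction.\<close>

lemma Ck_on_blinfun_inverse: "Ck_on k S T \<Longrightarrow> Ck_on k S J"
proof (induction k)
  case 0
  then show ?case using continuous_on_blinfun_inverse by simp
next
  case (Suc k)
  have cont: "isCont J x" if "x \<in> S" for x
    using continuous_on_blinfun_inverse[OF Ck_on_imp_continuous_on[OF Suc.prems]] that S
    by (simp add: continuous_on_eq_continuous_at)
  have der: "(J has_derivative (\<lambda>v. - (J x o\<^sub>L (frechet_derivative T (at x) v o\<^sub>L J x)))) (at x)" if "x \<in> S" for x
    by (rule has_derivative_blinfun_inverse[OF that]) (use Suc.prems cont that in auto)
  have J: "Ck_on k S J" using Suc.IH Ck_on_Suc_imp[OF Suc.prems] by blast
  have "Ck_on k S (\<lambda>x. frechet_derivative J (at x) v)" for v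
  proof (rule Ck_on_cong[OF S])
    show "Ck_on k S (\<lambda>x. (-1) *\<^sub>R (J x o\<^sub>L (frechet_derivative T (at x) v o\<^sub>L J x)))"
      by (intro Ck_on_bilinear[OF bounded_bilinear_blinfun_compose] Ck_on_bilinear[OF bounded_bilinear_scaleR] J S Ck_on_const)
        (use Suc.prems in auto)
    show "(-1) *\<^sub>R (J x o\<^sub>L (frechet_derivative T (at x) v o\<^sub>L J x)) = frechet_derivative J (at x) v" if "x \<in> S" for x
      using frechet_derivative_at[OF der[OF that]] by (metis scaleR_minus1_left)
  qed
  then show ?case using differentiableI[OF der] by simp
qed

lemma smooth_on_blinfun_inverse: "smooth_on S T \<Longrightarrow> smooth_on S J"
  by (simp add: smooth_on_def Ck_on_blinfun_inverse)

end

lemma Ck_on_inverse: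
  fixes f :: "'d::real_normed_vector \<Rightarrow> real"
  assumes "open S" "\<And>x. x \<in> S \<Longrightarrow> f x \<noteq> 0"
  shows "Ck_on k S f \<Longrightarrow> Ck_on k S (\<lambda>x. inverse (f x))"
proof (induction k)
  case 0
  then show ?case using assms by (auto intro: continuous_intros)
next
  case (Suc k)
  have der: "((\<lambda>x. inverse (f x)) has_derivative (\<lambda>v. - (inverse (f x) * frechet_derivative f (at x) v * inverse (f x)))) (at x)"
    if "x \<in> S" for x
    by (rule Deriv.has_derivative_inverse) (use Suc.prems that assms frechet_derivative_works in auto)
  have J: "Ck_on k S (\<lambda>x. inverse (f x))" using Suc.IH Ck_on_Suc_imp[OF Suc.prems] by blast
  have "Ck_on k S (\<lambda>x. frechet_derivative (\<lambda>x. inverse (f x)) (at x) v)" for v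
  proof (rule Ck_on_cong[OF assms(1)])
    show "Ck_on k S (\<lambda>x. (-1) * (inverse (f x) * frechet_derivative f (at x) v * inverse (f x)))"
      by (intro Ck_on_bilinear[OF bounded_bilinear_mult] J assms Ck_on_const) (use Suc.prems in auto)
    show "(-1) * (inverse (f x) * frechet_derivative f (at x) v * inverse (f x)) = frechet_derivative (\<lambda>x. inverse (f x)) (at x) v"
      if "x \<in> S" for x
      using frechet_derivative_at[OF der[OF that]] by (metis mult_minus1)
  qed
  moreover have "(\<lambda>x. inverse (f x)) differentiable (at x)" if "x \<in> S" for x
    using differentiableI[OF der[OF that]] .
  ultimately show ?case by simp
qed

lemma smooth_on_divide:
  fixes f g :: "'d::real_normed_vector \<Rightarrow> real"
  assumes "open S" "\<And>x. x \<in> S \<Longrightarrow> g x \<noteq> 0" "smooth_on S f" "smooth_on S g"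
  shows "smooth_on S (\<lambda>x. f x / g x)"
  unfolding divide_inverse
  by (intro smooth_on_mult assms) (use assms Ck_on_inverse[of S g] in \<open>auto simp: smooth_on_def\<close>)

section \<open>Smooth cut-off functions on the real line\<close>

text \<open>For m = 0 this is the classical function exp(-1/t) extended by zero. With the powers of
  1/t the derivatives are linear combinations of members of the same family, so one induction proves
  all of them smooth.\<close>

definition flat_exp :: "nat \<Rightarrow> real \<Rightarrow> real" where
  "flat_exp m t = (if t \<le> 0 then 0 else inverse t ^ m * exp (- inverse t))"

lemma power_le_fact_exp: "y \<ge> 0 \<Longrightarrow> y ^ n \<le> fact n * exp (y::real)"
proof -
  assume "y \<ge> 0"
  have "(\<Sum>k\<in>{n}. y ^ k /\<^sub>R fact k) \<le> (\<Sum>k. y ^ k /\<^sub>R fact k)"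
    using exp_converges[of y] \<open>y \<ge> 0\<close> by (intro sum_le_suminf) (auto simp: sums_iff)
  then show ?thesis using exp_converges[of y] by (simp add: sums_iff field_simps)
qed

text \<open>The exponential beats two more powers of 1/t than are present, which leaves a factor
  \<open>t\<^sup>2\<close>; one of its two factors survives in the difference quotient at 0 and
  sends it to 0.\<close>

lemma flat_exp_bound: "\<bar>flat_exp m t\<bar> \<le> fact (m + 2) * t\<^sup>2"
proof (cases "t \<le> 0")
  case False
  then have "inverse t ^ (m + 2) \<le> fact (m + 2) * exp (inverse t)" by (intro power_le_fact_exp) auto
  then have "inverse t ^ (m + 2) * exp (- inverse t) \<le> fact (m + 2)"
    unfolding exp_minus using pos_divide_le_eq[OF exp_gt_zero] by (metis divide_inverse)
  then have "t\<^sup>2 * (inverse t ^ (m + 2) * exp (- inverse t)) \<le> t\<^sup>2 * fact (m + 2)"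
    by (intro mult_left_mono) auto
  moreover have "t\<^sup>2 * (inverse t ^ (m + 2) * exp (- inverse t)) = (t\<^sup>2 * inverse t ^ 2) * (inverse t ^ m * exp (- inverse t))"
    by (simp only: power_add mult_ac)
  moreover have "t\<^sup>2 * inverse t ^ 2 = 1" using False by (simp add: field_simps)
  ultimately have "inverse t ^ m * exp (- inverse t) \<le> t\<^sup>2 * fact (m + 2)" by (simp only: mult_1_left)
  then show ?thesis using False by (simp add: flat_exp_def mult.commute del: fact_Suc)
qed (simp add: flat_exp_def)

lemma DERIV_flat_exp:
  "(flat_exp m has_real_derivative flat_exp (m + 2) t - real m * flat_exp (m + 1) t) (at t)"
proof -
  consider "t < 0" | "t = 0" | "t > 0" by linarith
  then show ?thesis
  proof cases
    case 1
    have "((\<lambda>_. 0) has_real_derivative flat_exp (m + 2) t - real m * flat_exp (m + 1) t) (at t)"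
      using 1 by (simp add: flat_exp_def)
    then show ?thesis
      by (rule has_field_derivative_transform_within_open[of _ _ _ "{..<0}"]) (use 1 in \<open>auto simp: flat_exp_def\<close>)
  next
    case 2
    have "norm ((flat_exp m (0 + h) - flat_exp m 0) / h) \<le> fact (m + 2) * \<bar>h\<bar>" for h
      using flat_exp_bound[of m h]
      by (cases "h = 0") (auto simp: flat_exp_def[of m 0] divide_le_eq power2_eq_square mult_ac abs_mult[symmetric] simp del: fact_Suc)
    then have ev: "\<forall>\<^sub>F h in at 0. norm ((flat_exp m (0 + h) - flat_exp m 0) / h) \<le> fact (m + 2) * \<bar>h\<bar>"
      by (simp only: eventually_True)
    have "((\<lambda>h::real. fact (m + 2) * \<bar>h\<bar>) \<longlongrightarrow> fact (m + 2) * \<bar>0\<bar>) (at 0)" by (intro tendsto_intros)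
    then have "((\<lambda>h::real. fact (m + 2) * \<bar>h\<bar>) \<longlongrightarrow> 0) (at 0)" by (simp only: abs_zero mult_zero_right)
    from Lim_null_comparison[OF ev this]
    have "((\<lambda>h. (flat_exp m (0 + h) - flat_exp m 0) / h) \<longlongrightarrow> 0) (at 0)" .
    then show ?thesis using 2 by (simp add: DERIV_def flat_exp_def)
  next
    case 3
    have "(inverse has_real_derivative - (inverse t ^ 2)) (at t)"
      using DERIV_inverse[of t UNIV] 3 by (simp add: numeral_2_eq_2)
    from DERIV_power[OF this, of m] have d1: "((\<lambda>t. inverse t ^ m) has_real_derivative - (real m * inverse t ^ (m + 1))) (at t)"
      by (cases m) (auto simp: power2_eq_square mult_ac)
    have d2: "((\<lambda>t. exp (- inverse t)) has_real_derivative exp (- inverse t) * inverse t ^ 2) (at t)"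
      using 3 by (auto intro!: derivative_eq_intros simp: power2_eq_square)
    from DERIV_mult[OF d1 d2] have "((\<lambda>t. inverse t ^ m * exp (- inverse t)) has_real_derivative
      flat_exp (m + 2) t - real m * flat_exp (m + 1) t) (at t)"
      using 3 by (simp add: flat_exp_def power2_eq_square algebra_simps)
    then show ?thesis
      by (rule has_field_derivative_transform_within_open[of _ _ _ "{0<..}"]) (use 3 in \<open>auto simp: flat_exp_def\<close>)
  qed
qed

lemma smooth_on_flat_exp: "smooth_on S (flat_exp m)"
proof -
  have "Ck_on k UNIV (flat_exp m)" for k
  proof (induction k arbitrary: m)
    case 0
    show ?case using DERIV_flat_exp by (auto intro!: DERIV_continuous_on)
  next
    case (Suc k)
    have eq: "v * flat_exp (m + 2) t + (- (v * real m)) * flat_exp (m + 1) t = frechet_derivative (flat_exp m) (at t) v" for v t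
      unfolding frechet_derivative_at[OF DERIV_flat_exp[of m t, unfolded has_field_derivative_def], symmetric]
      by (simp add: algebra_simps)
    have "Ck_on k UNIV (\<lambda>t. v * flat_exp (m + 2) t + (- (v * real m)) * flat_exp (m + 1) t)" for v
      by (intro Ck_on_add Ck_on_bilinear[OF bounded_bilinear_mult] Ck_on_const Suc.IH) auto
    moreover have "flat_exp m differentiable (at t)" for t
      using DERIV_flat_exp differentiableI has_field_derivative_def by blast
    ultimately show ?case unfolding eq by simp
  qed
  then show ?thesis unfolding smooth_on_def using Ck_on_subset by blast
qed

definition rbump :: "real \<Rightarrow> real" where "rbump = flat_exp 0"

lemma smooth_on_rbump: "smooth_on S rbump"
  by (simp add: rbump_def smooth_on_flat_exp)

lemma rbump_pos_iff: "rbump t > 0 \<longleftrightarrow> t > 0" and rbump_nonneg: "rbump t \<ge> 0"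
  and rbump_eq_0_iff: "rbump t = 0 \<longleftrightarrow> t \<le> 0"
  by (auto simp: rbump_def flat_exp_def)

text \<open>The denominator never vanishes, because 1 - t and t - 1/2 are not both nonpositive; the
  quotient is 1 up to 1/2 and 0 from 1 on.\<close>

definition rplateau :: "real \<Rightarrow> real" where
  "rplateau t = rbump (1 - t) / (rbump (1 - t) + rbump (t - 1/2))"

lemma smooth_on_rplateau: "smooth_on S rplateau"
proof -
  have a: "smooth_on UNIV (\<lambda>t. rbump (1 - t))" "smooth_on UNIV (\<lambda>t. rbump (t - 1/2))"
    by (rule smooth_on_compose[OF is_onb_real _ open_UNIV _ _ smooth_on_rbump];
        auto intro: smooth_on_diff smooth_on_const smooth_on_bounded_linear[OF bounded_linear_ident])+
  have "rbump (1 - t) + rbump (t - 1/2) \<noteq> 0" for t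
    using rbump_nonneg[of "1 - t"] rbump_nonneg[of "t - 1/2"] rbump_eq_0_iff[of "1 - t"] rbump_eq_0_iff[of "t - 1/2"]
    by linarith
  then have "smooth_on UNIV rplateau"
    unfolding rplateau_def by (intro smooth_on_divide smooth_on_add a) auto
  then show ?thesis by (rule smooth_on_subset) simp
qed

lemma rplateau_eq_1: "t \<le> 1/2 \<Longrightarrow> rplateau t = 1"
  using rbump_pos_iff[of "1 - t"] by (simp add: rplateau_def rbump_eq_0_iff[of "t - 1/2", THEN iffD2])

lemma rplateau_eq_0: "t \<ge> 1 \<Longrightarrow> rplateau t = 0"
  by (simp add: rplateau_def rbump_eq_0_iff[of "1 - t", THEN iffD2])

section \<open>Compactness and linear maps in finite dimension\<close>

text \<open>In coordinates, the box with sides from -r to r is a finite sum of compact segments,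
  hence compact, and the ball around 0 is a closed subset of it.\<close>

lemma compact_cball_onb:
  assumes B: "is_onb (B::'e::real_inner set)"
  shows "compact (cball (x::'e) r)"
proof -
  have fin: "finite B" and on: "\<And>b. b \<in> B \<Longrightarrow> norm b = 1" using B by (auto simp: is_onb_def norm_eq_1)
  have "compact {\<Sum>b\<in>F. c b *\<^sub>R b |c. \<forall>b\<in>F. c b \<in> {-r..r}}" if "finite F" for F :: "'e set"
    using that
  proof induction
    case (insert a F)
    have "{\<Sum>b\<in>insert a F. c b *\<^sub>R b |c. \<forall>b\<in>insert a F. c b \<in> {-r..r}}
      = {x + y |x y. x \<in> (\<lambda>t. t *\<^sub>R a) ` {-r..r} \<and> y \<in> {\<Sum>b\<in>F. c b *\<^sub>R b |c. \<forall>b\<in>F. c b \<in> {-r..r}}}" (is "?L = ?R")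
    proof
      show "?L \<subseteq> ?R" using insert.hyps by (auto 4 4)
      show "?R \<subseteq> ?L"
      proof clarify
        fix t c assume t: "t \<in> {-r..r}" and c: "\<forall>b\<in>F. c b \<in> {-r..r}"
        have "(\<Sum>b\<in>F. (c(a := t)) b *\<^sub>R b) = (\<Sum>b\<in>F. c b *\<^sub>R b)"
          by (rule sum.cong) (use insert.hyps in auto)
        then have "t *\<^sub>R a + (\<Sum>b\<in>F. c b *\<^sub>R b) = (\<Sum>b\<in>insert a F. (c(a := t)) b *\<^sub>R b)"
          using insert.hyps by simp
        moreover have "\<forall>b\<in>insert a F. (c(a := t)) b \<in> {-r..r}" using t c by auto
        ultimately show "\<exists>c'. t *\<^sub>R a + (\<Sum>b\<in>F. c b *\<^sub>R b) = (\<Sum>b\<in>insert a F. c' b *\<^sub>R b) \<and> (\<forall>b\<in>insert a F. c' b \<in> {-r..r})"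
          by blast
      qed
    qed
    moreover have "compact ((\<lambda>t. t *\<^sub>R a) ` {-r..r})"
      by (intro compact_continuous_image continuous_intros) auto
    ultimately show ?case using compact_sums[OF _ insert.IH] by simp
  qed simp
  from this[OF fin] have "compact ({\<Sum>b\<in>B. c b *\<^sub>R b |c. \<forall>b\<in>B. c b \<in> {-r..r}} \<inter> cball 0 r)"
    by (rule compact_Int_closed) simp
  moreover have "cball 0 r \<subseteq> {\<Sum>b\<in>B. c b *\<^sub>R b |c. \<forall>b\<in>B. c b \<in> {-r..r}}"
  proof
    fix v :: 'e assume "v \<in> cball 0 r"
    then have "\<bar>v \<bullet> b\<bar> \<le> r" if "b \<in> B" for b
      using Cauchy_Schwarz_ineq2[of v b] on[OF that] by simp
    then have "\<forall>b\<in>B. v \<bullet> b \<in> {-r..r}" by (metis abs_le_iff atLeastAtMost_iff minus_le_iff)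
    then show "v \<in> {\<Sum>b\<in>B. c b *\<^sub>R b |c. \<forall>b\<in>B. c b \<in> {-r..r}}"
      using is_onb_expand[OF B, of v] by blast
  qed
  ultimately have "compact (cball (0::'e) r)" by (simp add: Int_absorb1)
  from compact_translation[OF this, of x] show ?thesis by (simp add: image_add_cball)
qed

lemma finite_dimensional_vector_space_onb:
  assumes B: "is_onb (B::'e::real_inner set)"
  shows "finite_dimensional_vector_space ((*\<^sub>R) :: real \<Rightarrow> 'e \<Rightarrow> 'e) B"
proof (unfold_locales, unfold span_raw_def[symmetric] dependent_raw_def[symmetric])
  show "finite B" using B by (simp add: is_onb_def)
  have "0 \<notin> B"
  proof
    assume "0 \<in> B"
    then have "(0::'e) \<bullet> 0 = of_bool ((0::'e) = 0)" using B unfolding is_onb_def by blast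
    then show False by simp
  qed
  moreover have "pairwise orthogonal B" using B by (auto simp: is_onb_def pairwise_def orthogonal_def)
  ultimately show "independent B" by (simp add: pairwise_orthogonal_independent)
  have "v \<in> span B" for v
    by (subst is_onb_expand[OF B, of v]) (intro span_sum span_mul span_base)
  then show "span B = UNIV" by auto
qed

lemma inj_linear_imp_surj_onb:
  fixes f :: "'e::real_inner \<Rightarrow> 'e"
  assumes "is_onb (B::'e set)" "linear f" "inj f"
  shows "surj f"
proof -
  interpret finite_dimensional_vector_space "(*\<^sub>R) :: real \<Rightarrow> 'e \<Rightarrow> 'e" B
    using finite_dimensional_vector_space_onb[OF assms(1)] .
  show ?thesis using linear_inj_imp_surj[of f] assms(2,3) by (simp add: linear_def)
qed

text \<open>For use in the rank argument: a linearly independent subset of V with at least dim V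
  elements already spans V.\<close>

lemma subspace_eq_span_onb:
  fixes V :: "'e::real_inner set"
  assumes "is_onb (B::'e set)" "independent C" "C \<subseteq> V" "dim V \<le> card C"
  shows "V \<subseteq> span C"
proof -
  interpret finite_dimensional_vector_space "(*\<^sub>R) :: real \<Rightarrow> 'e \<Rightarrow> 'e" B
    using finite_dimensional_vector_space_onb[OF assms(1)] .
  show ?thesis
    using card_ge_dim_independent[of C V] assms(2-) by (simp add: span_raw_def dependent_raw_def dim_raw_def)
qed

section \<open>Charts\<close>

definition onb :: "'e::real_inner set" where
  "onb = (SOME B. is_onb B)"

text \<open>The vector-valued form of \<open>vderiv\<close>, which also differentiates the
  components of fields and families of operators.\<close>

definition cderiv :: "('a, 'e::real_normed_vector) chart \<Rightarrow> ('a \<Rightarrow> 'f::real_normed_vector) \<Rightarrow> 'a \<Rightarrow> 'e \<Rightarrow> 'f" where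
  "cderiv c f p = frechet_derivative (\<lambda>x. f (param c x)) (at (coord c p))"

lemma vderiv_eq_cderiv: "vderiv X f c p = cderiv c f p (X c p)"
  by (simp add: vderiv_def cderiv_def)

lemma lie_bracket_eq_cderiv: "lie_bracket X Y c p = cderiv c (Y c) p (X c p) - cderiv c (X c) p (Y c p)"
  by (simp add: lie_bracket_def cderiv_def)

context smooth_manifold
begin

lemma is_onb: "is_onb (onb :: 'e set)"
  unfolding onb_def using someI_ex[OF ex_onb[OF finite_dim]] .

lemma blinfun_apply_Blinfun_linear: "linear f \<Longrightarrow> blinfun_apply (Blinfun f) v = f v" for f :: "'e \<Rightarrow> 'f::real_normed_vector"
  by (rule bounded_linear_Blinfun_apply[THEN fun_cong]) (rule linear_imp_bounded_linear_onb[OF is_onb])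

lemma chart_homeo: "c \<in> A \<Longrightarrow> homeomorphism (chart_dom c) (coord c ` chart_dom c) (coord c) (param c)"
  using charts unfolding is_chart_def by blast

lemma open_chart_dom: "c \<in> A \<Longrightarrow> open (chart_dom c)"
  using charts unfolding is_chart_def by blast

lemma param_coord: "c \<in> A \<Longrightarrow> p \<in> chart_dom c \<Longrightarrow> param c (coord c p) = p"
  using chart_homeo homeomorphism_apply1 by blast

lemma coord_inj: "c \<in> A \<Longrightarrow> p \<in> chart_dom c \<Longrightarrow> q \<in> chart_dom c \<Longrightarrow> coord c p = coord c q \<Longrightarrow> p = q"
  using param_coord by metis

lemma open_coord_image:
  assumes "c \<in> A" "open W" "W \<subseteq> chart_dom c"
  shows "open (coord c ` W)"
proof -
  have "open (coord c ` chart_dom c \<inter> param c -` W)"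
    by (rule continuous_open_preimage)
      (use charts[OF assms(1)] assms(2) homeomorphism_cont2[OF chart_homeo[OF assms(1)]] in \<open>auto simp: is_chart_def\<close>)
  moreover have "coord c ` chart_dom c \<inter> param c -` W = coord c ` W"
    using assms param_coord[OF assms(1)] by (force simp: image_iff)
  ultimately show ?thesis by simp
qed

lemma open_coord_vimage:
  assumes "c \<in> A" "open V"
  shows "open {p \<in> chart_dom c. coord c p \<in> V}"
proof -
  have "open (chart_dom c \<inter> coord c -` V)"
    by (rule continuous_open_preimage)
      (use open_chart_dom homeomorphism_cont1[OF chart_homeo] assms in auto)
  then show ?thesis by (simp add: vimage_def Int_def)
qed

lemma ex_chart: obtains c where "c \<in> A" "p \<in> chart_dom c"
  using cover by blast

lemma smooth_on_chart_change:
  assumes "c \<in> A" "d \<in> A" "open W" "W \<subseteq> chart_dom c" "W \<subseteq> chart_dom d"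
    and "smooth_on (coord d ` W) (\<lambda>x. f (param d x))"
  shows "smooth_on (coord c ` W) (\<lambda>x. f (param c x))"
proof (rule smooth_on_cong)
  show op: "open (coord c ` W)" by (rule open_coord_image) (use assms in auto)
  have sm: "smooth_on (coord c ` W) (coord d \<circ> param c)"
    by (rule smooth_on_subset[OF compatible[OF assms(1,2)]]) (use assms in auto)
  show "smooth_on (coord c ` W) (\<lambda>x. f (param d ((coord d \<circ> param c) x)))"
    by (rule smooth_on_compose[OF is_onb op _ _ sm assms(6)])
      (use assms open_coord_image param_coord in \<open>auto simp: image_iff subset_iff\<close>)
  show "f (param d ((coord d \<circ> param c) x)) = f (param c x)" if "x \<in> coord c ` W" for x
    using that assms param_coord by (auto simp: subset_iff)
qed

section \<open>Smoothness near a point of the manifold\<close>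

text \<open>Smoothness as a property of functions on the manifold at a point. It gives calculus
  rules that mention neither coordinate images nor parametrisations; independence of the chart is
  \<open>smooth_near_chart\<close>.\<close>

definition smooth_near :: "('a \<Rightarrow> 'f::real_normed_vector) \<Rightarrow> 'a \<Rightarrow> bool" where
  "smooth_near f p \<longleftrightarrow> (\<exists>c\<in>A. \<exists>W. open W \<and> p \<in> W \<and> W \<subseteq> chart_dom c \<and> smooth_on (coord c ` W) (\<lambda>x. f (param c x)))"

lemma smooth_near_chart:
  assumes "smooth_near f p" "c \<in> A" "p \<in> chart_dom c"
  obtains W where "open W" "p \<in> W" "W \<subseteq> chart_dom c" "open (coord c ` W)" "smooth_on (coord c ` W) (\<lambda>x. f (param c x))"
proof -
  obtain d W where d: "d \<in> A" "open W" "p \<in> W" "W \<subseteq> chart_dom d" "smooth_on (coord d ` W) (\<lambda>x. f (param d x))"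
    using assms unfolding smooth_near_def by blast
  have o: "open (W \<inter> chart_dom c)" by (intro open_Int open_chart_dom d assms)
  show thesis
  proof (rule that[of "W \<inter> chart_dom c"])
    show "smooth_on (coord c ` (W \<inter> chart_dom c)) (\<lambda>x. f (param c x))"
      by (rule smooth_on_chart_change[OF assms(2) d(1) o])
        (use d in \<open>auto intro: smooth_on_subset[OF d(5)]\<close>)
  qed (use o d assms open_coord_image in auto)
qed

lemma smooth_nearI:
  "c \<in> A \<Longrightarrow> open W \<Longrightarrow> p \<in> W \<Longrightarrow> W \<subseteq> chart_dom c \<Longrightarrow> smooth_on (coord c ` W) (\<lambda>x. f (param c x)) \<Longrightarrow> smooth_near f p"
  unfolding smooth_near_def by blast

lemma smooth_near_cong:
  assumes "open U" "p \<in> U" "\<And>q. q \<in> U \<Longrightarrow> f q = g q" "smooth_near f p"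
  shows "smooth_near g p"
proof -
  obtain c W where c: "c \<in> A" "open W" "p \<in> W" "W \<subseteq> chart_dom c" "smooth_on (coord c ` W) (\<lambda>x. f (param c x))"
    using assms unfolding smooth_near_def by blast
  show ?thesis
  proof (rule smooth_nearI[of c "W \<inter> U"])
    show "smooth_on (coord c ` (W \<inter> U)) (\<lambda>x. g (param c x))"
    proof (rule smooth_on_cong)
      show "open (coord c ` (W \<inter> U))" using c assms by (intro open_coord_image) auto
      show "smooth_on (coord c ` (W \<inter> U)) (\<lambda>x. f (param c x))" by (rule smooth_on_subset[OF c(5)]) auto
      show "f (param c x) = g (param c x)" if "x \<in> coord c ` (W \<inter> U)" for x
        using that c assms(3) param_coord by (auto simp: subset_iff)
    qed
  qed (use c assms in auto)
qed

lemma smooth_near_smooth_on: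
  assumes "c \<in> A" "open U" "\<And>p. p \<in> chart_dom c \<inter> U \<Longrightarrow> smooth_near f p"
  shows "smooth_on (coord c ` (chart_dom c \<inter> U)) (\<lambda>x. f (param c x))"
proof (rule smooth_on_local)
  fix x assume "x \<in> coord c ` (chart_dom c \<inter> U)"
  then obtain p where p: "p \<in> chart_dom c" "p \<in> U" "x = coord c p" by blast
  obtain W where "open W" "p \<in> W" "W \<subseteq> chart_dom c" "open (coord c ` W)" "smooth_on (coord c ` W) (\<lambda>x. f (param c x))"
    using smooth_near_chart[of f p c] assms p by blast
  then show "\<exists>U. open U \<and> x \<in> U \<and> smooth_on U (\<lambda>x. f (param c x))" using p by blast
qed

lemma smooth_near_chart2:
  assumes "smooth_near f p" "smooth_near g p" "c \<in> A" "p \<in> chart_dom c"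
  obtains W where "open W" "p \<in> W" "W \<subseteq> chart_dom c" "open (coord c ` W)"
    "smooth_on (coord c ` W) (\<lambda>x. f (param c x))" "smooth_on (coord c ` W) (\<lambda>x. g (param c x))"
proof -
  obtain W where W: "open W" "p \<in> W" "W \<subseteq> chart_dom c" "smooth_on (coord c ` W) (\<lambda>x. f (param c x))"
    using smooth_near_chart[OF assms(1,3,4)] .
  obtain W' where W': "open W'" "p \<in> W'" "W' \<subseteq> chart_dom c" "smooth_on (coord c ` W') (\<lambda>x. g (param c x))"
    using smooth_near_chart[OF assms(2,3,4)] .
  have s: "coord c ` (W \<inter> W') \<subseteq> coord c ` W" "coord c ` (W \<inter> W') \<subseteq> coord c ` W'" by auto
  show thesis
    by (rule that[of "W \<inter> W'"])
      (use W W' assms smooth_on_subset[OF W(4) s(1)] smooth_on_subset[OF W'(4) s(2)] in \<open>auto intro!: open_coord_image\<close>)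
qed

lemma smooth_near_bilinear:
  assumes "bounded_bilinear bop" "smooth_near f p" "smooth_near g p"
  shows "smooth_near (\<lambda>q. bop (f q) (g q)) p"
proof -
  obtain c where c: "c \<in> A" "p \<in> chart_dom c" using ex_chart .
  obtain W where W: "open W" "p \<in> W" "W \<subseteq> chart_dom c" "open (coord c ` W)"
    "smooth_on (coord c ` W) (\<lambda>x. f (param c x))" "smooth_on (coord c ` W) (\<lambda>x. g (param c x))"
    using smooth_near_chart2[OF assms(2,3) c] .
  show ?thesis
    by (rule smooth_nearI[OF c(1) W(1-3) smooth_on_bilinear[OF assms(1) W(4)]]) (use W in auto)
qed

lemmas smooth_near_scaleR = smooth_near_bilinear[OF bounded_bilinear_scaleR]
lemmas smooth_near_mult = smooth_near_bilinear[OF bounded_bilinear_mult]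
lemmas smooth_near_inner = smooth_near_bilinear[OF bounded_bilinear_inner]
lemmas smooth_near_blinfun_apply = smooth_near_bilinear[OF bounded_bilinear_blinfun_apply]
lemmas smooth_near_blinfun_compose = smooth_near_bilinear[OF bounded_bilinear_blinfun_compose]

lemma smooth_near_const: "smooth_near (\<lambda>q. v) p"
proof -
  obtain c where c: "c \<in> A" "p \<in> chart_dom c" using ex_chart .
  show ?thesis by (rule smooth_nearI[of c "chart_dom c"]) (use c open_chart_dom smooth_on_const in auto)
qed

lemma smooth_near_add:
  assumes "smooth_near f p" "smooth_near g p"
  shows "smooth_near (\<lambda>q. f q + g q) p"
proof -
  obtain c where c: "c \<in> A" "p \<in> chart_dom c" using ex_chart .
  obtain W where W: "open W" "p \<in> W" "W \<subseteq> chart_dom c" "open (coord c ` W)"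
    "smooth_on (coord c ` W) (\<lambda>x. f (param c x))" "smooth_on (coord c ` W) (\<lambda>x. g (param c x))"
    using smooth_near_chart2[OF assms(1,2) c] .
  show ?thesis
    by (rule smooth_nearI[OF c(1) W(1-3) smooth_on_add[OF W(4)]]) (use W in auto)
qed

lemma smooth_near_diff:
  assumes "smooth_near f p" "smooth_near g p"
  shows "smooth_near (\<lambda>q. f q - g q) p"
  using smooth_near_add[OF assms(1) smooth_near_scaleR[OF smooth_near_const[of "-1"] assms(2)]] by simp

lemma smooth_near_sum:
  "(\<And>i. i \<in> I \<Longrightarrow> smooth_near (f i) p) \<Longrightarrow> smooth_near (\<lambda>q. \<Sum>i\<in>I. f i q) p"
  by (induction I rule: infinite_finite_induct) (auto intro: smooth_near_const smooth_near_add)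

lemma smooth_near_prod:
  fixes f :: "'i \<Rightarrow> 'a \<Rightarrow> real"
  shows "(\<And>i. i \<in> I \<Longrightarrow> smooth_near (f i) p) \<Longrightarrow> smooth_near (\<lambda>q. \<Prod>i\<in>I. f i q) p"
  by (induction I rule: infinite_finite_induct) (auto intro: smooth_near_const smooth_near_mult)

lemma smooth_near_linear:
  assumes "bounded_linear h" "smooth_near f p"
  shows "smooth_near (\<lambda>q. h (f q)) p"
proof -
  have "bounded_bilinear (\<lambda>r y. r *\<^sub>R h y)"
    by (rule bounded_bilinear.comp[OF bounded_bilinear_scaleR bounded_linear_ident assms(1)])
  from smooth_near_bilinear[OF this smooth_near_const[of 1] assms(2)] show ?thesis by simp
qed

lemma smooth_near_compose:
  fixes f :: "'a \<Rightarrow> 'f::real_inner"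
  assumes "is_onb (B::'f set)" "open V" "f p \<in> V" "smooth_on V g" "smooth_near f p"
  shows "smooth_near (\<lambda>q. g (f q)) p"
proof -
  obtain c where c: "c \<in> A" "p \<in> chart_dom c" using ex_chart .
  obtain W where W: "open W" "p \<in> W" "W \<subseteq> chart_dom c" "open (coord c ` W)" "smooth_on (coord c ` W) (\<lambda>x. f (param c x))"
    using smooth_near_chart[OF assms(5) c] .
  let ?S = "coord c ` W \<inter> (\<lambda>x. f (param c x)) -` V"
  have o: "open ?S"
    by (rule continuous_open_preimage[OF smooth_on_imp_continuous_on[OF W(5)] W(4) assms(2)])
  define W' where "W' = {q \<in> chart_dom c. coord c q \<in> ?S}"
  have W'W: "W' \<subseteq> W" using W coord_inj[OF c(1)] unfolding W'_def by blast
  have oW': "open W'" unfolding W'_def by (rule open_coord_vimage[OF c(1) o])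
  show ?thesis
  proof (rule smooth_nearI[OF c(1) oW'])
    show "p \<in> W'" using W c assms(3) param_coord by (auto simp: W'_def)
    show "W' \<subseteq> chart_dom c" by (auto simp: W'_def)
    show "smooth_on (coord c ` W') (\<lambda>x. g (f (param c x)))"
    proof (rule smooth_on_compose[OF assms(1) _ assms(2) _ _ assms(4)])
      show "open (coord c ` W')" using oW' W'W W by (intro open_coord_image c) auto
      show "(\<lambda>x. f (param c x)) ` coord c ` W' \<subseteq> V" by (auto simp: W'_def)
      show "smooth_on (coord c ` W') (\<lambda>x. f (param c x))"
        by (rule smooth_on_subset[OF W(5)]) (use W'W in auto)
    qed
  qed
qed

lemma smooth_near_coord:
  assumes "c \<in> A" "p \<in> chart_dom c"
  shows "smooth_near (coord c) p"
proof (rule smooth_nearI[OF assms(1) open_chart_dom[OF assms(1)] assms(2) order_refl])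
  show "smooth_on (coord c ` chart_dom c) (\<lambda>x. coord c (param c x))"
    by (rule smooth_on_cong[of _ "\<lambda>x. x"])
      (use assms param_coord open_coord_image[OF assms(1) open_chart_dom[OF assms(1)]] in
        \<open>auto intro: smooth_on_bounded_linear bounded_linear_ident\<close>)
qed

text \<open>In finite dimension an operator is a finite sum of rank-one operators built from its
  values on the basis, so pointwise smoothness implies smoothness in the operator norm.\<close>

lemma smooth_near_blinfunI:
  fixes F :: "'a \<Rightarrow> 'e \<Rightarrow>\<^sub>L 'f::real_normed_vector"
  assumes "open U" "p \<in> U" "\<And>v. smooth_near (\<lambda>q. F q v) p"
  shows "smooth_near F p"
proof (rule smooth_near_cong[OF assms(1,2)])
  show "smooth_near (\<lambda>q. \<Sum>b\<in>onb. blinfun_scaleR_left (F q b) o\<^sub>L blinfun_inner_right b) p"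
    by (intro smooth_near_sum smooth_near_blinfun_compose smooth_near_const assms
        smooth_near_linear[OF bounded_linear_blinfun_scaleR_left])
  show "(\<Sum>b\<in>onb. blinfun_scaleR_left (F x b) o\<^sub>L blinfun_inner_right b) = F x" for x
  proof (rule blinfun_eqI)
    fix v
    have "(\<Sum>b\<in>onb. blinfun_scaleR_left (F x b) o\<^sub>L blinfun_inner_right b) v = (\<Sum>b\<in>onb. (v \<bullet> b) *\<^sub>R F x b)"
      by (simp add: blinfun.sum_left inner_commute)
    also have "\<dots> = F x v"
      by (rule linear_onb[OF is_onb, symmetric]) (simp add: blinfun.bounded_linear_right bounded_linear.linear)
    finally show "(\<Sum>b\<in>onb. blinfun_scaleR_left (F x b) o\<^sub>L blinfun_inner_right b) v = F x v" .
  qed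
qed

section \<open>Differentiation in a chart\<close>

lemma differentiable_chart:
  assumes "smooth_near f p" "c \<in> A" "p \<in> chart_dom c"
  shows "(\<lambda>x. f (param c x)) differentiable (at (coord c p))"
proof -
  obtain W where W: "open W" "p \<in> W" "W \<subseteq> chart_dom c" "smooth_on (coord c ` W) (\<lambda>x. f (param c x))"
    using smooth_near_chart[OF assms] .
  then show ?thesis using smooth_on_imp_differentiable by blast
qed

lemma linear_cderiv:
  assumes "smooth_near f p" "c \<in> A" "p \<in> chart_dom c"
  shows "linear (cderiv c f p)"
  unfolding cderiv_def by (rule linear_frechet_derivative[OF differentiable_chart[OF assms]])

lemma cderiv_bilinear:
  assumes "bounded_bilinear bop" "smooth_near f p" "smooth_near g p" "c \<in> A" "p \<in> chart_dom c"
  shows "cderiv c (\<lambda>q. bop (f q) (g q)) p v = bop (cderiv c f p v) (g p) + bop (f p) (cderiv c g p v)"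
  unfolding cderiv_def
  using frechet_derivative_bilinear(2)[OF assms(1) differentiable_chart[OF assms(2,4,5)] differentiable_chart[OF assms(3,4,5)]]
  by (simp add: param_coord[OF assms(4,5)])

lemma cderiv_add:
  assumes "smooth_near f p" "smooth_near g p" "c \<in> A" "p \<in> chart_dom c"
  shows "cderiv c (\<lambda>q. f q + g q) p v = cderiv c f p v + cderiv c g p v"
  unfolding cderiv_def by (rule frechet_derivative_add) (intro differentiable_chart assms)+

lemma cderiv_const: "cderiv c (\<lambda>q. a) p v = 0"
  by (simp add: cderiv_def)

lemma cderiv_linear:
  assumes "bounded_linear h" "smooth_near f p" "c \<in> A" "p \<in> chart_dom c"
  shows "cderiv c (\<lambda>q. h (f q)) p v = h (cderiv c f p v)"
proof -
  have "bounded_bilinear (\<lambda>r y. r *\<^sub>R h y)"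
    by (rule bounded_bilinear.comp[OF bounded_bilinear_scaleR bounded_linear_ident assms(1)])
  from cderiv_bilinear[OF this smooth_near_const[of 1] assms(2,3,4)] show ?thesis
    by (simp add: cderiv_const)
qed

lemma cderiv_cong:
  assumes "open U" "p \<in> U" "\<And>q. q \<in> U \<Longrightarrow> f q = g q" "c \<in> A" "p \<in> chart_dom c"
  shows "cderiv c f p = cderiv c g p"
  unfolding cderiv_def
proof (rule frechet_derivative_cong_open)
  show "open (coord c ` (chart_dom c \<inter> U))" using assms open_chart_dom[OF assms(4)] by (intro open_coord_image) auto
  show "f (param c x) = g (param c x)" if "x \<in> coord c ` (chart_dom c \<inter> U)" for x
    using that assms param_coord by auto
qed (use assms in auto)

lemma smooth_near_cderiv:
  assumes "smooth_near f p" "smooth_near V p" "c \<in> A" "p \<in> chart_dom c"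
  shows "smooth_near (\<lambda>q. cderiv c f q (V q)) p"
proof -
  obtain W where W: "open W" "p \<in> W" "W \<subseteq> chart_dom c" "open (coord c ` W)"
    "smooth_on (coord c ` W) (\<lambda>x. f (param c x))" "smooth_on (coord c ` W) (\<lambda>x. V (param c x))"
    using smooth_near_chart2[OF assms] .
  have "smooth_on (coord c ` W) (\<lambda>x. frechet_derivative (\<lambda>x. f (param c x)) (at x) (V (param c x)))"
    by (rule smooth_on_frechet_derivative_field[OF is_onb W(4-6)])
  then have "smooth_on (coord c ` W) (\<lambda>x. cderiv c f (param c x) (V (param c x)))"
    by (rule smooth_on_cong[OF W(4), rotated]) (use W param_coord assms in \<open>auto simp: cderiv_def subset_iff\<close>)
  then show ?thesis by (rule smooth_nearI[OF assms(3) W(1-3)])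
qed

section \<open>Transition maps and fields\<close>

abbreviation trans :: "('a, 'e) chart \<Rightarrow> ('a, 'e) chart \<Rightarrow> 'a \<Rightarrow> 'e \<Rightarrow>\<^sub>L 'e" where
  "trans \<equiv> transition_deriv"

lemma trans_apply:
  assumes "c \<in> A" "d \<in> A" "p \<in> chart_dom c" "p \<in> chart_dom d"
  shows "trans c d p v = cderiv c (coord d) p v"
  using linear_cderiv[OF smooth_near_coord[OF assms(2,4)] assms(1,3)]
  by (simp add: transition_deriv_def cderiv_def o_def blinfun_apply_Blinfun_linear)

lemma cderiv_chart_change:
  assumes "smooth_near f p" "c \<in> A" "d \<in> A" "p \<in> chart_dom c" "p \<in> chart_dom d"
  shows "cderiv c f p v = cderiv d f p (trans c d p v)"
proof -
  have "cderiv c f p = cderiv c (\<lambda>q. f (param d (coord d q))) p"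
    by (rule cderiv_cong[of "chart_dom d"]) (use assms open_chart_dom param_coord in auto)
  also have "\<dots> = frechet_derivative ((\<lambda>x. f (param d x)) \<circ> (\<lambda>x. coord d (param c x))) (at (coord c p))"
    by (simp add: cderiv_def o_def)
  also have "\<dots> = frechet_derivative (\<lambda>x. f (param d x)) (at (coord d (param c (coord c p)))) \<circ> cderiv c (coord d) p"
    unfolding cderiv_def
    by (rule frechet_derivative_compose)
      (use assms differentiable_chart[OF smooth_near_coord[of d p], of c] differentiable_chart[of f p d] in \<open>simp_all add: param_coord\<close>)
  finally show ?thesis using assms by (simp add: param_coord trans_apply cderiv_def[of d])
qed

lemma trans_self: "c \<in> A \<Longrightarrow> p \<in> chart_dom c \<Longrightarrow> trans c c p v = v"
proof -
  assume c: "c \<in> A" "p \<in> chart_dom c"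
  have o: "open (coord c ` chart_dom c)" using c open_chart_dom open_coord_image by blast
  have "cderiv c (coord c) p = frechet_derivative (\<lambda>x. x) (at (coord c p))"
    unfolding cderiv_def by (rule frechet_derivative_cong_open[OF o]) (use c param_coord in auto)
  then show ?thesis using c trans_apply by simp
qed

lemma trans_comp:
  assumes "c \<in> A" "d \<in> A" "e \<in> A" "p \<in> chart_dom c" "p \<in> chart_dom d" "p \<in> chart_dom e"
  shows "trans d e p (trans c d p v) = trans c e p v"
  using cderiv_chart_change[OF smooth_near_coord[of e p] assms(1,2,4,5), of v] assms by (simp add: trans_apply)

lemma smooth_near_trans:
  assumes "c \<in> A" "d \<in> A" "p \<in> chart_dom c" "p \<in> chart_dom d"
  shows "smooth_near (trans c d) p"
proof (rule smooth_near_blinfunI)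
  show "open (chart_dom c \<inter> chart_dom d)" by (intro open_Int open_chart_dom assms)
  show "smooth_near (\<lambda>q. trans c d q v) p" for v
  proof (rule smooth_near_cong)
    show "open (chart_dom c \<inter> chart_dom d)" by (intro open_Int open_chart_dom assms)
    show "smooth_near (\<lambda>q. cderiv c (coord d) q v) p"
      by (intro smooth_near_cderiv smooth_near_coord smooth_near_const assms)
  qed (use assms trans_apply in auto)
qed (use assms in auto)

text \<open>Symmetry of the second derivative of the transition map, which is what makes the Lie
  bracket transform as a vector.\<close>

lemma cderiv_trans_commute:
  assumes "c \<in> A" "d \<in> A" "p \<in> chart_dom c" "p \<in> chart_dom d"
  shows "cderiv c (trans c d) p u v = cderiv c (trans c d) p v u"
proof -
  define W where "W = chart_dom c \<inter> chart_dom d"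
  have W: "open W" "p \<in> W" "W \<subseteq> chart_dom c" "W \<subseteq> chart_dom d" unfolding W_def by (intro open_Int open_chart_dom assms) (use assms in auto)
  have o: "open (coord c ` W)" using W assms by (intro open_coord_image) auto
  have *: "cderiv c (trans c d) p u v
    = frechet_derivative (\<lambda>y. frechet_derivative (\<lambda>x. coord d (param c x)) (at y) v) (at (coord c p)) u" for u v
  proof -
    have "cderiv c (trans c d) p u v = cderiv c (\<lambda>q. trans c d q v) p u"
      by (rule cderiv_linear[symmetric]) (use assms smooth_near_trans blinfun.bounded_linear_left in auto)
    also have "cderiv c (\<lambda>q. trans c d q v) p = cderiv c (\<lambda>q. cderiv c (coord d) q v) p"
      by (rule cderiv_cong[OF W(1,2)]) (use assms trans_apply in \<open>auto simp: W_def\<close>)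
    also have "\<dots> = frechet_derivative (\<lambda>y. frechet_derivative (\<lambda>x. coord d (param c x)) (at y) v) (at (coord c p))"
      unfolding cderiv_def
      by (rule frechet_derivative_cong_open[OF o]) (use W assms param_coord in \<open>auto simp: subset_iff\<close>)
    finally show ?thesis .
  qed
  have "smooth_on (coord c ` W) (\<lambda>x. coord d (param c x))"
    using smooth_near_smooth_on[OF assms(1), of "chart_dom d" "coord d"] assms open_chart_dom smooth_near_coord
    by (simp add: W_def)
  then show ?thesis unfolding * by (intro frechet_derivative_commute[OF is_onb o]) (use W in auto)
qed

section \<open>Functions, vector fields and one-forms through pointwise smoothness\<close>

lemma smooth_function_iff: "smooth_function A f \<longleftrightarrow> (\<forall>p. smooth_near f p)"
proof
  assume f: "smooth_function A f"
  show "\<forall>p. smooth_near f p"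
  proof
    fix p
    obtain c where "c \<in> A" "p \<in> chart_dom c" using ex_chart .
    then show "smooth_near f p" using f open_chart_dom
      by (intro smooth_nearI[of c "chart_dom c"]) (auto simp: smooth_function_def)
  qed
next
  assume "\<forall>p. smooth_near f p"
  then show "smooth_function A f"
    using smooth_near_smooth_on[of _ UNIV f] by (auto simp: smooth_function_def)
qed

lemma smooth_on_chart_iff:
  assumes "c \<in> A" "open U"
  shows "smooth_on (coord c ` (chart_dom c \<inter> U)) (\<lambda>x. f (param c x)) \<longleftrightarrow> (\<forall>p\<in>chart_dom c \<inter> U. smooth_near f p)"
  using smooth_near_smooth_on[OF assms] smooth_nearI[OF assms(1), of "chart_dom c \<inter> U" _ f] open_chart_dom assms by blast

lemma vector_field_on_iff:
  assumes "open U"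
  shows "vector_field_on A U X \<longleftrightarrow>
     (\<forall>c\<in>A. \<forall>p \<in> chart_dom c \<inter> U. smooth_near (X c) p) \<and>
     (\<forall>c\<in>A. \<forall>d\<in>A. \<forall>p \<in> chart_dom c \<inter> chart_dom d \<inter> U. X d p = trans c d p (X c p)) \<and>
     (\<forall>c p. c \<notin> A \<or> p \<notin> chart_dom c \<inter> U \<longrightarrow> X c p = 0)"
  unfolding vector_field_on_def using smooth_on_chart_iff[OF _ assms] by auto

lemma one_form_iff:
  "one_form A \<xi> \<longleftrightarrow>
     (\<forall>c\<in>A. \<forall>p \<in> chart_dom c. smooth_near (\<xi> c) p) \<and>
     (\<forall>c\<in>A. \<forall>d\<in>A. \<forall>p \<in> chart_dom c \<inter> chart_dom d. \<xi> c p = \<xi> d p o\<^sub>L trans c d p) \<and>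
     (\<forall>c p. c \<notin> A \<or> p \<notin> chart_dom c \<longrightarrow> \<xi> c p = 0)"
proof -
  have "(\<forall>v. smooth_on (coord c ` chart_dom c) (\<lambda>x. blinfun_apply (\<xi> c (param c x)) v))
    \<longleftrightarrow> (\<forall>p\<in>chart_dom c. smooth_near (\<xi> c) p)" if "c \<in> A" for c
  proof -
    have "(\<forall>v. smooth_on (coord c ` chart_dom c) (\<lambda>x. blinfun_apply (\<xi> c (param c x)) v))
      \<longleftrightarrow> (\<forall>v. \<forall>p\<in>chart_dom c. smooth_near (\<lambda>q. \<xi> c q v) p)"
      using smooth_on_chart_iff[OF that open_UNIV, unfolded Int_UNIV_right, of "\<lambda>q. \<xi> c q v" for v] by blast
    also have "\<dots> \<longleftrightarrow> (\<forall>p\<in>chart_dom c. smooth_near (\<xi> c) p)"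
      using smooth_near_blinfunI[of "chart_dom c" _ "\<xi> c"] open_chart_dom[OF that]
        smooth_near_linear[OF blinfun.bounded_linear_left, of "\<xi> c"] by blast
    finally show ?thesis .
  qed
  then show ?thesis unfolding one_form_def by blast
qed

lemma vector_fieldD:
  assumes "vector_field_on A U X" "open U"
  shows "c \<in> A \<Longrightarrow> p \<in> chart_dom c \<Longrightarrow> p \<in> U \<Longrightarrow> smooth_near (X c) p"
    and "c \<in> A \<Longrightarrow> d \<in> A \<Longrightarrow> p \<in> chart_dom c \<Longrightarrow> p \<in> chart_dom d \<Longrightarrow> p \<in> U \<Longrightarrow> X d p = trans c d p (X c p)"
    and "c \<notin> A \<or> p \<notin> chart_dom c \<or> p \<notin> U \<Longrightarrow> X c p = 0"
  using assms(1) unfolding vector_field_on_iff[OF assms(2)] by blast+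

text \<open>Smoothness is asked in one chart around each point only; the transformation law with
  smooth coefficients carries it to all others.\<close>

lemma vector_field_onI:
  assumes "open U"
    and sm: "\<And>p. p \<in> U \<Longrightarrow> \<exists>c\<in>A. p \<in> chart_dom c \<and> smooth_near (X c) p"
    and tr: "\<And>c d p. c \<in> A \<Longrightarrow> d \<in> A \<Longrightarrow> p \<in> chart_dom c \<Longrightarrow> p \<in> chart_dom d \<Longrightarrow> p \<in> U \<Longrightarrow> X d p = trans c d p (X c p)"
    and "\<And>c p. c \<notin> A \<or> p \<notin> chart_dom c \<or> p \<notin> U \<Longrightarrow> X c p = 0"
  shows "vector_field_on A U X"
  unfolding vector_field_on_iff[OF assms(1)]
proof (intro conjI ballI allI impI)
  fix d p assume d: "d \<in> A" "p \<in> chart_dom d \<inter> U"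
  then obtain c where c: "c \<in> A" "p \<in> chart_dom c" "smooth_near (X c) p" using sm by blast
  show "smooth_near (X d) p"
  proof (rule smooth_near_cong)
    show "open (chart_dom c \<inter> chart_dom d \<inter> U)" by (intro open_Int open_chart_dom c d assms(1))
    show "smooth_near (\<lambda>q. trans c d q (X c q)) p"
      by (intro smooth_near_blinfun_apply smooth_near_trans c) (use c d in auto)
    show "trans c d q (X c q) = X d q" if "q \<in> chart_dom c \<inter> chart_dom d \<inter> U" for q
      by (rule tr[symmetric]) (use c d that in auto)
  qed (use c d in auto)
next
  show "X d p = trans c d p (X c p)" if "c \<in> A" "d \<in> A" "p \<in> chart_dom c \<inter> chart_dom d \<inter> U" for c d p
    by (rule tr) (use that in auto)
  show "X c p = 0" if "c \<notin> A \<or> p \<notin> chart_dom c \<inter> U" for c p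
    by (rule assms(4)) (use that in auto)
qed

lemma one_formI:
  fixes \<xi> :: "('a, 'e) form1"
  assumes sm: "\<And>p. \<exists>c\<in>A. p \<in> chart_dom c \<and> smooth_near (\<xi> c) p"
    and tr: "\<And>c d p v. c \<in> A \<Longrightarrow> d \<in> A \<Longrightarrow> p \<in> chart_dom c \<Longrightarrow> p \<in> chart_dom d \<Longrightarrow> \<xi> c p v = \<xi> d p (trans c d p v)"
    and "\<And>c p. c \<notin> A \<or> p \<notin> chart_dom c \<Longrightarrow> \<xi> c p = 0"
  shows "one_form A \<xi>"
  unfolding one_form_iff
proof (intro conjI ballI allI impI)
  have tr': "\<xi> c p = \<xi> d p o\<^sub>L trans c d p" if "c \<in> A" "d \<in> A" "p \<in> chart_dom c \<inter> chart_dom d" for c d p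
    by (rule blinfun_eqI) (use tr[of c d p] that in \<open>simp only: blinfun_apply_blinfun_compose Int_iff\<close>)
  show "\<xi> c p = \<xi> d p o\<^sub>L trans c d p" if "c \<in> A" "d \<in> A" "p \<in> chart_dom c \<inter> chart_dom d" for c d p
    by (rule tr'[OF that])
  fix d p assume d: "d \<in> A" "p \<in> chart_dom d"
  then obtain c where c: "c \<in> A" "p \<in> chart_dom c" "smooth_near (\<xi> c) p" using sm by blast
  show "smooth_near (\<xi> d) p"
  proof (rule smooth_near_cong)
    show "open (chart_dom c \<inter> chart_dom d)" by (intro open_Int open_chart_dom c d)
    show "smooth_near (\<lambda>q. \<xi> c q o\<^sub>L trans d c q) p"
      by (intro smooth_near_blinfun_compose smooth_near_trans c) (use c d in auto)
    show "\<xi> c q o\<^sub>L trans d c q = \<xi> d q" if "q \<in> chart_dom c \<inter> chart_dom d" for q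
      by (rule tr'[symmetric]) (use c d that in auto)
  qed (use c d in auto)
qed (use assms in auto)

lemma one_formD:
  fixes \<xi> :: "('a, 'e) form1"
  assumes "one_form A \<xi>"
  shows "c \<in> A \<Longrightarrow> p \<in> chart_dom c \<Longrightarrow> smooth_near (\<xi> c) p"
    and "c \<in> A \<Longrightarrow> d \<in> A \<Longrightarrow> p \<in> chart_dom c \<Longrightarrow> p \<in> chart_dom d \<Longrightarrow> \<xi> c p v = \<xi> d p (trans c d p v)"
    and "c \<notin> A \<or> p \<notin> chart_dom c \<Longrightarrow> \<xi> c p = 0"
proof -
  show "c \<in> A \<Longrightarrow> d \<in> A \<Longrightarrow> p \<in> chart_dom c \<Longrightarrow> p \<in> chart_dom d \<Longrightarrow> \<xi> c p v = \<xi> d p (trans c d p v)"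
  proof -
    assume "c \<in> A" "d \<in> A" "p \<in> chart_dom c" "p \<in> chart_dom d"
    then have "\<xi> c p = \<xi> d p o\<^sub>L trans c d p" using assms unfolding one_form_iff by blast
    then show ?thesis by (metis blinfun_apply_blinfun_compose)
  qed
  show "c \<in> A \<Longrightarrow> p \<in> chart_dom c \<Longrightarrow> smooth_near (\<xi> c) p" "c \<notin> A \<or> p \<notin> chart_dom c \<Longrightarrow> \<xi> c p = 0"
    using assms unfolding one_form_iff by blast+
qed

text \<open>Differentiating the transformation law of Y along X adds a term with the second
  derivative of the transition map. This term is symmetric in X and Y and cancels in the
  bracket.\<close>

lemma lie_bracket_trans:
  assumes X: "vector_field_on A U X" and Y: "vector_field_on A U Y" and U: "open U" "p \<in> U"
    and c: "c \<in> A" "d \<in> A" "p \<in> chart_dom c" "p \<in> chart_dom d"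
  shows "lie_bracket X Y d p = trans c d p (lie_bracket X Y c p)"
proof -
  have *: "cderiv d (Y d) p (X d p) = cderiv c (trans c d) p (X c p) (Y c p) + trans c d p (cderiv c (Y c) p (X c p))"
    if X: "vector_field_on A U X" and Y: "vector_field_on A U Y" for X Y
  proof -
    note X = vector_fieldD[OF X U(1)] and Y = vector_fieldD[OF Y U(1)]
    have "cderiv d (Y d) p (X d p) = cderiv c (Y d) p (X c p)"
      unfolding X(2)[OF c U(2)] by (rule cderiv_chart_change[symmetric]) (use Y(1) c U in auto)
    also have "cderiv c (Y d) p = cderiv c (\<lambda>q. trans c d q (Y c q)) p"
      by (rule cderiv_cong[of "chart_dom c \<inter> chart_dom d \<inter> U"]) (use c U in \<open>auto intro!: open_Int open_chart_dom Y(2)\<close>)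
    finally show ?thesis
      using cderiv_bilinear[OF bounded_bilinear_blinfun_apply smooth_near_trans[of c d p] Y(1)[of c p]] c U by simp
  qed
  show ?thesis
    unfolding lie_bracket_eq_cderiv *[OF X Y] *[OF Y X]
    using cderiv_trans_commute[OF c] by (simp add: blinfun.diff_right)
qed

section \<open>Cut-off functions and partitions of unity\<close>

text \<open>The closed set K inside V is what makes extension by zero smooth: a point outside V has
  the complement of K as a neighbourhood on which the extension vanishes.\<close>

definition cutoff :: "'a set \<Rightarrow> ('a \<Rightarrow> real) \<Rightarrow> bool" where
  "cutoff V \<phi> \<longleftrightarrow> open V \<and> (\<forall>q. smooth_near \<phi> q) \<and> (\<exists>K. closed K \<and> K \<subseteq> V \<and> (\<forall>q. q \<notin> K \<longrightarrow> \<phi> q = 0))"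

lemma ex_plateau:
  assumes "open V" "p \<in> V"
  obtains \<phi> W where "cutoff V \<phi>" "open W" "p \<in> W" "W \<subseteq> V" "\<And>q. q \<in> W \<Longrightarrow> \<phi> q = 1"
proof -
  obtain c where c: "c \<in> A" "p \<in> chart_dom c" using ex_chart .
  have "open (coord c ` (V \<inter> chart_dom c))"
    by (intro open_coord_image c open_Int assms open_chart_dom) auto
  then obtain \<epsilon> where \<epsilon>: "\<epsilon> > 0" "cball (coord c p) \<epsilon> \<subseteq> coord c ` (V \<inter> chart_dom c)"
    using c assms open_contains_cball_eq by (metis IntI imageI)
  \<comment> \<open>The squared distance, unlike the distance, is smooth at p. The scaling makes it
    1 on the sphere of radius \<epsilon> and at most 1/4 on the ball of half that radius.\<close>
  define r where "r q = ((coord c q - coord c p) \<bullet> (coord c q - coord c p)) / \<epsilon>\<^sup>2" for q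
  have r: "r q = (dist (coord c p) (coord c q) / \<epsilon>)\<^sup>2" for q
    by (simp add: r_def dist_norm power2_norm_eq_inner[symmetric] norm_minus_commute power_divide)
  define \<phi> where "\<phi> q = (if q \<in> chart_dom c then rplateau (r q) else 0)" for q
  define K where "K = param c ` cball (coord c p) \<epsilon>"
  define W where "W = {q \<in> chart_dom c. coord c q \<in> ball (coord c p) (\<epsilon> / 2)}"
  have KV: "K \<subseteq> V \<inter> chart_dom c"
    using \<epsilon>(2) param_coord[OF c(1)] by (fastforce simp: K_def)
  \<comment> \<open>A set closed in the chart domain need not be closed in the manifold; K is,
    because it is compact and the manifold is Hausdorff.\<close>
  have "compact K" unfolding K_def
    by (rule compact_continuous_image[OF continuous_on_subset[OF homeomorphism_cont2[OF chart_homeo[OF c(1)]]] compact_cball_onb[OF is_onb]])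
      (use \<epsilon>(2) in auto)
  then have K: "closed K" by (rule compact_imp_closed)
  have out: "\<phi> q = 0" if "q \<notin> K" for q
  proof (cases "q \<in> chart_dom c")
    case True
    then have "coord c q \<notin> cball (coord c p) \<epsilon>" using that param_coord[OF c(1)] by (metis K_def imageI)
    then have "1 \<le> dist (coord c p) (coord c q) / \<epsilon>" using \<epsilon>(1) by simp
    then have "1 \<le> r q" unfolding r using power_mono[of 1 "dist (coord c p) (coord c q) / \<epsilon>" 2] by simp
    then show ?thesis using True rplateau_eq_0 by (simp add: \<phi>_def)
  qed (simp add: \<phi>_def)
  have "smooth_near \<phi> q" for q
  proof (cases "q \<in> chart_dom c")
    case True
    have "smooth_near r q"
      unfolding r_def divide_inverse
      by (intro smooth_near_mult smooth_near_inner smooth_near_diff smooth_near_const smooth_near_coord c True)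
    then have "smooth_near (\<lambda>q. rplateau (r q)) q"
      by (rule smooth_near_compose[OF is_onb_real open_UNIV UNIV_I smooth_on_rplateau])
    then show ?thesis
      by (rule smooth_near_cong[rotated 3]) (use open_chart_dom[OF c(1)] True in \<open>auto simp: \<phi>_def\<close>)
  next
    case False
    show ?thesis
      by (rule smooth_near_cong[of "-K" _ "\<lambda>_. 0"]) (use K KV False out smooth_near_const in \<open>auto intro: open_Compl\<close>)
  qed
  then have "cutoff V \<phi>" using K KV out assms(1) unfolding cutoff_def by blast
  moreover have "open W" unfolding W_def by (rule open_coord_vimage[OF c(1) open_ball])
  moreover have "\<phi> q = 1" if "q \<in> W" for q
  proof -
    have "dist (coord c p) (coord c q) / \<epsilon> \<le> 1/2" using that \<epsilon>(1) by (simp add: W_def field_simps)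
    then have "(dist (coord c p) (coord c q) / \<epsilon>)\<^sup>2 \<le> (1/2)\<^sup>2" using \<epsilon>(1) by (intro power_mono) auto
    also have "(1/2)\<^sup>2 \<le> (1/2::real)" by (simp add: power2_eq_square)
    finally have "r q \<le> 1/2" unfolding r .
    then show ?thesis using that rplateau_eq_1 by (simp add: \<phi>_def W_def)
  qed
  moreover from this have "W \<subseteq> V" using out KV by (metis IntD1 subsetD subsetI zero_neq_one)
  moreover have "p \<in> W" using c \<epsilon>(1) by (simp add: W_def)
  ultimately show thesis using that by blast
qed

text \<open>Countably many plateaus suffice by second countability. Multiplying the n-th one by the
  product of all earlier factors 1 - f makes the partial sums telescope. On the open set where some
  f is 1, that product is 0 from then on, so the later functions vanish and the sum is exactly 1; no
  locally finite refinement has to be constructed.\<close>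

lemma ex_partition_of_unity:
  assumes "\<And>p. \<exists>V\<in>\<V>. open V \<and> p \<in> V"
  obtains \<phi> :: "nat \<Rightarrow> 'a \<Rightarrow> real" and V where "\<And>n. V n \<in> \<V>" "\<And>n. cutoff (V n) (\<phi> n)"
    "\<And>p. \<exists>W m. open W \<and> p \<in> W \<and> (\<forall>q\<in>W. (\<forall>n\<ge>m. \<phi> n q = 0) \<and> (\<Sum>n<m. \<phi> n q) = 1)"
proof -
  have "\<exists>V f W. V \<in> \<V> \<and> cutoff V f \<and> open W \<and> p \<in> W \<and> (\<forall>q\<in>W. f q = 1)" for p
    using assms[of p] ex_plateau by metis
  then obtain V f W where VfW: "\<And>p. V p \<in> \<V>" "\<And>p. cutoff (V p) (f p)" "\<And>p. open (W p)" "\<And>p. p \<in> W p"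
      "\<And>p q. q \<in> W p \<Longrightarrow> f p q = (1::real)"
    by metis
  obtain F where F: "F \<subseteq> range W" "countable F" "\<Union>F = \<Union>(range W)"
    using Lindelof[of "range W"] VfW(3) by blast
  obtain C where C: "countable C" "F = W ` C" using countable_subset_image F(1,2) by metis
  have cov: "\<Union>(W ` C) = UNIV" using F(3) C(2) VfW(4) by blast
  then have "C \<noteq> {}" by auto
  \<comment> \<open>The enumeration may repeat elements; the telescoping does not require distinct
    indices.\<close>
  define s where "s = from_nat_into C"
  have s: "range s = C" using C(1) \<open>C \<noteq> {}\<close> by (simp add: s_def range_from_nat_into)
  define \<phi> where "\<phi> n q = f (s n) q * (\<Prod>k<n. 1 - f (s k) q)" for n q
  have sum: "(\<Sum>n<m. \<phi> n q) = 1 - (\<Prod>k<m. 1 - f (s k) q)" for m q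
    by (induction m) (auto simp: \<phi>_def algebra_simps)
  show thesis
  proof (rule that[of "\<lambda>n. V (s n)" \<phi>])
    fix n
    have "smooth_near (f p) q" for p q using VfW(2) by (simp add: cutoff_def)
    then have "smooth_near (\<phi> n) q" for q
      unfolding \<phi>_def by (intro smooth_near_mult smooth_near_prod smooth_near_diff smooth_near_const)
    moreover obtain K where K: "closed K" "K \<subseteq> V (s n)" "\<And>q. q \<notin> K \<Longrightarrow> f (s n) q = 0"
      using VfW(2)[of "s n"] unfolding cutoff_def by blast
    then have "\<forall>q. q \<notin> K \<longrightarrow> \<phi> n q = 0" by (simp add: \<phi>_def)
    ultimately show "cutoff (V (s n)) (\<phi> n)"
      using VfW(2)[of "s n"] K(1,2) unfolding cutoff_def by blast
  next
    fix p
    obtain k where k: "p \<in> W (s k)" using cov s by blast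
    have zero: "(\<Prod>j<n. 1 - f (s j) q) = 0" if "n > k" "q \<in> W (s k)" for n q
      using that VfW(5) by (intro prod_zero) auto
    have "\<forall>q\<in>W (s k). (\<forall>n\<ge>Suc k. \<phi> n q = 0) \<and> (\<Sum>n<Suc k. \<phi> n q) = 1"
    proof (intro ballI conjI allI impI)
      fix q assume q: "q \<in> W (s k)"
      show "(\<Sum>n<Suc k. \<phi> n q) = 1" unfolding sum using zero[of "Suc k" q] q by simp
      show "\<phi> n q = 0" if "n \<ge> Suc k" for n unfolding \<phi>_def using zero[of n q] q that by simp
    qed
    then show "\<exists>W m. open W \<and> p \<in> W \<and> (\<forall>q\<in>W. (\<forall>n\<ge>m. \<phi> n q = 0) \<and> (\<Sum>n<m. \<phi> n q) = 1)"
      using VfW(3)[of "s k"] k by blast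
  qed (use VfW in auto)
qed

section \<open>Global fields and forms from local ones\<close>

definition ext_fun :: "'a set \<Rightarrow> ('a \<Rightarrow> real) \<Rightarrow> ('a \<Rightarrow> 'f::real_normed_vector) \<Rightarrow> 'a \<Rightarrow> 'f" where
  "ext_fun V \<phi> u = (\<lambda>q. if q \<in> V then \<phi> q *\<^sub>R u q else 0)"

lemma smooth_near_ext_fun:
  assumes "cutoff V \<phi>" "p \<in> V \<Longrightarrow> smooth_near u p"
  shows "smooth_near (ext_fun V \<phi> u) p"
proof (cases "p \<in> V")
  case True
  show ?thesis
    by (rule smooth_near_cong[of V _ "\<lambda>q. \<phi> q *\<^sub>R u q"])
      (use assms True in \<open>auto simp: cutoff_def ext_fun_def intro: smooth_near_scaleR\<close>)
next
  case False
  obtain K where K: "closed K" "K \<subseteq> V" "\<And>q. q \<notin> K \<Longrightarrow> \<phi> q = 0" using assms(1) unfolding cutoff_def by blast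
  show ?thesis
    by (rule smooth_near_cong[of "-K" _ "\<lambda>q. 0"])
      (use K False in \<open>auto simp: ext_fun_def intro: smooth_near_const\<close>)
qed

definition ext_vfield :: "('a, 'e) chart \<Rightarrow> 'a set \<Rightarrow> ('a \<Rightarrow> real) \<Rightarrow> ('a \<Rightarrow> 'e) \<Rightarrow> ('a, 'e) vfield" where
  "ext_vfield c V \<phi> u = (\<lambda>d q. if d \<in> A \<and> q \<in> chart_dom d then ext_fun V \<phi> (\<lambda>q. trans c d q (u q)) q else 0)"

text \<open>Covectors are pulled back, so the transition runs from d to c, opposite to the one in
  \<open>ext_vfield\<close>.\<close>

definition ext_form :: "('a, 'e) chart \<Rightarrow> 'a set \<Rightarrow> ('a \<Rightarrow> real) \<Rightarrow> ('a \<Rightarrow> 'e \<Rightarrow>\<^sub>L real) \<Rightarrow> ('a, 'e) form1" where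
  "ext_form c V \<phi> u = (\<lambda>d q. if d \<in> A \<and> q \<in> chart_dom d then ext_fun V \<phi> (\<lambda>q. u q o\<^sub>L trans d c q) q else 0)"

lemma ext_vfield_apply:
  "c \<in> A \<Longrightarrow> q \<in> chart_dom c \<Longrightarrow> ext_vfield c V \<phi> u c q = ext_fun V \<phi> u q"
  by (simp add: ext_vfield_def ext_fun_def trans_self)

lemma ext_form_apply:
  "c \<in> A \<Longrightarrow> q \<in> chart_dom c \<Longrightarrow> ext_form c V \<phi> u c q = ext_fun V \<phi> u q"
  by (auto simp: ext_form_def ext_fun_def trans_self intro!: blinfun_eqI)

lemma vector_field_ext_vfield:
  assumes "cutoff V \<phi>" "c \<in> A" "V \<subseteq> chart_dom c" "\<And>q. q \<in> V \<Longrightarrow> smooth_near u q"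
  shows "vector_field A (ext_vfield c V \<phi> u)"
proof (rule vector_field_onI[OF open_UNIV])
  fix p
  obtain d where d: "d \<in> A" "p \<in> chart_dom d" using ex_chart .
  have "smooth_near (ext_fun V \<phi> (\<lambda>q. trans c d q (u q))) p"
    by (rule smooth_near_ext_fun[OF assms(1)])
      (use assms d in \<open>auto intro!: smooth_near_blinfun_apply smooth_near_trans\<close>)
  then have "smooth_near (ext_vfield c V \<phi> u d) p"
    by (rule smooth_near_cong[rotated 3]) (use d open_chart_dom[OF d(1)] in \<open>auto simp: ext_vfield_def\<close>)
  with d show "\<exists>c'\<in>A. p \<in> chart_dom c' \<and> smooth_near (ext_vfield c V \<phi> u c') p" by blast
next
  show "ext_vfield c V \<phi> u e p = trans d e p (ext_vfield c V \<phi> u d p)"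
    if "d \<in> A" "e \<in> A" "p \<in> chart_dom d" "p \<in> chart_dom e" for d e p
    using that assms by (auto simp: ext_vfield_def ext_fun_def blinfun.scaleR_right trans_comp subset_iff)
qed (auto simp: ext_vfield_def)

lemma one_form_ext_form:
  assumes "cutoff V \<phi>" "c \<in> A" "V \<subseteq> chart_dom c" "\<And>q. q \<in> V \<Longrightarrow> smooth_near u q"
  shows "one_form A (ext_form c V \<phi> u)"
proof (rule one_formI)
  fix p
  obtain d where d: "d \<in> A" "p \<in> chart_dom d" using ex_chart .
  have "smooth_near (ext_fun V \<phi> (\<lambda>q. u q o\<^sub>L trans d c q)) p"
    by (rule smooth_near_ext_fun[OF assms(1)])
      (use assms d in \<open>auto intro!: smooth_near_blinfun_compose smooth_near_trans\<close>)
  then have "smooth_near (ext_form c V \<phi> u d) p"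
    by (rule smooth_near_cong[rotated 3]) (use d open_chart_dom[OF d(1)] in \<open>auto simp: ext_form_def\<close>)
  with d show "\<exists>c'\<in>A. p \<in> chart_dom c' \<and> smooth_near (ext_form c V \<phi> u c') p" by blast
next
  show "ext_form c V \<phi> u d p v = ext_form c V \<phi> u e p (trans d e p v)"
    if "d \<in> A" "e \<in> A" "p \<in> chart_dom d" "p \<in> chart_dom e" for d e p v
    using that assms by (auto simp: ext_form_def ext_fun_def blinfun.scaleR_left trans_comp subset_iff)
qed (auto simp: ext_form_def)

lemma ex_vector_field_const:
  assumes "c \<in> A" "p \<in> chart_dom c"
  obtains Y W where "\<And>v. vector_field A (Y v)" "open W" "p \<in> W" "W \<subseteq> chart_dom c" "\<And>q v. q \<in> W \<Longrightarrow> Y v c q = v"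
proof -
  obtain \<phi> W where \<phi>: "cutoff (chart_dom c) \<phi>" "open W" "p \<in> W" "W \<subseteq> chart_dom c" "\<And>q. q \<in> W \<Longrightarrow> \<phi> q = 1"
    by (rule ex_plateau[OF open_chart_dom[OF assms(1)] assms(2)]) blast
  show thesis
  proof (rule that[of "\<lambda>v. ext_vfield c (chart_dom c) \<phi> (\<lambda>_. v)" W])
    show "vector_field A (ext_vfield c (chart_dom c) \<phi> (\<lambda>_. v))" for v
      by (rule vector_field_ext_vfield[OF \<phi>(1) assms(1)]) (auto intro: smooth_near_const)
    show "ext_vfield c (chart_dom c) \<phi> (\<lambda>_. v) c q = v" if "q \<in> W" for q v
      using that \<phi>(4,5) ext_vfield_apply[OF assms(1)] by (auto simp: ext_fun_def)
  qed (use \<phi> in auto)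
qed

section \<open>Covariant derivatives of one-forms\<close>

lemma vector_field_scale:
  assumes "smooth_function A f" "vector_field A X"
  shows "vector_field A (\<lambda>c p. f p *\<^sub>R X c p)"
proof (rule vector_field_onI[OF open_UNIV])
  fix p
  obtain c where c: "c \<in> A" "p \<in> chart_dom c" using ex_chart .
  then have "smooth_near (\<lambda>p. f p *\<^sub>R X c p) p"
    using assms vector_fieldD(1)[OF assms(2) open_UNIV] by (intro smooth_near_scaleR) (auto simp: smooth_function_iff)
  then show "\<exists>c\<in>A. p \<in> chart_dom c \<and> smooth_near (\<lambda>p. f p *\<^sub>R X c p) p" using c by blast
next
  show "f p *\<^sub>R X d p = trans c d p (f p *\<^sub>R X c p)"
    if "c \<in> A" "d \<in> A" "p \<in> chart_dom c" "p \<in> chart_dom d" for c d p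
    using vector_fieldD(2)[OF assms(2) open_UNIV that UNIV_I] by (simp add: blinfun.scaleR_right)
qed (use vector_fieldD(3)[OF assms(2) open_UNIV] in auto)

lemma vector_field_add:
  assumes "vector_field A X" "vector_field A Y"
  shows "vector_field A (\<lambda>c p. X c p + Y c p)"
proof (rule vector_field_onI[OF open_UNIV])
  fix p
  obtain c where c: "c \<in> A" "p \<in> chart_dom c" using ex_chart .
  then have "smooth_near (\<lambda>p. X c p + Y c p) p"
    using vector_fieldD(1)[OF assms(1) open_UNIV] vector_fieldD(1)[OF assms(2) open_UNIV] by (intro smooth_near_add) auto
  then show "\<exists>c\<in>A. p \<in> chart_dom c \<and> smooth_near (\<lambda>p. X c p + Y c p) p" using c by blast
next
  show "X d p + Y d p = trans c d p (X c p + Y c p)"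
    if "c \<in> A" "d \<in> A" "p \<in> chart_dom c" "p \<in> chart_dom d" for c d p
    using vector_fieldD(2)[OF assms(1) open_UNIV that UNIV_I] vector_fieldD(2)[OF assms(2) open_UNIV that UNIV_I]
    by (simp add: blinfun.add_right)
qed (use vector_fieldD(3)[OF assms(1) open_UNIV] vector_fieldD(3)[OF assms(2) open_UNIV] in auto)

lemma vector_field_zero: "vector_field A (\<lambda>c p. 0)"
  by (rule vector_field_onI[OF open_UNIV]) (auto intro: smooth_near_const ex_chart)

lemma vector_field_sum:
  "(\<And>i. i \<in> I \<Longrightarrow> vector_field A (Y i)) \<Longrightarrow> vector_field A (\<lambda>c p. \<Sum>i\<in>I. Y i c p)"
  by (induction I rule: infinite_finite_induct) (auto intro: vector_field_add vector_field_zero)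

lemma vector_field_eqI:
  assumes "vector_field A X" "vector_field A Y" "\<And>c p. c \<in> A \<Longrightarrow> p \<in> chart_dom c \<Longrightarrow> X c p = Y c p"
  shows "X = Y"
proof (intro ext)
  fix c p
  show "X c p = Y c p"
    using assms(3) vector_fieldD(3)[OF assms(1) open_UNIV, of c p] vector_fieldD(3)[OF assms(2) open_UNIV, of c p]
    by (cases "c \<in> A \<and> p \<in> chart_dom c") auto
qed

lemma smooth_near_pairing:
  assumes "one_form A \<xi>" "vector_field A Y" "c \<in> A" "p \<in> chart_dom c"
  shows "smooth_near (\<lambda>q. \<xi> c q (Y c q)) p"
  using assms one_formD(1)[OF assms(1)] vector_fieldD(1)[OF assms(2) open_UNIV] by (intro smooth_near_blinfun_apply) auto

lemma connectionD:
  assumes "connection A N"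
  shows "vector_field A X \<Longrightarrow> vector_field A Y \<Longrightarrow> vector_field A (N X Y)"
    and "vector_field A X \<Longrightarrow> vector_field A Y \<Longrightarrow> vector_field A Y' \<Longrightarrow>
        N X (\<lambda>c p. Y c p + Y' c p) = (\<lambda>c p. N X Y c p + N X Y' c p)"
    and "smooth_function A f \<Longrightarrow> vector_field A X \<Longrightarrow> vector_field A Y \<Longrightarrow>
        N X (\<lambda>c p. f p *\<^sub>R Y c p) = (\<lambda>c p. f p *\<^sub>R N X Y c p + vderiv X f c p *\<^sub>R Y c p)"
  using assms unfolding connection_def by blast+

lemma smooth_function_const: "smooth_function A (\<lambda>_. a)"
  by (simp add: smooth_function_iff smooth_near_const)

lemma connection_zero:
  assumes "connection A N" "vector_field A X"
  shows "N X (\<lambda>c p. 0) = (\<lambda>c p. 0)"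
  using connectionD(3)[OF assms(1) smooth_function_const[of 0] assms(2) vector_field_zero]
  by (simp add: vderiv_eq_cderiv cderiv_const)

context
  fixes N :: "('a, 'e) vfield \<Rightarrow> ('a, 'e) vfield \<Rightarrow> ('a, 'e) vfield" and X \<xi>
  assumes N: "connection A N" and X: "vector_field A X" and \<xi>: "one_form A \<xi>"
begin

text \<open>The prescribed value of the covariant derivative of \<xi> on Y. The aim is to show that
  it is linear over smooth functions in Y, hence given by a one-form.\<close>

private definition F :: "('a, 'e) vfield \<Rightarrow> ('a, 'e) chart \<Rightarrow> 'a \<Rightarrow> real" where
  "F Y c p = vderiv X (\<lambda>q. \<xi> c q (Y c q)) c p - \<xi> c p (N X Y c p)"

private lemma F_chart:
  assumes Y: "vector_field A Y" and "c \<in> A" "d \<in> A" "p \<in> chart_dom c" "p \<in> chart_dom d"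
  shows "F Y c p = F Y d p"
proof -
  have eq: "\<xi> c q (Z c q) = \<xi> d q (Z d q)" if "q \<in> chart_dom c \<inter> chart_dom d" "vector_field A Z" for q Z
    using one_formD(2)[OF \<xi> assms(2,3), of q "Z c q"] vector_fieldD(2)[OF that(2) open_UNIV assms(2,3), of q] that by simp
  have "cderiv c (\<lambda>q. \<xi> c q (Y c q)) p = cderiv c (\<lambda>q. \<xi> d q (Y d q)) p"
    by (rule cderiv_cong[of "chart_dom c \<inter> chart_dom d"]) (use assms eq Y in \<open>auto intro!: open_Int open_chart_dom\<close>)
  then have "vderiv X (\<lambda>q. \<xi> c q (Y c q)) c p = cderiv d (\<lambda>q. \<xi> d q (Y d q)) p (trans c d p (X c p))"
    using cderiv_chart_change[OF smooth_near_pairing[OF \<xi> Y assms(3,5)] assms(2-5)] by (simp add: vderiv_eq_cderiv)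
  also have "trans c d p (X c p) = X d p"
    using vector_fieldD(2)[OF X open_UNIV assms(2-5)] by simp
  finally show ?thesis
    using eq[of p "N X Y"] connectionD(1)[OF N X Y] assms by (simp add: F_def vderiv_eq_cderiv)
qed

private lemma smooth_near_F:
  assumes Y: "vector_field A Y" and c: "c \<in> A" "p \<in> chart_dom c"
  shows "smooth_near (F Y c) p"
  unfolding F_def vderiv_eq_cderiv
  by (intro smooth_near_diff smooth_near_cderiv smooth_near_pairing[OF \<xi>] c connectionD(1)[OF N] X Y
      vector_fieldD(1)[OF X open_UNIV]) simp

private lemma F_add:
  assumes Y: "vector_field A Y" "vector_field A Y'" and c: "c \<in> A" "p \<in> chart_dom c"
  shows "F (\<lambda>c p. Y c p + Y' c p) c p = F Y c p + F Y' c p"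
  unfolding F_def connectionD(2)[OF N X Y] vderiv_eq_cderiv
  using cderiv_add[OF smooth_near_pairing[OF \<xi> Y(1) c] smooth_near_pairing[OF \<xi> Y(2) c] c]
  by (simp add: blinfun.add_right)

text \<open>The derivative of f appears once from the product rule for the pairing and once from the
  Leibniz rule of the connection; the two cancel.\<close>

private lemma F_scale:
  assumes f: "smooth_function A f" and Y: "vector_field A Y" and c: "c \<in> A" "p \<in> chart_dom c"
  shows "F (\<lambda>c p. f p *\<^sub>R Y c p) c p = f p * F Y c p"
  unfolding F_def connectionD(3)[OF N f X Y] vderiv_eq_cderiv
  using cderiv_bilinear[OF bounded_bilinear_mult _ smooth_near_pairing[OF \<xi> Y c] c, of f] f
  by (simp add: blinfun.add_right blinfun.scaleR_right smooth_function_iff algebra_simps)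

private lemma F_zero: "c \<in> A \<Longrightarrow> p \<in> chart_dom c \<Longrightarrow> F (\<lambda>c p. 0) c p = 0"
  using F_scale[OF smooth_function_const[of 0] vector_field_zero, of c p] by simp

private lemma F_sum:
  assumes "\<And>i. i \<in> I \<Longrightarrow> vector_field A (Y i)" "c \<in> A" "p \<in> chart_dom c"
  shows "F (\<lambda>c p. \<Sum>i\<in>I. Y i c p) c p = (\<Sum>i\<in>I. F (Y i) c p)"
  using assms(1)
proof (induction I rule: infinite_finite_induct)
  case (insert i I)
  then show ?case
    using F_add[of "Y i" "\<lambda>c p. \<Sum>i\<in>I. Y i c p" c p] vector_field_sum[of I Y] assms(2,3) by simp
qed (use F_zero assms(2,3) in auto)

text \<open>Tensoriality. Near p, Y is a combination of basis fields whose coefficients vanish at p,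
  and function linearity takes the coefficients out.\<close>

private lemma F_local:
  assumes Y: "vector_field A Y" and c: "c \<in> A" "p \<in> chart_dom c" and "Y c p = 0"
  shows "F Y c p = 0"
proof -
  let ?V = "chart_dom c"
  obtain \<phi> W where \<phi>: "cutoff ?V \<phi>" "p \<in> W" "W \<subseteq> ?V" "\<And>q. q \<in> W \<Longrightarrow> \<phi> q = 1"
    by (rule ex_plateau[OF open_chart_dom[OF c(1)] c(2)]) blast
  define E where "E b = ext_vfield c ?V \<phi> (\<lambda>_. b)" for b
  define g where "g b = ext_fun ?V \<phi> (\<lambda>q. Y c q \<bullet> b)" for b
  have E: "vector_field A (E b)" for b
    unfolding E_def by (rule vector_field_ext_vfield[OF \<phi>(1) c(1)]) (auto intro: smooth_near_const)
  have g: "smooth_function A (g b)" for b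
    unfolding smooth_function_iff g_def
    using smooth_near_ext_fun[OF \<phi>(1)] smooth_near_inner[OF vector_fieldD(1)[OF Y open_UNIV c(1)] smooth_near_const] by blast
  have \<phi>_fun: "smooth_function A (\<lambda>q. \<phi> q * \<phi> q)"
    using \<phi>(1) by (auto simp: smooth_function_iff cutoff_def intro: smooth_near_mult)
  \<comment> \<open>The cut-off occurs squared: one factor makes the coefficients global, the other
    makes the basis fields global. Both are 1 at p.\<close>
  have "(\<lambda>d q. (\<phi> q * \<phi> q) *\<^sub>R Y d q) = (\<lambda>d q. \<Sum>b\<in>onb. g b q *\<^sub>R E b d q)"
  proof (rule vector_field_eqI)
    show "vector_field A (\<lambda>d q. (\<phi> q * \<phi> q) *\<^sub>R Y d q)" by (rule vector_field_scale[OF \<phi>_fun Y])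
    show "vector_field A (\<lambda>d q. \<Sum>b\<in>onb. g b q *\<^sub>R E b d q)" by (intro vector_field_sum vector_field_scale g E)
    fix d q assume d: "d \<in> A" "q \<in> chart_dom d"
    show "(\<phi> q * \<phi> q) *\<^sub>R Y d q = (\<Sum>b\<in>onb. g b q *\<^sub>R E b d q)"
    proof (cases "q \<in> ?V")
      case True
      have "(\<Sum>b\<in>onb. g b q *\<^sub>R E b d q) = (\<phi> q * \<phi> q) *\<^sub>R (\<Sum>b\<in>onb. (Y c q \<bullet> b) *\<^sub>R trans c d q b)"
        using True d by (simp add: g_def E_def ext_vfield_def ext_fun_def scaleR_sum_right mult_ac)
      also have "(\<Sum>b\<in>onb. (Y c q \<bullet> b) *\<^sub>R trans c d q b) = trans c d q (Y c q)"
        by (rule linear_onb[OF is_onb, symmetric]) (simp add: blinfun.bounded_linear_right bounded_linear.linear)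
      also have "\<dots> = Y d q" using vector_fieldD(2)[OF Y open_UNIV c(1) d(1) True d(2)] by simp
      finally show ?thesis by simp
    next
      case False
      moreover have "\<phi> q = 0" using False \<phi>(1) unfolding cutoff_def by blast
      ultimately show ?thesis by (simp add: g_def ext_fun_def)
    qed
  qed
  then have "F (\<lambda>d q. (\<phi> q * \<phi> q) *\<^sub>R Y d q) c p = (\<Sum>b\<in>onb. F (\<lambda>d q. g b q *\<^sub>R E b d q) c p)"
    using F_sum[of onb "\<lambda>b d q. g b q *\<^sub>R E b d q" c p] vector_field_scale[OF g E] c by simp
  then have "F Y c p = (\<Sum>b\<in>onb. g b p * F (E b) c p)"
    using F_scale[OF \<phi>_fun Y c] F_scale[OF g E c] \<phi>(2,4) by simp
  moreover have "g b p = 0" for b using assms(4) by (simp add: g_def ext_fun_def)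
  ultimately show ?thesis by simp
qed

private definition value_field :: "('a, 'e) chart \<Rightarrow> 'a \<Rightarrow> 'e \<Rightarrow> ('a, 'e) vfield" where
  "value_field c p v = (SOME Y. vector_field A Y \<and> Y c p = v)"

private lemma value_field:
  assumes "c \<in> A" "p \<in> chart_dom c"
  shows "vector_field A (value_field c p v)" "value_field c p v c p = v"
proof -
  have "\<exists>Y. vector_field A Y \<and> Y c p = v"
    by (rule ex_vector_field_const[OF assms]) blast
  from someI_ex[OF this] show "vector_field A (value_field c p v)" "value_field c p v c p = v"
    unfolding value_field_def by auto
qed

private lemma F_eqI:
  assumes "vector_field A Y" "vector_field A Y'" "c \<in> A" "p \<in> chart_dom c" "Y c p = Y' c p"
  shows "F Y c p = F Y' c p"
proof -
  have m: "vector_field A (\<lambda>c p. (-1) *\<^sub>R Y' c p)" by (rule vector_field_scale[OF smooth_function_const assms(2)])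
  have "F (\<lambda>c p. Y c p + (-1) *\<^sub>R Y' c p) c p = 0"
    by (rule F_local[OF vector_field_add[OF assms(1) m]]) (use assms in auto)
  then show ?thesis
    unfolding F_add[OF assms(1) m assms(3,4)] F_scale[OF smooth_function_const assms(2-4)] by simp
qed

private definition \<zeta> :: "('a, 'e) form1" where
  "\<zeta> c p = (if c \<in> A \<and> p \<in> chart_dom c then Blinfun (\<lambda>v. F (value_field c p v) c p) else 0)"

private lemma \<zeta>_apply:
  assumes Y: "vector_field A Y" and c: "c \<in> A" "p \<in> chart_dom c"
  shows "\<zeta> c p (Y c p) = F Y c p"
proof -
  note vf = value_field[OF c]
  have "linear (\<lambda>v. F (value_field c p v) c p)"
  proof (rule linearI)
    fix v w r
    have "F (value_field c p (v + w)) c p = F (\<lambda>d q. value_field c p v d q + value_field c p w d q) c p"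
      by (rule F_eqI) (use vf c vector_field_add in auto)
    then show "F (value_field c p (v + w)) c p = F (value_field c p v) c p + F (value_field c p w) c p"
      using F_add[OF vf(1) vf(1) c] by simp
    have "F (value_field c p (r *\<^sub>R v)) c p = F (\<lambda>d q. r *\<^sub>R value_field c p v d q) c p"
      by (rule F_eqI) (use vf c vector_field_scale[OF smooth_function_const] in auto)
    then show "F (value_field c p (r *\<^sub>R v)) c p = r *\<^sub>R F (value_field c p v) c p"
      using F_scale[OF smooth_function_const vf(1) c] by simp
  qed
  then have "\<zeta> c p (Y c p) = F (value_field c p (Y c p)) c p"
    using c by (simp add: \<zeta>_def blinfun_apply_Blinfun_linear)
  also have "\<dots> = F Y c p" by (rule F_eqI) (use vf Y c in auto)
  finally show ?thesis .
qed

private lemma one_form_\<zeta>: "one_form A \<zeta>"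
proof (rule one_formI)
  fix p
  obtain c where c: "c \<in> A" "p \<in> chart_dom c" using ex_chart .
  \<comment> \<open>\<open>value_field\<close> is chosen separately at each point and says nothing
    about smoothness. Fields with a constant value around p replace it here, which is harmless
    because F depends only on the value of its argument at the point.\<close>
  obtain Y W where Y: "\<And>v. vector_field A (Y v)" "open W" "p \<in> W" "W \<subseteq> chart_dom c" "\<And>q v. q \<in> W \<Longrightarrow> Y v c q = v"
    by (rule ex_vector_field_const[OF c]) blast
  have "smooth_near (\<zeta> c) p"
  proof (rule smooth_near_blinfunI[OF Y(2,3)])
    fix v
    show "smooth_near (\<lambda>q. \<zeta> c q v) p"
    proof (rule smooth_near_cong[OF Y(2,3)])
      show "smooth_near (F (Y v) c) p" by (rule smooth_near_F[OF Y(1) c])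
      show "F (Y v) c q = \<zeta> c q v" if "q \<in> W" for q
        using \<zeta>_apply[OF Y(1) c(1), of q v] Y(4,5) that by auto
    qed
  qed
  then show "\<exists>c\<in>A. p \<in> chart_dom c \<and> smooth_near (\<zeta> c) p" using c by blast
next
  fix c d p v assume c: "c \<in> A" "d \<in> A" "p \<in> chart_dom c" "p \<in> chart_dom d"
  note vf = value_field[OF c(1,3), of v]
  show "\<zeta> c p v = \<zeta> d p (trans c d p v)"
    using \<zeta>_apply[OF vf(1) c(1,3)] \<zeta>_apply[OF vf(1) c(2,4)] F_chart[OF vf(1) c]
      vector_fieldD(2)[OF vf(1) open_UNIV c] vf(2) by simp
qed (auto simp: \<zeta>_def)

text \<open>Existence is the form \<zeta>; uniqueness holds because every tangent vector is the
  value of a global field.\<close>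

lemma cov_deriv_form_apply:
  shows "vector_field A Y \<Longrightarrow> c \<in> A \<Longrightarrow> p \<in> chart_dom c \<Longrightarrow>
      cov_deriv_form A N X \<xi> c p (Y c p) = vderiv X (\<lambda>q. \<xi> c q (Y c q)) c p - \<xi> c p (N X Y c p)"
proof -
  let ?P = "\<lambda>\<zeta>. one_form A \<zeta> \<and> (\<forall>Y. vector_field A Y \<longrightarrow> (\<forall>c\<in>A. \<forall>p\<in>chart_dom c.
    blinfun_apply (\<zeta> c p) (Y c p) = vderiv X (\<lambda>q. blinfun_apply (\<xi> c q) (Y c q)) c p - blinfun_apply (\<xi> c p) (N X Y c p)))"
  have "?P \<zeta>" using one_form_\<zeta> \<zeta>_apply unfolding F_def by blast
  moreover have "\<zeta>' = \<zeta>" if P': "?P \<zeta>'" for \<zeta>'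
  proof (intro ext blinfun_eqI)
    fix c p v
    show "\<zeta>' c p v = \<zeta> c p v"
    proof (cases "c \<in> A \<and> p \<in> chart_dom c")
      case True
      then have vf: "vector_field A (value_field c p v)" "value_field c p v c p = v" using value_field by auto
      have "\<zeta>' c p (value_field c p v c p) = F (value_field c p v) c p"
        unfolding F_def using P' vf(1) True by blast
      then show ?thesis using \<zeta>_apply[OF vf(1), of c p] True vf(2) by simp
    next
      case False
      then have "\<zeta>' c p = 0" "\<zeta> c p = 0" using P' one_form_\<zeta> one_formD(3) by blast+
      then show ?thesis by simp
    qed
  qed
  ultimately have "?P (cov_deriv_form A N X \<xi>)"
    unfolding cov_deriv_form_def by (rule theI[where P = ?P])
  then show "vector_field A Y \<Longrightarrow> c \<in> A \<Longrightarrow> p \<in> chart_dom c \<Longrightarrow>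
      cov_deriv_form A N X \<xi> c p (Y c p) = vderiv X (\<lambda>q. \<xi> c q (Y c q)) c p - \<xi> c p (N X Y c p)"
    by blast
qed

end

end

section \<open>Generalised inverses of symmetric operators\<close>

lemma linear_blinfun: "linear (blinfun_apply T)"
  by (simp add: blinfun.bounded_linear_right bounded_linear.linear)

lemma blinfun_inverse_exists:
  fixes T :: "'e::real_inner \<Rightarrow>\<^sub>L 'e"
  assumes B: "is_onb (B::'e set)" and inj: "\<And>v. T v = 0 \<Longrightarrow> v = 0"
  obtains J where "J o\<^sub>L T = id_blinfun" "T o\<^sub>L J = id_blinfun"
proof -
  have inj: "inj T"
    using inj linear_injective_0[OF linear_blinfun] by blast
  have surj: "surj T" by (rule inj_linear_imp_surj_onb[OF B linear_blinfun inj])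
  define j where "j = inv T"
  have j: "T (j v) = v" "j (T v) = v" for v
    using surj_f_inv_f[OF surj] inv_f_f[OF inj] by (auto simp: j_def)
  have "linear j"
    by (rule linearI) (metis j blinfun.add_right, metis j blinfun.scaleR_right)
  then have J: "blinfun_apply (Blinfun j) = j"
    by (intro bounded_linear_Blinfun_apply linear_imp_bounded_linear_onb[OF B])
  show thesis
    by (rule that[of "Blinfun j"]) (auto intro!: blinfun_eqI simp: J j)
qed

lemma norm_blinfun_inverse_le:
  assumes "T o\<^sub>L J = id_blinfun" "K \<ge> 0" "\<And>v. norm v \<le> K * norm (blinfun_apply T v)"
  shows "norm J \<le> K"
proof (rule norm_blinfun_bound[OF assms(2)])
  fix v
  have "T (J v) = v" using assms(1) by (metis blinfun_apply_blinfun_compose id_blinfun.rep_eq id_apply)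
  then show "norm (J v) \<le> K * norm v" using assms(3)[of "J v"] by simp
qed

text \<open>P is the orthogonal projection onto the image. By symmetry the kernel of S is orthogonal
  to its image, so S is injective on the image; adding the identity on the complement gives an
  invertible operator, and K is the norm of its inverse. The estimate is what survives a
  perturbation of S.\<close>

lemma symmetric_range_projection:
  fixes S :: "'e::real_inner \<Rightarrow>\<^sub>L 'e"
  assumes B: "is_onb (B::'e set)" and sym: "\<And>a b. S a \<bullet> b = a \<bullet> S b"
  obtains P K where "\<And>a b. blinfun_apply P a \<bullet> b = a \<bullet> P b" "\<And>v. P (P v) = P v" "range P = range S"
    "K \<ge> 0" "\<And>v. norm v \<le> K * norm (P (S (P v)) + (v - P v))"
proof -
  have "finite (S ` B)" using B by (simp add: is_onb_def)
  from orthonormal_basis_span[OF this] obtain C where C: "finite C" "span C = span (S ` B)"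
    "\<And>b b'. b \<in> C \<Longrightarrow> b' \<in> C \<Longrightarrow> b \<bullet> b' = of_bool (b = b')" by blast
  have "v \<in> span B" for v
    by (subst is_onb_expand[OF B, of v]) (intro span_sum span_mul span_base)
  then have "span B = UNIV" by blast
  then have spanC: "span C = range S"
    unfolding C(2) using linear_span_image[OF linear_blinfun, of S B] by simp
  define P where "P = Blinfun (\<lambda>v. \<Sum>c\<in>C. (v \<bullet> c) *\<^sub>R c)"
  have P: "P v = (\<Sum>c\<in>C. (v \<bullet> c) *\<^sub>R c)" for v
    unfolding P_def
    by (rule bounded_linear_Blinfun_apply[THEN fun_cong], rule linear_imp_bounded_linear_onb[OF B], rule linearI)
      (auto simp: inner_add_left scaleR_add_left sum.distrib scaleR_sum_right)
  have Pfix: "P u = u" if "u \<in> range S" for u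
    unfolding P using orthonormal_span_expansion[OF C(1,3)] that spanC by metis
  have Pmem: "P v \<in> range S" for v
    unfolding P spanC[symmetric] by (intro span_sum span_mul span_base)
  have Psym: "P a \<bullet> b = a \<bullet> P b" for a b
    by (simp add: P inner_sum_left inner_sum_right inner_commute mult.commute)
  have SP: "S (P v) = S v" for v
  proof (rule onb_eqI[OF B])
    fix b
    show "S (P v) \<bullet> b = S v \<bullet> b" using Pfix[of "S b"] by (simp add: sym Psym)
  qed
  define T where "T = (P o\<^sub>L S o\<^sub>L P) + (id_blinfun - P)"
  have T: "T v = P (S (P v)) + (v - P v)" for v
    by (simp add: T_def blinfun.bilinear_simps)
  have T': "T v = S v + (v - P v)" for v unfolding T SP using Pfix by simp
  obtain J where J: "J o\<^sub>L T = id_blinfun" "T o\<^sub>L J = id_blinfun"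
  proof (rule blinfun_inverse_exists[OF B])
    fix v assume "T v = 0"
    \<comment> \<open>Applying P separates the two summands: it fixes S v and kills v - P v.\<close>
    then have "P (S v + (v - P v)) = 0" by (simp add: T')
    then have S0: "S v = 0" using Pfix Pmem by (simp add: blinfun.bilinear_simps)
    then have "v = P v" using \<open>T v = 0\<close> by (simp add: T')
    then obtain w where "v = S w" using Pmem by (metis imageE)
    then have "v \<bullet> v = 0" using sym[of v w] S0 by simp
    then show "v = 0" by simp
  qed
  have "norm v \<le> norm J * norm (T v)" for v
    using norm_blinfun[of J "T v"] J(1) by (metis blinfun_apply_blinfun_compose id_blinfun.rep_eq id_apply)
  then show thesis
    using that[of P "norm J"] Psym Pfix Pmem T by (metis image_subsetI norm_ge_zero rangeI subset_antisym subsetI)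
qed

text \<open>Here P need not project onto the image of S: it will be frozen at one point while S
  varies. Since J inverts P S P + (1 - P), one has J P S P = P, so S is injective on the image of P.
  The dimension bound then forces S to map that image onto its own, so every S v equals some S P w,
  and there the identity is immediate. Symmetry of the inverse comes from symmetry of the operator
  it inverts.\<close>

lemma generalised_inverse:
  fixes S P J :: "'e::real_inner \<Rightarrow>\<^sub>L 'e"
  assumes B: "is_onb (B::'e set)"
    and sym: "\<And>a b. S a \<bullet> b = a \<bullet> S b" "\<And>a b. P a \<bullet> b = a \<bullet> P b" and PP: "\<And>v. P (P v) = P v"
    and dim: "dim (range S) \<le> dim (range P)"
    and J: "\<And>v. P (S (P (J v))) + (J v - P (J v)) = v" "\<And>v. J (P (S (P v)) + (v - P v)) = v"
  shows "P (J (P a)) \<bullet> b = a \<bullet> P (J (P b))"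
    and "S (P (J (P (S v)))) = S v"
proof -
  have JPSP: "J (P (S (P v))) = P v" for v using J(2)[of "P v"] by (simp add: PP)
  have Jsym: "J a \<bullet> b = a \<bullet> J b" for a b
  proof -
    have "J a \<bullet> b = J a \<bullet> (P (S (P (J b))) + (J b - P (J b)))" by (simp add: J(1))
    also have "\<dots> = (P (S (P (J a))) + (J a - P (J a))) \<bullet> J b"
      by (simp add: inner_add_left inner_add_right inner_diff_left inner_diff_right sym)
    finally show ?thesis by (simp add: J(1))
  qed
  show "P (J (P a)) \<bullet> b = a \<bullet> P (J (P b))" by (simp add: sym Jsym)
  obtain C where C: "C \<subseteq> range P" "independent C" "range P \<subseteq> span C" "card C = dim (range P)"
    using basis_exists[of "range P"] by blast
  have sub: "subspace (range P)" using linear_subspace_image[OF linear_blinfun subspace_UNIV] .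
  then have span: "span C = range P" using C span_minimal by blast
  have inj: "inj_on S (span C)"
  proof (rule inj_onI)
    fix x y assume "x \<in> span C" "y \<in> span C" and eq: "S x = S y"
    then obtain a b where ab: "x = P a" "y = P b" unfolding span by blast
    have "P a = J (P (S (P b)))" using JPSP[of a] eq ab by argo
    then show "x = y" using JPSP[of b] ab by argo
  qed
  have "independent (S ` C)" by (rule linear_independent_injective_image[OF linear_blinfun C(2) inj])
  moreover have "card (S ` C) = card C"
    by (rule card_image) (use inj span_superset in \<open>blast intro: inj_on_subset\<close>)
  ultimately have "range S \<subseteq> span (S ` C)"
    by (intro subspace_eq_span_onb[OF B]) (use C(4) dim in auto)
  also have "\<dots> = S ` range P" using linear_span_image[OF linear_blinfun, of S C] span by simp
  finally obtain w where "S v = S (P w)" by blast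
  then show "S (P (J (P (S v)))) = S v" using JPSP PP by simp
qed

section \<open>Symmetric tensors of constant rank\<close>

locale symmetric_tensor_manifold = smooth_manifold A
  for A :: "('a::{t2_space, second_countable_topology}, 'e::real_inner) chart set" +
  fixes \<Theta> :: "('a, 'e) tensor20"
  assumes symmetric: "symmetric_tensor20 A \<Theta>" and rank: "constant_rank A \<Theta>"
begin

text \<open>The Riesz representative, inverse to \<open>blinfun_inner_right\<close>.\<close>

definition dual_vec :: "('e \<Rightarrow>\<^sub>L real) \<Rightarrow> 'e" where
  "dual_vec \<alpha> = (\<Sum>b\<in>onb. \<alpha> b *\<^sub>R b)"

lemma inner_dual_vec: "dual_vec \<alpha> \<bullet> v = \<alpha> v" "v \<bullet> dual_vec \<alpha> = \<alpha> v"
proof -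
  show "dual_vec \<alpha> \<bullet> v = \<alpha> v"
    unfolding dual_vec_def using linear_onb[OF is_onb linear_blinfun, of \<alpha> v]
    by (simp add: inner_sum_left inner_commute[of v] mult.commute)
  then show "v \<bullet> dual_vec \<alpha> = \<alpha> v" by (simp add: inner_commute)
qed

lemma blinfun_inner_right_dual_vec: "blinfun_inner_right (dual_vec \<alpha>) = \<alpha>"
  by (rule blinfun_eqI) (simp add: inner_dual_vec)

lemma dual_vec_inner: "dual_vec (blinfun_inner_right a) = a"
  unfolding dual_vec_def using is_onb_expand[OF is_onb, of a] by (simp only: blinfun_inner_right.rep_eq)

lemma bounded_linear_dual_vec: "bounded_linear dual_vec"
  unfolding dual_vec_def
  by (intro bounded_linear_sum bounded_linear_scaleR_const blinfun.bounded_linear_left)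

lemma tensor:
  assumes "c \<in> A" "p \<in> chart_dom c"
  shows "bilinear (\<Theta> c p)" "\<Theta> c p \<alpha> \<beta> = \<Theta> c p \<beta> \<alpha>"
  using symmetric assms unfolding symmetric_tensor20_def tensor20_field_def by blast+

lemma tensor_trans:
  assumes "c \<in> A" "d \<in> A" "p \<in> chart_dom c" "p \<in> chart_dom d"
  shows "\<Theta> d p \<alpha> \<beta> = \<Theta> c p (\<alpha> o\<^sub>L trans c d p) (\<beta> o\<^sub>L trans c d p)"
  using symmetric assms unfolding symmetric_tensor20_def tensor20_field_def by blast

lemma smooth_near_tensor:
  assumes "c \<in> A" "p \<in> chart_dom c"
  shows "smooth_near (\<lambda>q. \<Theta> c q \<alpha> \<beta>) p"
proof (rule smooth_nearI[OF assms(1) open_chart_dom[OF assms(1)] assms(2) order_refl])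
  show "smooth_on (coord c ` chart_dom c) (\<lambda>x. \<Theta> c (param c x) \<alpha> \<beta>)"
    using symmetric assms(1) unfolding symmetric_tensor20_def tensor20_field_def by blast
qed

text \<open>The definite description denotes: in finite dimension a functional on covectors is
  evaluation at exactly one vector, whose coordinates are its values on the dual basis.\<close>

lemma apply_tensor_morphism:
  fixes \<beta> :: "'e \<Rightarrow>\<^sub>L real"
  assumes "c \<in> A" "p \<in> chart_dom c"
  shows "\<beta> (tensor_morphism \<Theta> c p \<alpha>) = \<Theta> c p \<alpha> \<beta>"
proof -
  define v where "v = (\<Sum>b\<in>onb. \<Theta> c p \<alpha> (blinfun_inner_right b) *\<^sub>R b)"
  have lin: "linear (\<Theta> c p \<alpha>)" using tensor(1)[OF assms] by (simp add: bilinear_def)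
  have v: "\<forall>\<beta>. blinfun_apply \<beta> v = \<Theta> c p \<alpha> \<beta>"
  proof
    fix \<beta> :: "'e \<Rightarrow>\<^sub>L real"
    have "\<beta> = (\<Sum>b\<in>onb. \<beta> b *\<^sub>R blinfun_inner_right b)"
      by (subst blinfun_inner_right_dual_vec[of \<beta>, symmetric])
        (simp add: dual_vec_def linear_sum[OF bounded_linear.linear[OF bounded_linear_blinfun_inner_right]]
          linear_scale[OF bounded_linear.linear[OF bounded_linear_blinfun_inner_right]])
    then have "\<Theta> c p \<alpha> \<beta> = \<Theta> c p \<alpha> (\<Sum>b\<in>onb. \<beta> b *\<^sub>R blinfun_inner_right b)" by (rule arg_cong)
    also have "\<dots> = (\<Sum>b\<in>onb. \<beta> b * \<Theta> c p \<alpha> (blinfun_inner_right b))"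
      by (simp add: linear_sum[OF lin] linear_scale[OF lin])
    also have "\<dots> = \<beta> v" by (simp add: v_def blinfun.sum_right blinfun.scaleR_right mult.commute)
    finally show "\<beta> v = \<Theta> c p \<alpha> \<beta>" by simp
  qed
  have "w = v" if "\<forall>\<beta>. blinfun_apply \<beta> w = \<Theta> c p \<alpha> \<beta>" for w
  proof (rule onb_eqI[OF is_onb])
    fix b
    show "w \<bullet> b = v \<bullet> b"
      using that[rule_format, of "blinfun_inner_right b"] v[rule_format, of "blinfun_inner_right b"] by (simp add: inner_commute)
  qed
  with v have "\<forall>\<beta>. blinfun_apply \<beta> (tensor_morphism \<Theta> c p \<alpha>) = \<Theta> c p \<alpha> \<beta>"
    unfolding tensor_morphism_def by (rule theI)
  then show ?thesis by blast
qed

definition tensor_op :: "('a, 'e) chart \<Rightarrow> 'a \<Rightarrow> 'e \<Rightarrow>\<^sub>L 'e" where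
  "tensor_op c p = Blinfun (\<lambda>a. tensor_morphism \<Theta> c p (blinfun_inner_right a))"

lemma tensor_op_apply:
  assumes "c \<in> A" "p \<in> chart_dom c"
  shows "tensor_op c p a = tensor_morphism \<Theta> c p (blinfun_inner_right a)"
proof -
  have inner: "b \<bullet> tensor_morphism \<Theta> c p \<alpha> = \<Theta> c p \<alpha> (blinfun_inner_right b)" for b \<alpha>
    using apply_tensor_morphism[OF assms, of "blinfun_inner_right b" \<alpha>] by simp
  have lin: "linear (\<lambda>\<alpha>. \<Theta> c p \<alpha> \<beta>)" for \<beta> using tensor(1)[OF assms] by (simp add: bilinear_def)
  note lir = bounded_linear.linear[OF bounded_linear_blinfun_inner_right]
  have "linear (\<lambda>a. tensor_morphism \<Theta> c p (blinfun_inner_right a))"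
    by (rule linearI; rule onb_eqI[OF is_onb];
        simp add: inner_commute[of _ "_::'e"] inner inner_add_right linear_add[OF lir] linear_scale[OF lir]
        linear_add[OF lin] linear_scale[OF lin])
  then show ?thesis unfolding tensor_op_def by (rule blinfun_apply_Blinfun_linear)
qed

lemma inner_tensor_op:
  assumes "c \<in> A" "p \<in> chart_dom c"
  shows "b \<bullet> tensor_op c p a = \<Theta> c p (blinfun_inner_right a) (blinfun_inner_right b)"
  using apply_tensor_morphism[OF assms, of "blinfun_inner_right b"] tensor_op_apply[OF assms] by simp

lemma tensor_op_sym:
  assumes "c \<in> A" "p \<in> chart_dom c"
  shows "tensor_op c p a \<bullet> b = a \<bullet> tensor_op c p b"
  using inner_tensor_op[OF assms] tensor(2)[OF assms] by (metis inner_commute)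

lemma tensor_morphism_eq:
  assumes "c \<in> A" "p \<in> chart_dom c"
  shows "tensor_morphism \<Theta> c p \<alpha> = tensor_op c p (dual_vec \<alpha>)"
  using tensor_op_apply[OF assms] by (simp add: blinfun_inner_right_dual_vec)

lemma tensor_eq_inner:
  assumes "c \<in> A" "p \<in> chart_dom c"
  shows "\<Theta> c p \<alpha> \<beta> = dual_vec \<alpha> \<bullet> tensor_op c p (dual_vec \<beta>)"
  using inner_tensor_op[OF assms, of "dual_vec \<alpha>" "dual_vec \<beta>"] tensor(2)[OF assms]
  by (simp add: blinfun_inner_right_dual_vec)

lemma tensor_image_eq:
  assumes "c \<in> A" "p \<in> chart_dom c"
  shows "tensor_image \<Theta> c p = range (tensor_op c p)"
proof -
  have "tensor_op c p ` range dual_vec = tensor_op c p ` UNIV"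
    using dual_vec_inner by (metis surj_def)
  then show ?thesis
    unfolding tensor_image_def by (simp add: image_image tensor_morphism_eq[OF assms])
qed

lemma smooth_near_tensor_op:
  assumes "c \<in> A" "p \<in> chart_dom c"
  shows "smooth_near (tensor_op c) p"
proof (rule smooth_near_blinfunI[OF open_chart_dom[OF assms(1)] assms(2)])
  fix a
  show "smooth_near (\<lambda>q. tensor_op c q a) p"
  proof (rule smooth_near_cong[OF open_chart_dom[OF assms(1)] assms(2)])
    show "smooth_near (\<lambda>q. \<Sum>b\<in>onb. \<Theta> c q (blinfun_inner_right a) (blinfun_inner_right b) *\<^sub>R b) p"
      by (intro smooth_near_sum smooth_near_scaleR smooth_near_const smooth_near_tensor assms)
    show "(\<Sum>b\<in>onb. \<Theta> c q (blinfun_inner_right a) (blinfun_inner_right b) *\<^sub>R b) = tensor_op c q a"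
      if "q \<in> chart_dom c" for q
      using is_onb_expand[OF is_onb, of "tensor_op c q a"] inner_tensor_op[OF assms(1) that]
      by (simp add: inner_commute)
  qed
qed

definition sharp :: "('a, 'e) form1 \<Rightarrow> ('a, 'e) vfield" where
  "sharp \<xi> c p = (if c \<in> A \<and> p \<in> chart_dom c then tensor_op c p (dual_vec (\<xi> c p)) else 0)"

lemma form_sharp:
  fixes \<xi> \<eta> :: "('a, 'e) form1"
  assumes "c \<in> A" "p \<in> chart_dom c"
  shows "\<xi> c p (sharp \<eta> c p) = \<Theta> c p (\<xi> c p) (\<eta> c p)"
  using assms by (simp add: sharp_def tensor_eq_inner inner_dual_vec)

text \<open>Stated for covectors, since the identification of covectors with vectors by the inner
  product depends on the chart and does not commute with transitions.\<close>

lemma tensor_op_trans: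
  assumes c: "c \<in> A" "d \<in> A" "p \<in> chart_dom c" "p \<in> chart_dom d"
  shows "tensor_op d p (dual_vec \<beta>) = trans c d p (tensor_op c p (dual_vec (\<beta> o\<^sub>L trans c d p)))"
proof (rule onb_eqI[OF is_onb])
  fix b :: 'e
  let ?b = "blinfun_inner_right b"
  have "tensor_op d p (dual_vec \<beta>) \<bullet> b = \<Theta> d p \<beta> ?b"
    using apply_tensor_morphism[OF c(2,4), of ?b \<beta>] c by (simp add: tensor_morphism_eq inner_commute)
  also have "\<dots> = \<Theta> c p (\<beta> o\<^sub>L trans c d p) (?b o\<^sub>L trans c d p)" by (simp add: tensor_trans[OF c])
  also have "\<dots> = ?b (trans c d p (tensor_op c p (dual_vec (\<beta> o\<^sub>L trans c d p))))"
    using apply_tensor_morphism[OF c(1,3), of "?b o\<^sub>L trans c d p"] c by (simp add: tensor_morphism_eq)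
  finally show "tensor_op d p (dual_vec \<beta>) \<bullet> b = trans c d p (tensor_op c p (dual_vec (\<beta> o\<^sub>L trans c d p))) \<bullet> b"
    by (simp add: inner_commute)
qed

lemma trans_mem_tensor_image:
  assumes c: "c \<in> A" "d \<in> A" "p \<in> chart_dom c" "p \<in> chart_dom d"
  shows "trans c d p (tensor_op c p a) \<in> tensor_image \<Theta> d p"
proof -
  \<comment> \<open>The covector of \<open>a\<close> carried over by the inverse transition, so that
    pulling it back returns the original.\<close>
  let ?\<beta> = "blinfun_inner_right a o\<^sub>L trans d c p"
  have "?\<beta> o\<^sub>L trans c d p = blinfun_inner_right a"
    by (rule blinfun_eqI) (simp add: trans_comp trans_self c)
  then have "trans c d p (tensor_op c p a) = tensor_op d p (dual_vec ?\<beta>)"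
    unfolding tensor_op_trans[OF c] by (simp add: dual_vec_inner)
  then show ?thesis unfolding tensor_image_eq[OF c(2,4)] by simp
qed

lemma vector_field_sharp:
  assumes "one_form A \<xi>"
  shows "vector_field A (sharp \<xi>)"
proof (rule vector_field_onI[OF open_UNIV])
  fix p
  obtain c where c: "c \<in> A" "p \<in> chart_dom c" using ex_chart .
  have "smooth_near (sharp \<xi> c) p"
    by (rule smooth_near_cong[OF open_chart_dom[OF c(1)] c(2) _
        smooth_near_blinfun_apply[OF smooth_near_tensor_op[OF c] smooth_near_linear[OF bounded_linear_dual_vec one_formD(1)[OF assms c]]]])
      (use c in \<open>auto simp: sharp_def\<close>)
  with c show "\<exists>c\<in>A. p \<in> chart_dom c \<and> smooth_near (sharp \<xi> c) p" by blast
next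
  fix c d p assume c: "c \<in> A" "d \<in> A" "p \<in> chart_dom c" "p \<in> chart_dom d"
  have eq: "\<xi> d p o\<^sub>L trans c d p = \<xi> c p"
    by (rule blinfun_eqI) (simp add: one_formD(2)[OF assms c])
  show "sharp \<xi> d p = trans c d p (sharp \<xi> c p)"
    using tensor_op_trans[OF c, of "\<xi> d p"] c by (simp add: sharp_def eq)
qed (auto simp: sharp_def)

text \<open>Expanding both covariant derivatives of the forms turns \<open>\<nabla>\<Theta> = 0\<close> into a condition on \<open>\<nabla>\<close>
  itself.\<close>

lemma cov_deriv_tensor20_eq:
  fixes \<xi> \<eta> :: "('a, 'e) form1"
  assumes N: "connection A N" and X: "vector_field A X" and \<xi>: "one_form A \<xi>" and \<eta>: "one_form A \<eta>"
    and c: "c \<in> A" "p \<in> chart_dom c"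
  shows "cov_deriv_tensor20 A N X \<Theta> \<xi> \<eta> c p =
    \<xi> c p (N X (sharp \<eta>) c p) + \<eta> c p (N X (sharp \<xi>) c p) - vderiv X (\<lambda>q. \<Theta> c q (\<xi> c q) (\<eta> c q)) c p"
proof -
  have v: "vderiv X (\<lambda>q. \<xi> c q (sharp \<eta> c q)) c p = vderiv X (\<lambda>q. \<Theta> c q (\<xi> c q) (\<eta> c q)) c p" for \<xi> \<eta> :: "('a, 'e) form1"
    unfolding vderiv_eq_cderiv
    by (rule fun_cong[OF cderiv_cong[OF open_chart_dom[OF c(1)] c(2) _ c]]) (simp add: form_sharp c)
  have s: "vderiv X (\<lambda>q. \<Theta> c q (\<eta> c q) (\<xi> c q)) c p = vderiv X (\<lambda>q. \<Theta> c q (\<xi> c q) (\<eta> c q)) c p"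
    unfolding vderiv_eq_cderiv
    by (rule fun_cong[OF cderiv_cong[OF open_chart_dom[OF c(1)] c(2) _ c]]) (rule tensor(2)[OF c(1)])
  have "\<Theta> c p (cov_deriv_form A N X \<xi> c p) (\<eta> c p)
      = vderiv X (\<lambda>q. \<Theta> c q (\<xi> c q) (\<eta> c q)) c p - \<xi> c p (N X (sharp \<eta>) c p)"
    using cov_deriv_form_apply[OF N X \<xi> vector_field_sharp[OF \<eta>] c] by (simp add: form_sharp[OF c] v)
  moreover have "\<Theta> c p (\<xi> c p) (cov_deriv_form A N X \<eta> c p)
      = vderiv X (\<lambda>q. \<Theta> c q (\<xi> c q) (\<eta> c q)) c p - \<eta> c p (N X (sharp \<xi>) c p)"
    using cov_deriv_form_apply[OF N X \<eta> vector_field_sharp[OF \<xi>] c] by (simp add: form_sharp[OF c] v s tensor(2)[OF c])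
  ultimately show ?thesis by (simp add: cov_deriv_tensor20_def)
qed

section \<open>Smooth generalised inverses near a point\<close>

lemma smooth_near_continuous:
  assumes "smooth_near f p" "open V" "f p \<in> V"
  obtains W where "open W" "p \<in> W" "\<And>q. q \<in> W \<Longrightarrow> f q \<in> V"
proof -
  obtain c where c: "c \<in> A" "p \<in> chart_dom c" using ex_chart .
  obtain W where W: "open W" "p \<in> W" "W \<subseteq> chart_dom c" "open (coord c ` W)" "smooth_on (coord c ` W) (\<lambda>x. f (param c x))"
    using smooth_near_chart[OF assms(1) c] .
  let ?S = "coord c ` W \<inter> (\<lambda>x. f (param c x)) -` V"
  have "open ?S"
    by (rule continuous_open_preimage[OF smooth_on_imp_continuous_on[OF W(5)] W(4) assms(2)])
  show thesis
  proof (rule that)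
    show "open {q \<in> chart_dom c. coord c q \<in> ?S}" by (rule open_coord_vimage[OF c(1) \<open>open ?S\<close>])
    show "p \<in> {q \<in> chart_dom c. coord c q \<in> ?S}" using c W(2) assms(3) param_coord by auto
    show "f q \<in> V" if "q \<in> {q \<in> chart_dom c. coord c q \<in> ?S}" for q
      using that param_coord[OF c(1), of q] by simp
  qed
qed

text \<open>Symmetry makes the projections S G and G S adjoint to each other. This is how kernel
  vectors can test membership in the image.\<close>

definition ginverse_on :: "('a, 'e) chart \<Rightarrow> 'a set \<Rightarrow> ('a \<Rightarrow> 'e \<Rightarrow>\<^sub>L 'e) \<Rightarrow> bool" where
  "ginverse_on c W G \<longleftrightarrow> c \<in> A \<and> open W \<and> W \<subseteq> chart_dom c \<and> (\<forall>q\<in>W. smooth_near G q \<and>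
     (\<forall>a b. blinfun_apply (G q) a \<bullet> b = a \<bullet> G q b) \<and>
     (\<forall>v. tensor_op c q (G q (tensor_op c q v)) = tensor_op c q v))"

text \<open>P is frozen at p, so only S varies in the operator T, which stays invertible nearby by
  continuity. Its inverse is smooth in q, and so is the compression of the inverse by P.\<close>

lemma ex_ginverse:
  assumes c: "c \<in> A" "p \<in> chart_dom c"
  obtains W G where "ginverse_on c W G" "p \<in> W"
proof -
  let ?S = "tensor_op c"
  obtain P K where P: "\<And>a b. blinfun_apply P a \<bullet> b = a \<bullet> P b" "\<And>v. P (P v) = P v" "range P = range (?S p)"
    "K \<ge> 0" "\<And>v. norm v \<le> K * norm (P (?S p (P v)) + (v - P v))"
    by (rule symmetric_range_projection[OF is_onb tensor_op_sym[OF c]]) blast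
  define T where "T q = (P o\<^sub>L ?S q o\<^sub>L P) + (id_blinfun - P)" for q
  have T: "T q v = P (?S q (P v)) + (v - P v)" for q v
    by (simp add: T_def blinfun.bilinear_simps)
  have smT: "smooth_near T q" if "q \<in> chart_dom c" for q
    unfolding T_def by (intro smooth_near_add smooth_near_const smooth_near_blinfun_compose smooth_near_tensor_op c that)
  \<comment> \<open>With K \<delta> at most 1/2, the perturbation costs at most half of the norm of
    v, so the lower bound persists with 2 K in place of K. The summand 1 covers K = 0.\<close>
  define \<delta> where "\<delta> = 1 / (2 * (K + 1))"
  have \<delta>: "\<delta> > 0" "K * \<delta> \<le> 1/2" using P(4) by (auto simp: \<delta>_def field_simps)
  obtain W0 where W0: "open W0" "p \<in> W0" "\<And>q. q \<in> W0 \<Longrightarrow> T q \<in> ball (T p) \<delta>"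
    by (rule smooth_near_continuous[OF smT[OF c(2)] open_ball[of "T p" \<delta>]])
      (simp add: \<delta>(1), blast)
  define W where "W = W0 \<inter> chart_dom c"
  have W: "open W" "p \<in> W" "W \<subseteq> chart_dom c" using W0 c open_chart_dom[OF c(1)] by (auto simp: W_def)
  have bound: "norm v \<le> 2 * K * norm (T q v)" if "q \<in> W" for q v
  proof -
    have "norm (T p v - T q v) \<le> \<delta> * norm v"
      using norm_blinfun[of "T p - T q" v] W0(3)[of q] that mult_right_mono[of "norm (T p - T q)" \<delta> "norm v"]
      by (auto simp: W_def dist_norm blinfun.diff_left intro: order_trans)
    then have "norm (T p v) \<le> norm (T q v) + \<delta> * norm v"
      using norm_triangle_sub[of "T p v" "T q v"] by linarith
    then have "norm v \<le> K * (norm (T q v) + \<delta> * norm v)"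
      using P(5)[of v] mult_left_mono[OF _ P(4)] unfolding T[symmetric] by (meson order_trans)
    moreover have "K * \<delta> * norm v \<le> 1/2 * norm v" using \<delta>(2) by (intro mult_right_mono) auto
    ultimately show ?thesis by (simp add: algebra_simps)
  qed
  have "\<exists>J. J o\<^sub>L T q = id_blinfun \<and> T q o\<^sub>L J = id_blinfun" if "q \<in> W" for q
  proof (rule blinfun_inverse_exists[OF is_onb])
    show "v = 0" if "T q v = 0" for v using bound[OF \<open>q \<in> W\<close>, of v] that by simp
  qed blast
  then obtain J where J: "\<And>q. q \<in> W \<Longrightarrow> J q o\<^sub>L T q = id_blinfun" "\<And>q. q \<in> W \<Longrightarrow> T q o\<^sub>L J q = id_blinfun"
    by metis
  have J': "J q (P (?S q (P v)) + (v - P v)) = v" "P (?S q (P (J q v))) + (J q v - P (J q v)) = v" if "q \<in> W" for q v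
    using J(1,2)[OF that] by (metis T blinfun_apply_blinfun_compose id_blinfun.rep_eq id_apply)+
  have oW: "open (coord c ` W)" by (rule open_coord_image[OF c(1) W(1,3)])
  have param: "param c x \<in> W" if "x \<in> coord c ` W" for x using that W(3) param_coord[OF c(1)] by auto
  have "smooth_on (coord c ` (chart_dom c \<inter> W)) (\<lambda>x. T (param c x))"
    by (rule smooth_near_smooth_on[OF c(1) W(1)]) (use smT in auto)
  then have smT': "smooth_on (coord c ` W) (\<lambda>x. T (param c x))" using W(3) by (simp add: Int_absorb1)
  have "smooth_on (coord c ` W) (\<lambda>x. J (param c x))"
  proof (rule smooth_on_blinfun_inverse[OF oW _ _ _ smT'])
    show "norm (J (param c x)) \<le> 2 * K" if "x \<in> coord c ` W" for x
      by (rule norm_blinfun_inverse_le[OF J(2)[OF param[OF that]] _ bound[OF param[OF that]]]) (use P(4) in auto)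
  qed (use J param in auto)
  then have smJ: "smooth_near J q" if "q \<in> W" for q by (rule smooth_nearI[OF c(1) W(1) that W(3)])
  \<comment> \<open>Constant rank: the image at q has the dimension of the image at p, which is the
    range of P.\<close>
  have dimS: "dim (range (?S q)) \<le> dim (range P)" if "q \<in> W" for q
    using rank that W(3) c unfolding constant_rank_def P(3) by (metis order_refl subsetD tensor_image_eq)
  show thesis
  proof (rule that)
    show "ginverse_on c W (\<lambda>q. P o\<^sub>L J q o\<^sub>L P)"
      unfolding ginverse_on_def
    proof (intro conjI c W ballI allI)
      fix q assume q: "q \<in> W"
      then have qc: "q \<in> chart_dom c" using W by blast
      note gi = generalised_inverse[OF is_onb tensor_op_sym[OF c(1) qc] P(1,2) dimS[OF q] J'(2,1)[OF q]]
      show "smooth_near (\<lambda>q. P o\<^sub>L J q o\<^sub>L P) q"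
        by (intro smooth_near_blinfun_compose smooth_near_const smJ q)
      show "(P o\<^sub>L J q o\<^sub>L P) a \<bullet> b = a \<bullet> (P o\<^sub>L J q o\<^sub>L P) b" for a b using gi(1) by simp
      show "?S q ((P o\<^sub>L J q o\<^sub>L P) (?S q v)) = ?S q v" for v using gi(2) by simp
    qed
  qed (rule W(2))
qed

lemma ginverse_onD:
  assumes "ginverse_on c W G"
  shows "c \<in> A" "open W" "W \<subseteq> chart_dom c"
    and "q \<in> W \<Longrightarrow> smooth_near G q"
    and "q \<in> W \<Longrightarrow> G q a \<bullet> b = a \<bullet> G q b"
    and "q \<in> W \<Longrightarrow> tensor_op c q (G q (tensor_op c q v)) = tensor_op c q v"
  using assms unfolding ginverse_on_def by blast+

lemma ginverse_kernel:
  assumes "ginverse_on c W G" "q \<in> W"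
  shows "tensor_op c q (b - G q (tensor_op c q b)) = 0"
  using ginverse_onD(6)[OF assms] by (simp add: blinfun.diff_right)

text \<open>The vectors b - G S b lie in the kernel, hence pair to zero with z; moving G and S
  across the inner product turns this into S G z = z. The image is thus the orthogonal complement of
  the kernel.\<close>

lemma ginverse_range:
  assumes G: "ginverse_on c W G" "q \<in> W" and z: "\<And>a. tensor_op c q a = 0 \<Longrightarrow> a \<bullet> z = 0"
  shows "tensor_op c q (G q z) = z"
proof (rule onb_eqI[OF is_onb])
  fix b
  have q: "c \<in> A" "q \<in> chart_dom c" using ginverse_onD[OF G(1)] G(2) by auto
  have "(b - G q (tensor_op c q b)) \<bullet> z = 0" by (rule z[OF ginverse_kernel[OF G]])
  then have "b \<bullet> z = G q (tensor_op c q b) \<bullet> z" by (simp add: inner_diff_left)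
  also have "\<dots> = b \<bullet> tensor_op c q (G q z)"
    by (simp add: ginverse_onD(5)[OF G] tensor_op_sym[OF q])
  finally show "tensor_op c q (G q z) \<bullet> b = z \<bullet> b" by (simp add: inner_commute)
qed

section \<open>From a parallel tensor to an involutive image\<close>

lemma smooth_near_inner_right:
  "smooth_near f p \<Longrightarrow> smooth_near (\<lambda>q. blinfun_inner_right (f q)) p" for f :: "'a \<Rightarrow> 'e"
  by (rule smooth_near_linear[OF bounded_linear_blinfun_inner_right])

text \<open>In the expanded form of \<nabla>\<Theta> = 0, a form with vanishing \<open>sharp\<close>
  kills the derivative of the pairing as well as the term with its own \<open>sharp\<close>; only
  the claimed term is left. The form must be in the kernel everywhere, because \<open>N\<close> is
  applied to the global field \<open>sharp \<eta>\<close>.\<close>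

lemma parallel_kernel:
  assumes N: "connection A N" and par: "parallel A N \<Theta>"
    and X: "vector_field A X" and \<eta>: "one_form A \<eta>" and \<upsilon>: "one_form A \<upsilon>"
    and ker: "sharp \<eta> = (\<lambda>c p. 0)" and c: "c \<in> A" "p \<in> chart_dom c"
  shows "\<eta> c p (N X (sharp \<upsilon>) c p) = 0"
proof -
  have "vderiv X (\<lambda>q. \<Theta> c q (\<eta> c q) (\<upsilon> c q)) c p = cderiv c (\<lambda>q. 0) p (X c p)"
    unfolding vderiv_eq_cderiv
    by (rule fun_cong[OF cderiv_cong[OF open_chart_dom[OF c(1)] c(2) _ c]])
      (use form_sharp[OF c(1), of _ \<upsilon> \<eta>] tensor(2)[OF c(1)] ker in \<open>metis blinfun.zero_right\<close>)
  moreover have "cov_deriv_tensor20 A N X \<Theta> \<eta> \<upsilon> c p = 0"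
    using par X \<eta> \<upsilon> c unfolding parallel_def by blast
  ultimately show ?thesis
    unfolding cov_deriv_tensor20_eq[OF N X \<eta> \<upsilon> c] ker connection_zero[OF N X]
    by (simp add: cderiv_const)
qed

lemma integrable_tensor_imp_distribution:
  assumes "integrable_tensor A \<Theta>"
  shows "integrable_distribution A (tensor_image \<Theta>)"
proof -
  obtain N where N: "connection A N" and tf: "torsion_free A N" and par: "parallel A N \<Theta>"
    using assms unfolding integrable_tensor_def by blast
  have "lie_bracket X Y c p \<in> tensor_image \<Theta> c p"
    if U: "open U" "p \<in> U" and X: "vector_field_on A U X" "section_of A U (tensor_image \<Theta>) X"
      and Y: "vector_field_on A U Y" "section_of A U (tensor_image \<Theta>) Y" and c: "c \<in> A" "p \<in> chart_dom c" for U X Y c p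
  proof -
    obtain W G where G: "ginverse_on c W G" "p \<in> W" using ex_ginverse[OF c] .
    note Gd = ginverse_onD[OF G(1)]
    define V where "V = W \<inter> U"
    have V: "open V" "p \<in> V" "V \<subseteq> chart_dom c" using Gd U G(2) by (auto simp: V_def)
    obtain \<phi> W' where \<phi>: "cutoff V \<phi>" "open W'" "p \<in> W'" "W' \<subseteq> V" "\<And>q. q \<in> W' \<Longrightarrow> \<phi> q = 1"
      by (rule ex_plateau[OF V(1,2)]) blast
    \<comment> \<open>For a section of the image S G X = X, so G X is a covector with image X; cut
      off, it yields a global field that agrees with X near p.\<close>
    define lift where "lift X = ext_form c V \<phi> (\<lambda>q. blinfun_inner_right (G q (X c q)))" for X
    have lift: "one_form A (lift X)" "\<And>q. q \<in> W' \<Longrightarrow> sharp (lift X) c q = X c q"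
      if X: "vector_field_on A U X" "section_of A U (tensor_image \<Theta>) X" for X
    proof -
      show "one_form A (lift X)"
        unfolding lift_def
        by (rule one_form_ext_form[OF \<phi>(1) c(1) V(3)], intro smooth_near_inner_right smooth_near_blinfun_apply)
          (use Gd(4) vector_fieldD(1)[OF X(1) U(1) c(1)] V(3) in \<open>auto simp: V_def\<close>)
      fix q assume q: "q \<in> W'"
      then have qc: "q \<in> W" "q \<in> U" "q \<in> V" "q \<in> chart_dom c" using \<phi>(4) V(3) by (auto simp: V_def)
      then obtain u where u: "X c q = tensor_op c q u"
        using X(2) c(1) unfolding section_of_def by (metis IntI imageE tensor_image_eq)
      have "sharp (lift X) c q = tensor_op c q (G q (X c q))"
        using c(1) qc \<phi>(5)[OF q] by (simp add: sharp_def lift_def ext_form_apply ext_fun_def dual_vec_inner)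
      then show "sharp (lift X) c q = X c q" using Gd(6)[OF qc(1)] u by simp
    qed
    define X' where "X' = sharp (lift X)"
    define Y' where "Y' = sharp (lift Y)"
    have vf: "vector_field A X'" "vector_field A Y'"
      unfolding X'_def Y'_def using vector_field_sharp lift(1) X Y by blast+
    \<comment> \<open>The bracket at p sees only the germs of the two fields, and these are
      unchanged.\<close>
    have brk: "lie_bracket X' Y' c p = lie_bracket X Y c p"
      unfolding lie_bracket_eq_cderiv X'_def Y'_def
      using cderiv_cong[OF \<phi>(2,3) lift(2)[OF X] c] cderiv_cong[OF \<phi>(2,3) lift(2)[OF Y] c] lift(2)[OF X \<phi>(3)] lift(2)[OF Y \<phi>(3)]
      by simp
    have "a \<bullet> lie_bracket X Y c p = 0" if a: "tensor_op c p a = 0" for a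
    proof -
      \<comment> \<open>The kernel vector \<open>a\<close> is extended by projecting it to the
        kernel at every point. At p nothing changes since S a = 0 there, and after the cut-off
        \<open>sharp \<eta>\<close> vanishes on the whole manifold.\<close>
      define \<eta> where "\<eta> = ext_form c V \<phi> (\<lambda>q. blinfun_inner_right (a - G q (tensor_op c q a)))"
      have \<eta>: "one_form A \<eta>"
        unfolding \<eta>_def
        by (rule one_form_ext_form[OF \<phi>(1) c(1) V(3)], intro smooth_near_inner_right smooth_near_blinfun_apply smooth_near_diff smooth_near_const)
          (use Gd(4) smooth_near_tensor_op[OF c(1)] V(3) in \<open>auto simp: V_def\<close>)
      have zero: "sharp \<eta> c q = 0" if "q \<in> V" for q
      proof -
        have q: "q \<in> W" "q \<in> chart_dom c" using that V(3) by (auto simp: V_def)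
        have "sharp \<eta> c q = \<phi> q *\<^sub>R tensor_op c q (a - G q (tensor_op c q a))"
          using c(1) q that
          by (simp add: sharp_def \<eta>_def ext_form_apply ext_fun_def dual_vec_inner blinfun.scaleR_right
              linear_scale[OF bounded_linear.linear[OF bounded_linear_dual_vec]])
        then show ?thesis using ginverse_kernel[OF G(1) q(1)] by simp
      qed
      have ker: "sharp \<eta> = (\<lambda>c p. 0)"
      proof (rule vector_field_eqI[OF vector_field_sharp[OF \<eta>] vector_field_zero])
        fix d q assume d: "d \<in> A" "q \<in> chart_dom d"
        show "sharp \<eta> d q = 0"
        proof (cases "q \<in> V")
          case True
          then have "sharp \<eta> d q = trans c d q (sharp \<eta> c q)"
            using vector_fieldD(2)[OF vector_field_sharp[OF \<eta>] open_UNIV c(1) d(1) _ d(2)] V(3) by blast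
          then show ?thesis using zero[OF True] by simp
        next
          case False
          then show ?thesis
            by (simp add: sharp_def \<eta>_def ext_form_def ext_fun_def linear_0[OF bounded_linear.linear[OF bounded_linear_dual_vec]])
        qed
      qed
      have "\<eta> c p (N X' Y' c p) = 0" "\<eta> c p (N Y' X' c p) = 0"
        using parallel_kernel[OF N par vf(1) \<eta> lift(1)[OF Y] ker c]
          parallel_kernel[OF N par vf(2) \<eta> lift(1)[OF X] ker c]
        unfolding X'_def Y'_def by auto
      moreover have "N X' Y' c p - N Y' X' c p = lie_bracket X Y c p"
        using tf vf c brk unfolding torsion_free_def by metis
      ultimately have "\<eta> c p (lie_bracket X Y c p) = 0" by (metis blinfun.diff_right diff_zero)
      moreover have "\<eta> c p = blinfun_inner_right a"
        using c V(2) \<phi>(3,5) a by (simp add: \<eta>_def ext_form_apply ext_fun_def)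
      ultimately show ?thesis by simp
    qed
    then have "tensor_op c p (G p (lie_bracket X Y c p)) = lie_bracket X Y c p"
      by (rule ginverse_range[OF G])
    then show ?thesis unfolding tensor_image_eq[OF c] by (metis rangeI)
  qed
  then show ?thesis unfolding integrable_distribution_def section_of_def by blast
qed

section \<open>Constraints on the derivative of the tensor\<close>

abbreviation dS :: "('a, 'e) chart \<Rightarrow> 'a \<Rightarrow> 'e \<Rightarrow> 'e \<Rightarrow>\<^sub>L 'e" where
  "dS c p u \<equiv> cderiv c (tensor_op c) p u"

lemma linear_dS: "c \<in> A \<Longrightarrow> p \<in> chart_dom c \<Longrightarrow> linear (dS c p)"
  by (intro linear_cderiv smooth_near_tensor_op)

lemma cderiv_tensor_op_apply:
  assumes "c \<in> A" "p \<in> chart_dom c" "smooth_near f p"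
  shows "cderiv c (\<lambda>q. tensor_op c q (f q)) p u = dS c p u (f p) + tensor_op c p (cderiv c f p u)"
  by (rule cderiv_bilinear[OF bounded_bilinear_blinfun_apply smooth_near_tensor_op[OF assms(1,2)] assms(3,1,2)])

lemma cderiv_inner:
  assumes "smooth_near f p" "smooth_near g p" "c \<in> A" "p \<in> chart_dom c"
  shows "cderiv c (\<lambda>q. f q \<bullet> g q) p u = cderiv c f p u \<bullet> g p + f p \<bullet> cderiv c g p u"
  by (rule cderiv_bilinear[OF bounded_bilinear_inner assms])

lemma dS_sym:
  assumes c: "c \<in> A" "p \<in> chart_dom c"
  shows "dS c p u a \<bullet> b = a \<bullet> dS c p u b"
proof -
  have *: "dS c p u a = cderiv c (\<lambda>q. tensor_op c q a) p u" for a
    using cderiv_tensor_op_apply[OF c smooth_near_const, of a u] by (simp add: cderiv_const)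
  have sm: "smooth_near (\<lambda>q. tensor_op c q a) p" for a
    by (intro smooth_near_blinfun_apply smooth_near_tensor_op smooth_near_const c)
  have "dS c p u a \<bullet> b = cderiv c (\<lambda>q. tensor_op c q a \<bullet> b) p u"
    unfolding * using cderiv_inner[OF sm smooth_near_const c] by (simp add: cderiv_const)
  also have "cderiv c (\<lambda>q. tensor_op c q a \<bullet> b) p = cderiv c (\<lambda>q. a \<bullet> tensor_op c q b) p"
    by (rule cderiv_cong[OF open_chart_dom[OF c(1)] c(2) tensor_op_sym[OF c(1)] c])
  also have "\<dots> u = a \<bullet> dS c p u b"
    unfolding * using cderiv_inner[OF smooth_near_const sm c] by (simp add: cderiv_const)
  finally show ?thesis .
qed

text \<open>This is obtained by differentiating \<open>S = S G S\<close>.\<close>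

lemma dS_kernel:
  assumes G: "ginverse_on c W G" "p \<in> W" and a: "tensor_op c p a = 0" and b: "tensor_op c p b = 0"
  shows "dS c p u a \<bullet> b = 0"
proof -
  note Gd = ginverse_onD[OF G(1)]
  have c: "c \<in> A" "p \<in> chart_dom c" using Gd G(2) by auto
  have sm: "smooth_near (\<lambda>q. tensor_op c q a) p" "smooth_near (\<lambda>q. G q (tensor_op c q a)) p"
    by (intro smooth_near_blinfun_apply smooth_near_tensor_op smooth_near_const c Gd(4) G(2))+
  \<comment> \<open>The product rule leaves two terms: one vanishes because S a = 0, the other lies
    in the image of S and is orthogonal to the kernel vector b.\<close>
  have Sb: "tensor_op c p v \<bullet> b = 0" for v using tensor_op_sym[OF c, of v b] b by simp
  have "dS c p u a = cderiv c (\<lambda>q. tensor_op c q a) p u"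
    using cderiv_tensor_op_apply[OF c smooth_near_const, of a u] by (simp add: cderiv_const)
  also have "\<dots> = cderiv c (\<lambda>q. tensor_op c q (G q (tensor_op c q a))) p u"
    by (rule fun_cong[OF cderiv_cong[OF Gd(2) G(2) _ c]]) (simp add: Gd(6))
  also have "\<dots> = dS c p u (G p (tensor_op c p a)) + tensor_op c p (cderiv c (\<lambda>q. G q (tensor_op c q a)) p u)"
    by (rule cderiv_tensor_op_apply[OF c sm(2)])
  finally show ?thesis using a by (simp add: Sb)
qed

text \<open>Involutivity applied to the fields S u and S v with constant u and v. Their bracket at p
  is the difference of the two derivative terms, and being in the image it is orthogonal to the
  kernel.\<close>

lemma dS_involutive:
  assumes D: "integrable_distribution A (tensor_image \<Theta>)" and c: "c \<in> A" "p \<in> chart_dom c"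
    and z: "tensor_op c p z = 0"
  shows "dS c p (tensor_op c p u) v \<bullet> z = dS c p (tensor_op c p v) u \<bullet> z"
proof -
  let ?V = "chart_dom c"
  \<comment> \<open>Restricted to the chart domain without a cut-off: involutivity quantifies over
    sections on arbitrary open sets.\<close>
  define X where "X u d q = (if d \<in> A \<and> q \<in> chart_dom d \<inter> ?V then trans c d q (tensor_op c q u) else 0)" for u d q
  have Xc: "X u c q = tensor_op c q u" if "q \<in> ?V" for u q using that c by (simp add: X_def trans_self)
  have sm: "smooth_near (\<lambda>q. tensor_op c q u) p" if "p \<in> ?V" for p u
    by (intro smooth_near_blinfun_apply smooth_near_tensor_op smooth_near_const c(1) that)
  have X: "vector_field_on A ?V (X u)" for u
  proof (rule vector_field_onI[OF open_chart_dom[OF c(1)]])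
    fix q assume q: "q \<in> ?V"
    have "smooth_near (X u c) q"
      by (rule smooth_near_cong[OF open_chart_dom[OF c(1)] q _ sm[OF q]]) (rule Xc[symmetric])
    with c(1) q show "\<exists>d\<in>A. q \<in> chart_dom d \<and> smooth_near (X u d) q" by blast
  next
    fix d e q assume "d \<in> A" "e \<in> A" "q \<in> chart_dom d" "q \<in> chart_dom e" "q \<in> ?V"
    then show "X u e q = trans d e q (X u d q)" using c(1) by (simp add: X_def trans_comp)
  qed (auto simp: X_def)
  have sec: "section_of A ?V (tensor_image \<Theta>) (X u)" for u
    unfolding section_of_def using trans_mem_tensor_image c(1) by (auto simp: X_def)
  have "section_of A ?V (tensor_image \<Theta>) (lie_bracket (X u) (X v))"
    using D X sec open_chart_dom[OF c(1)] unfolding integrable_distribution_def by blast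
  then have "lie_bracket (X u) (X v) c p \<in> range (tensor_op c p)"
    using c by (simp add: section_of_def tensor_image_eq)
  moreover have "cderiv c (X v c) p w = dS c p w v" for v w
  proof -
    have "cderiv c (X v c) p = cderiv c (\<lambda>q. tensor_op c q v) p"
      by (rule cderiv_cong[OF open_chart_dom[OF c(1)] c(2) Xc c])
    then show ?thesis using cderiv_tensor_op_apply[OF c smooth_near_const, of v w] by (simp add: cderiv_const)
  qed
  ultimately have "dS c p (tensor_op c p u) v - dS c p (tensor_op c p v) u \<in> range (tensor_op c p)"
    by (simp add: lie_bracket_eq_cderiv Xc c(2))
  then obtain w where "dS c p (tensor_op c p u) v - dS c p (tensor_op c p v) u = tensor_op c p w" by blast
  then have "(dS c p (tensor_op c p u) v - dS c p (tensor_op c p v) u) \<bullet> z = 0"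
    using tensor_op_sym[OF c, of w z] z by simp
  then show ?thesis by (simp add: inner_diff_left)
qed

section \<open>Local solution for the Christoffel symbols\<close>

text \<open>The unknown \<open>\<Gamma>\<close> must be symmetric and satisfy
  \<open>\<langle>\<Gamma>(x, S a), b\<rangle> + \<langle>a, \<Gamma>(x, S b)\<rangle> = - \<langle>B x a, b\<rangle>\<close>, where \<open>B x\<close> is the derivative of \<open>S\<close>
  in the direction \<open>x\<close>. Taking \<open>b\<close> in the kernel of \<open>S\<close> forces \<open>Q \<Gamma>(x, y) = - Q (B x (G y))\<close> for
  \<open>y\<close> in the image; the \<open>Q\<close>-terms below are the symmetric extension of this. The component along the
  image is the Koszul formula for the metric \<open>G\<close> dual to \<open>S\<close>.\<close>

definition christoffel :: "('a, 'e) chart \<Rightarrow> ('a \<Rightarrow> 'e \<Rightarrow>\<^sub>L 'e) \<Rightarrow> 'a \<Rightarrow> 'e \<Rightarrow> 'e \<Rightarrow> 'e" where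
  "christoffel c G q x y = (let S = tensor_op c q; g = G q; B = dS c q; Q = (\<lambda>w. w - S (g w)) in
     (1/2) *\<^sub>R S ((\<Sum>b\<in>onb. (B b (g x) \<bullet> g y) *\<^sub>R b) - g (B x (g y)) - g (B y (g x)))
     - Q (B x (g y)) - Q (B (Q y) (g x)))"

lemma smooth_near_christoffel:
  assumes G: "ginverse_on c W G" "p \<in> W" and x: "smooth_near x p" and y: "smooth_near y p"
  shows "smooth_near (\<lambda>q. christoffel c G q (x q) (y q)) p"
proof -
  have c: "c \<in> A" "p \<in> chart_dom c" using ginverse_onD[OF G(1)] G(2) by auto
  note intros = smooth_near_diff smooth_near_blinfun_apply smooth_near_scaleR smooth_near_sum smooth_near_const
    smooth_near_inner smooth_near_cderiv smooth_near_tensor_op[OF c] ginverse_onD(4)[OF G] x y c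
  show ?thesis unfolding christoffel_def Let_def by (intro intros)
qed

definition local_nabla :: "('a, 'e) chart \<Rightarrow> ('a \<Rightarrow> 'e \<Rightarrow>\<^sub>L 'e) \<Rightarrow> ('a, 'e) vfield \<Rightarrow> ('a, 'e) vfield \<Rightarrow> 'a \<Rightarrow> 'e" where
  "local_nabla c G X Y p = cderiv c (Y c) p (X c p) + christoffel c G p (X c p) (Y c p)"

lemma smooth_near_form_vec:
  "one_form A \<xi> \<Longrightarrow> c \<in> A \<Longrightarrow> p \<in> chart_dom c \<Longrightarrow> smooth_near (\<lambda>q. dual_vec (\<xi> c q)) p"
  by (intro smooth_near_linear[OF bounded_linear_dual_vec] one_formD(1))

lemma smooth_near_tensor_forms:
  fixes \<xi> \<eta> :: "('a, 'e) form1"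
  assumes \<xi>: "one_form A \<xi>" and \<eta>: "one_form A \<eta>" and c: "c \<in> A" "p \<in> chart_dom c"
  shows "smooth_near (\<lambda>q. \<Theta> c q (\<xi> c q) (\<eta> c q)) p"
  by (rule smooth_near_cong[OF open_chart_dom[OF c(1)] c(2) _ smooth_near_pairing[OF \<xi> vector_field_sharp[OF \<eta>] c]])
    (rule form_sharp[OF c(1)])

lemma vderiv_tensor_forms_chart:
  fixes \<xi> \<eta> :: "('a, 'e) form1"
  assumes \<xi>: "one_form A \<xi>" and \<eta>: "one_form A \<eta>" and X: "vector_field A X"
    and c: "c \<in> A" "d \<in> A" "p \<in> chart_dom c" "p \<in> chart_dom d"
  shows "vderiv X (\<lambda>q. \<Theta> c q (\<xi> c q) (\<eta> c q)) c p = vderiv X (\<lambda>q. \<Theta> d q (\<xi> d q) (\<eta> d q)) d p"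
proof -
  have eq: "\<xi> c q = \<xi> d q o\<^sub>L trans c d q" if "q \<in> chart_dom c \<inter> chart_dom d" "one_form A \<xi>" for q \<xi>
    using that c(1,2) unfolding one_form_iff by blast
  have "cderiv c (\<lambda>q. \<Theta> c q (\<xi> c q) (\<eta> c q)) p = cderiv c (\<lambda>q. \<Theta> d q (\<xi> d q) (\<eta> d q)) p"
    by (rule cderiv_cong[of "chart_dom c \<inter> chart_dom d"])
      (use c eq \<xi> \<eta> tensor_trans[OF c(1,2)] in \<open>auto intro!: open_Int open_chart_dom\<close>)
  then show ?thesis
    using cderiv_chart_change[OF smooth_near_tensor_forms[OF \<xi> \<eta> c(2,4)] c] vector_fieldD(2)[OF X open_UNIV c UNIV_I]
    by (simp add: vderiv_eq_cderiv)
qed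

section \<open>Christoffel symbols and the local connection at a point\<close>

context
  fixes c W G p
  assumes G: "ginverse_on c W G" "p \<in> W"
begin

private lemma c: "c \<in> A" "p \<in> chart_dom c"
  using ginverse_onD[OF G(1)] G(2) by auto

private lemma linear_B_apply: "linear (\<lambda>u. dS c p u v)"
  by (rule linearI) (simp_all add: linear_add[OF linear_dS[OF c]] linear_scale[OF linear_dS[OF c]] blinfun.bilinear_simps)

lemma christoffel_add:
  "christoffel c G p (x + x') y = christoffel c G p x y + christoffel c G p x' y"
  "christoffel c G p x (y + y') = christoffel c G p x y + christoffel c G p x y'"
  unfolding christoffel_def Let_def
  by (simp_all add: linear_add[OF linear_dS[OF c]] linear_diff[OF linear_dS[OF c]] blinfun.bilinear_simps inner_add_left inner_add_right
      scaleR_add_left sum.distrib algebra_simps)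

lemma christoffel_scale:
  "christoffel c G p (r *\<^sub>R x) y = r *\<^sub>R christoffel c G p x y"
  "christoffel c G p x (r *\<^sub>R y) = r *\<^sub>R christoffel c G p x y"
proof -
  have s: "(\<Sum>b\<in>onb. (r * f b) *\<^sub>R b) = r *\<^sub>R (\<Sum>b\<in>onb. f b *\<^sub>R b)" for f :: "'e \<Rightarrow> real"
    by (simp add: scaleR_sum_right)
  show "christoffel c G p (r *\<^sub>R x) y = r *\<^sub>R christoffel c G p x y"
    "christoffel c G p x (r *\<^sub>R y) = r *\<^sub>R christoffel c G p x y"
    unfolding christoffel_def Let_def
    by (simp_all add: linear_scale[OF linear_dS[OF c]] linear_diff[OF linear_dS[OF c]] blinfun.bilinear_simps s algebra_simps)
qed

text \<open>The sum in \<open>christoffel\<close> is the Riesz representative of w \<mapsto>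
  \<langle>B w x, y\<rangle>, the Koszul term in which the test vector becomes the direction of
  differentiation.\<close>

private lemma inner_cyclic: "w \<bullet> (\<Sum>b\<in>onb. (dS c p b x \<bullet> y) *\<^sub>R b) = dS c p w x \<bullet> y"
proof -
  have "linear (\<lambda>w. dS c p w x \<bullet> y)"
    by (rule linearI) (simp_all add: linear_add[OF linear_B_apply] linear_scale[OF linear_B_apply] inner_add_left)
  from linear_onb[OF is_onb this, of w] show ?thesis
    by (simp add: inner_sum_right mult.commute)
qed

text \<open>The Koszul part is symmetric because each B is. In the transverse part, x = S G x + Q x
  is split in the direction of differentiation: the terms with Q x and Q y match up, and what
  remains has both directions in the image, where involutivity applies.\<close>

lemma christoffel_sym:
  assumes "integrable_distribution A (tensor_image \<Theta>)"
  shows "christoffel c G p x y = christoffel c G p y x"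
proof -
  let ?S = "tensor_op c p" and ?g = "G p" and ?B = "dS c p"
  define Q where "Q w = w - ?S (?g w)" for w
  have Q_inner: "Q w \<bullet> b = w \<bullet> (b - ?g (?S b))" for w b
    by (simp add: Q_def inner_diff_left inner_diff_right tensor_op_sym[OF c] ginverse_onD(5)[OF G])
  have inv: "Q (?B (?S u) v) = Q (?B (?S v) u)" for u v
    by (rule onb_eqI[OF is_onb])
      (simp only: Q_inner dS_involutive[OF assms c ginverse_kernel[OF G]])
  have split: "Q (?B x v) = Q (?B (?S (?g x)) v) + Q (?B (Q x) v)" for x v
  proof -
    have "?B x v = ?B (?S (?g x)) v + ?B (Q x) v"
      using linear_add[OF linear_B_apply, of "?S (?g x)" "Q x" v] by (simp add: Q_def)
    then show ?thesis by (simp add: Q_def blinfun.bilinear_simps algebra_simps)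
  qed
  have "Q (?B x (?g y)) + Q (?B (Q y) (?g x)) = Q (?B y (?g x)) + Q (?B (Q x) (?g y))"
    using split[of x "?g y"] split[of y "?g x"] inv[of "?g x" "?g y"] by simp
  moreover have "?B b (?g x) \<bullet> ?g y = ?B b (?g y) \<bullet> ?g x" for b
    using dS_sym[OF c] by (simp add: inner_commute)
  ultimately show ?thesis
    unfolding christoffel_def Let_def Q_def[symmetric] by (simp add: algebra_simps)
qed

text \<open>For y = S a one has Q y = 0, so the last term of \<open>christoffel\<close> drops out,
  and G y = R a with R = G S. In the sum of the formula and its mirror image the Koszul terms
  differentiating along S a and S b cancel. The rest is the expansion of
  \<open>?B x a \<bullet> b\<close>, in which the kernel parts a - R a and b - R b pair to zero by
  \<open>dS_kernel\<close>.\<close>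

lemma christoffel_compatible:
  "christoffel c G p x (tensor_op c p a) \<bullet> b + a \<bullet> christoffel c G p x (tensor_op c p b) + dS c p x a \<bullet> b = 0"
proof -
  let ?S = "tensor_op c p" and ?g = "G p" and ?B = "dS c p"
  have B0: "?B 0 v = 0" for v using linear_0[OF linear_B_apply] .
  define R where "R b = ?g (?S b)" for b
  have SR: "?S (R b) = ?S b" for b using ginverse_onD(6)[OF G] by (simp add: R_def)
  have S_inner: "?S w \<bullet> b = w \<bullet> ?S b" for w b by (rule tensor_op_sym[OF c])
  have P_inner: "?S (?g w) \<bullet> b = w \<bullet> R b" for w b
    by (simp add: R_def S_inner ginverse_onD(5)[OF G])
  have half: "christoffel c G p x (?S a) \<bullet> b = (1/2) * (?B (?S b) (?g x) \<bullet> R a - ?B x (R a) \<bullet> R b - ?B (?S a) (?g x) \<bullet> R b)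
      - (?B x (R a) \<bullet> b - ?B x (R a) \<bullet> R b)" for a b
  proof -
    have "christoffel c G p x (?S a) = (1/2) *\<^sub>R (?S (\<Sum>e\<in>onb. (?B e (?g x) \<bullet> R a) *\<^sub>R e) - ?S (?g (?B x (R a))) - ?S (?g (?B (?S a) (?g x))))
        - (?B x (R a) - ?S (?g (?B x (R a))))"
      unfolding christoffel_def Let_def R_def[symmetric] by (simp add: blinfun.bilinear_simps SR B0)
    then have "christoffel c G p x (?S a) \<bullet> b = (1/2) * (?S (\<Sum>e\<in>onb. (?B e (?g x) \<bullet> R a) *\<^sub>R e) \<bullet> b
        - ?S (?g (?B x (R a))) \<bullet> b - ?S (?g (?B (?S a) (?g x))) \<bullet> b)
        - (?B x (R a) \<bullet> b - ?S (?g (?B x (R a))) \<bullet> b)"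
      by (simp add: inner_diff_left)
    then show ?thesis
      unfolding P_inner unfolding S_inner by (simp add: inner_commute[of _ "?S b"] inner_cyclic)
  qed
  have "?B x (a - R a) \<bullet> (b - R b) = 0"
    unfolding R_def by (rule dS_kernel[OF G ginverse_kernel[OF G] ginverse_kernel[OF G]])
  then have "?B x a \<bullet> b = ?B x (R a) \<bullet> b + ?B x (R b) \<bullet> a - ?B x (R a) \<bullet> R b"
    using dS_sym[OF c, of x a "R b"] by (simp add: blinfun.diff_right inner_diff_left inner_diff_right inner_commute)
  moreover have "?B x (R b) \<bullet> R a = ?B x (R a) \<bullet> R b" using dS_sym[OF c] by (simp add: inner_commute)
  moreover have "a \<bullet> christoffel c G p x (?S b) = christoffel c G p x (?S b) \<bullet> a" by (rule inner_commute)
  ultimately show ?thesis unfolding half by (simp add: algebra_simps)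
qed

lemma smooth_near_local_nabla:
  assumes "vector_field A X" "vector_field A Y"
  shows "smooth_near (local_nabla c G X Y) p"
  unfolding local_nabla_def
  by (intro smooth_near_add smooth_near_cderiv smooth_near_christoffel[OF G] c vector_fieldD(1)[OF assms(1) open_UNIV]
      vector_fieldD(1)[OF assms(2) open_UNIV] UNIV_I)

lemma local_nabla_add_left:
  assumes "vector_field A Y"
  shows "local_nabla c G (\<lambda>c p. X c p + X' c p) Y p = local_nabla c G X Y p + local_nabla c G X' Y p"
  using linear_add[OF linear_cderiv[OF vector_fieldD(1)[OF assms open_UNIV c UNIV_I] c]]
  by (simp add: local_nabla_def christoffel_add)

lemma local_nabla_add_right:
  assumes "vector_field A Y" "vector_field A Y'"
  shows "local_nabla c G X (\<lambda>c p. Y c p + Y' c p) p = local_nabla c G X Y p + local_nabla c G X Y' p"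
  using cderiv_add[OF vector_fieldD(1)[OF assms(1) open_UNIV c UNIV_I] vector_fieldD(1)[OF assms(2) open_UNIV c UNIV_I] c]
  by (simp add: local_nabla_def christoffel_add)

lemma local_nabla_scale_left:
  assumes "vector_field A Y"
  shows "local_nabla c G (\<lambda>c p. f p *\<^sub>R X c p) Y p = f p *\<^sub>R local_nabla c G X Y p"
  using linear_scale[OF linear_cderiv[OF vector_fieldD(1)[OF assms open_UNIV c UNIV_I] c]]
  by (simp add: local_nabla_def christoffel_scale scaleR_add_right)

lemma local_nabla_leibniz:
  assumes "vector_field A Y" "smooth_function A f"
  shows "local_nabla c G X (\<lambda>c p. f p *\<^sub>R Y c p) p = f p *\<^sub>R local_nabla c G X Y p + vderiv X f c p *\<^sub>R Y c p"
  using cderiv_bilinear[OF bounded_bilinear_scaleR _ vector_fieldD(1)[OF assms(1) open_UNIV c UNIV_I] c, of f] assms(2)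
  by (simp add: local_nabla_def christoffel_scale scaleR_add_right smooth_function_iff vderiv_eq_cderiv)

lemma local_nabla_torsion:
  assumes "integrable_distribution A (tensor_image \<Theta>)"
  shows "local_nabla c G X Y p - local_nabla c G Y X p = lie_bracket X Y c p"
  using christoffel_sym[OF assms, of "X c p" "Y c p"] by (simp add: local_nabla_def lie_bracket_eq_cderiv)

text \<open>This is \<nabla>\<Theta> = 0 in the shape of \<open>cov_deriv_tensor20_eq\<close>. In
  the product rule for k \<bullet> S h the derivatives of k and h match on both sides by symmetry of
  S, and the remainder is \<open>christoffel_compatible\<close>.\<close>

lemma local_nabla_parallel:
  fixes \<xi> \<eta> :: "('a, 'e) form1"
  assumes \<xi>: "one_form A \<xi>" and \<eta>: "one_form A \<eta>"
  shows "\<xi> c p (local_nabla c G X (sharp \<eta>) p) + \<eta> c p (local_nabla c G X (sharp \<xi>) p)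
    = vderiv X (\<lambda>q. \<Theta> c q (\<xi> c q) (\<eta> c q)) c p"
proof -
  let ?S = "tensor_op c p" and ?x = "X c p"
  define k where "k q = dual_vec (\<xi> c q)" for q
  define h where "h q = dual_vec (\<eta> c q)" for q
  have sm: "smooth_near k p" "smooth_near h p"
    unfolding k_def h_def by (intro smooth_near_form_vec \<xi> \<eta> c)+
  have sharp_k: "sharp \<xi> c q = tensor_op c q (k q)" and sharp_h: "sharp \<eta> c q = tensor_op c q (h q)"
    if "q \<in> chart_dom c" for q using that c(1) by (simp_all add: sharp_def k_def h_def)
  have dk: "cderiv c (sharp \<xi> c) p ?x = dS c p ?x (k p) + ?S (cderiv c k p ?x)"
  proof -
    have "cderiv c (sharp \<xi> c) p = cderiv c (\<lambda>q. tensor_op c q (k q)) p"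
      by (rule cderiv_cong[OF open_chart_dom[OF c(1)] c(2) _ c]) (rule sharp_k)
    then show ?thesis using cderiv_tensor_op_apply[OF c sm(1)] by simp
  qed
  have dh: "cderiv c (sharp \<eta> c) p ?x = dS c p ?x (h p) + ?S (cderiv c h p ?x)"
  proof -
    have "cderiv c (sharp \<eta> c) p = cderiv c (\<lambda>q. tensor_op c q (h q)) p"
      by (rule cderiv_cong[OF open_chart_dom[OF c(1)] c(2) _ c]) (rule sharp_h)
    then show ?thesis using cderiv_tensor_op_apply[OF c sm(2)] by simp
  qed
  have smSh: "smooth_near (\<lambda>q. tensor_op c q (h q)) p"
    by (intro smooth_near_blinfun_apply smooth_near_tensor_op sm c)
  have "vderiv X (\<lambda>q. \<Theta> c q (\<xi> c q) (\<eta> c q)) c p = cderiv c (\<lambda>q. k q \<bullet> tensor_op c q (h q)) p ?x"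
    unfolding vderiv_eq_cderiv
    by (rule fun_cong[OF cderiv_cong[OF open_chart_dom[OF c(1)] c(2) _ c]]) (simp add: tensor_eq_inner c(1) k_def h_def)
  also have "\<dots> = cderiv c k p ?x \<bullet> ?S (h p) + k p \<bullet> (dS c p ?x (h p) + ?S (cderiv c h p ?x))"
    using cderiv_inner[OF sm(1) smSh c] cderiv_tensor_op_apply[OF c sm(2)] by simp
  finally have v: "vderiv X (\<lambda>q. \<Theta> c q (\<xi> c q) (\<eta> c q)) c p
    = cderiv c k p ?x \<bullet> ?S (h p) + k p \<bullet> (dS c p ?x (h p) + ?S (cderiv c h p ?x))" .
  have "\<xi> c p w = k p \<bullet> w" "\<eta> c p w = h p \<bullet> w" for w
    by (simp_all add: k_def h_def inner_dual_vec)
  moreover have "cderiv c k p ?x \<bullet> ?S (h p) = h p \<bullet> ?S (cderiv c k p ?x)"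
    using tensor_op_sym[OF c, of "cderiv c k p ?x" "h p"] inner_commute[of "h p"] by simp
  ultimately show ?thesis
    using christoffel_compatible[of ?x "h p" "k p"] dS_sym[OF c, of ?x "h p" "k p"]
    by (simp add: v local_nabla_def dk dh sharp_k sharp_h c(2) inner_add_right inner_commute)
qed

end

section \<open>Gluing the local connections\<close>

context
  fixes \<phi> :: "nat \<Rightarrow> 'a \<Rightarrow> real" and V C G
  assumes \<phi>: "\<And>n. cutoff (V n) (\<phi> n)" and G: "\<And>n. ginverse_on (C n) (V n) (G n)"
    and locally_finite: "\<And>p. \<exists>W m. open W \<and> p \<in> W \<and> (\<forall>q\<in>W. (\<forall>n\<ge>m. \<phi> n q = 0) \<and> (\<Sum>n<m. \<phi> n q) = 1)"
begin

text \<open>Summing over nonzero weights avoids choosing a bound depending on q; local finiteness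
  makes the index set finite. As the weights sum to 1, the average fixes constants and so preserves
  affine conditions.\<close>

private definition avg :: "'a \<Rightarrow> (nat \<Rightarrow> 'f::real_vector) \<Rightarrow> 'f" where
  "avg q Z = (\<Sum>n | \<phi> n q \<noteq> 0. \<phi> n q *\<^sub>R Z n)"

private lemma avg_eq:
  assumes "\<forall>n\<ge>m. \<phi> n q = 0"
  shows "avg q Z = (\<Sum>n<m. \<phi> n q *\<^sub>R Z n)"
proof -
  have "{n. \<phi> n q \<noteq> 0} \<subseteq> {..<m}" using assms by (auto simp: not_le[symmetric])
  then show ?thesis unfolding avg_def by (intro sum.mono_neutral_left) auto
qed

private lemma avg_const: "avg q (\<lambda>n. z) = z"
proof -
  obtain m where "\<forall>n\<ge>m. \<phi> n q = 0" "(\<Sum>n<m. \<phi> n q) = 1" using locally_finite by blast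
  then show ?thesis using avg_eq[of m q "\<lambda>n. z"] by (simp add: scaleR_sum_left[symmetric])
qed

private lemma avg_add: "avg q (\<lambda>n. Z n + Z' n) = avg q Z + avg q Z'"
  by (simp add: avg_def scaleR_add_right sum.distrib)

private lemma avg_linear: "linear h \<Longrightarrow> h (avg q Z) = avg q (\<lambda>n. h (Z n))"
  by (simp add: avg_def linear_sum linear_scale)

text \<open>The weight vanishes off V n, so identities of local connections are needed only where
  their charts and generalised inverses are valid.\<close>

private lemma avg_cong:
  assumes "\<And>n. q \<in> V n \<Longrightarrow> Z n = Z' n"
  shows "avg q Z = avg q Z'"
proof -
  have "q \<in> V n" if "\<phi> n q \<noteq> 0" for n using \<phi>[of n] that unfolding cutoff_def by blast
  then show ?thesis unfolding avg_def by (intro sum.cong) (auto simp: assms)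
qed

private lemma C: "C n \<in> A" "q \<in> V n \<Longrightarrow> q \<in> chart_dom (C n)"
  using ginverse_onD[OF G] by auto

definition glued_nabla :: "('a, 'e) vfield \<Rightarrow> ('a, 'e) vfield \<Rightarrow> ('a, 'e) vfield" where
  "glued_nabla X Y d q = (if d \<in> A \<and> q \<in> chart_dom d
     then avg q (\<lambda>n. trans (C n) d q (local_nabla (C n) (G n) X Y q)) else 0)"

private lemma vector_field_glued_nabla:
  assumes X: "vector_field A X" and Y: "vector_field A Y"
  shows "vector_field A (glued_nabla X Y)"
proof (rule vector_field_onI[OF open_UNIV])
  fix p
  obtain d where d: "d \<in> A" "p \<in> chart_dom d" using ex_chart .
  obtain W m where W: "open W" "p \<in> W" "\<And>q. q \<in> W \<Longrightarrow> \<forall>n\<ge>m. \<phi> n q = 0" using locally_finite[of p] by blast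
  \<comment> \<open>Each weighted local derivative is a global smooth field after extension by zero;
    near p the glued one is a finite sum of these.\<close>
  define E where "E n = ext_vfield (C n) (V n) (\<phi> n) (local_nabla (C n) (G n) X Y)" for n
  have E: "vector_field A (E n)" for n
    unfolding E_def
    by (rule vector_field_ext_vfield[OF \<phi> C(1) ginverse_onD(3)[OF G] smooth_near_local_nabla[OF G _ X Y]])
  have "smooth_near (glued_nabla X Y d) p"
  proof (rule smooth_near_cong)
    show "open (W \<inter> chart_dom d)" by (intro open_Int W open_chart_dom d)
    show "smooth_near (\<lambda>q. \<Sum>n<m. E n d q) p"
      by (intro smooth_near_sum vector_fieldD(1)[OF E open_UNIV d UNIV_I])
    fix q assume q: "q \<in> W \<inter> chart_dom d"
    have "E n d q = \<phi> n q *\<^sub>R trans (C n) d q (local_nabla (C n) (G n) X Y q)" for n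
    proof (cases "q \<in> V n")
      case False
      then have "\<phi> n q = 0" using \<phi>[of n] unfolding cutoff_def by blast
      with False show ?thesis by (simp add: E_def ext_vfield_def ext_fun_def)
    qed (use d q in \<open>simp add: E_def ext_vfield_def ext_fun_def\<close>)
    then show "(\<Sum>n<m. E n d q) = glued_nabla X Y d q"
      using q d W(3)[of q] by (simp add: glued_nabla_def avg_eq)
  qed (use W d in auto)
  with d show "\<exists>d\<in>A. p \<in> chart_dom d \<and> smooth_near (glued_nabla X Y d) p" by blast
next
  fix d e q assume d: "d \<in> A" "e \<in> A" "q \<in> chart_dom d" "q \<in> chart_dom e"
  then have "trans d e q (glued_nabla X Y d q) = avg q (\<lambda>n. trans d e q (trans (C n) d q (local_nabla (C n) (G n) X Y q)))"
    by (simp add: glued_nabla_def avg_linear[OF linear_blinfun])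
  also have "\<dots> = avg q (\<lambda>n. trans (C n) e q (local_nabla (C n) (G n) X Y q))"
    by (rule avg_cong) (use d C in \<open>simp add: trans_comp\<close>)
  finally show "glued_nabla X Y e q = trans d e q (glued_nabla X Y d q)" using d by (simp add: glued_nabla_def)
qed (auto simp: glued_nabla_def)

private lemma connection_glued_nabla: "connection A glued_nabla"
  unfolding connection_def
proof (intro conjI allI impI)
  fix X X' Y Y' :: "('a, 'e) vfield" and f :: "'a \<Rightarrow> real"
  note tr = blinfun.add_right[symmetric]
  show "vector_field A (glued_nabla X Y)" if "vector_field A X" "vector_field A Y"
    by (rule vector_field_glued_nabla[OF that])
  show "glued_nabla (\<lambda>c p. X c p + X' c p) Y = (\<lambda>c p. glued_nabla X Y c p + glued_nabla X' Y c p)"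
    if "vector_field A Y"
    unfolding glued_nabla_def
    by (intro ext) (auto simp: avg_add[symmetric] local_nabla_add_left[OF G _ that] tr intro!: avg_cong)
  show "glued_nabla X (\<lambda>c p. Y c p + Y' c p) = (\<lambda>c p. glued_nabla X Y c p + glued_nabla X Y' c p)"
    if "vector_field A Y" "vector_field A Y'"
    unfolding glued_nabla_def
    by (intro ext) (auto simp: avg_add[symmetric] local_nabla_add_right[OF G _ that] tr intro!: avg_cong)
  show "glued_nabla (\<lambda>c p. f p *\<^sub>R X c p) Y = (\<lambda>c p. f p *\<^sub>R glued_nabla X Y c p)"
    if "vector_field A Y"
    unfolding glued_nabla_def
    by (intro ext) (auto simp: avg_linear[of "\<lambda>z. r *\<^sub>R z" for r] local_nabla_scale_left[OF G _ that] blinfun.scaleR_right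
        intro!: avg_cong linearI scaleR_add_right)
  show "glued_nabla X (\<lambda>c p. f p *\<^sub>R Y c p) = (\<lambda>c p. f p *\<^sub>R glued_nabla X Y c p + vderiv X f c p *\<^sub>R Y c p)"
    if f: "smooth_function A f" and X: "vector_field A X" and Y: "vector_field A Y"
  proof (intro ext)
    fix d q
    show "glued_nabla X (\<lambda>c p. f p *\<^sub>R Y c p) d q = f q *\<^sub>R glued_nabla X Y d q + vderiv X f d q *\<^sub>R Y d q"
    proof (cases "d \<in> A \<and> q \<in> chart_dom d")
      case True
      \<comment> \<open>The derivative term is the same for every n once expressed in the chart d,
        so averaging reproduces it unchanged.\<close>
      have "trans (C n) d q (local_nabla (C n) (G n) X (\<lambda>c p. f p *\<^sub>R Y c p) q)
        = f q *\<^sub>R trans (C n) d q (local_nabla (C n) (G n) X Y q) + vderiv X f d q *\<^sub>R Y d q" if q: "q \<in> V n" for n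
      proof -
        note c = C(1)[of n] conjunct1[OF True] C(2)[OF q] conjunct2[OF True]
        have "vderiv X f (C n) q = vderiv X f d q"
          using cderiv_chart_change[of f, OF _ c] vector_fieldD(2)[OF X open_UNIV c UNIV_I] f
          by (simp add: vderiv_eq_cderiv smooth_function_iff)
        then show ?thesis
          using vector_fieldD(2)[OF Y open_UNIV c UNIV_I]
          by (simp add: local_nabla_leibniz[OF G q Y f] blinfun.add_right blinfun.scaleR_right)
      qed
      then have "glued_nabla X (\<lambda>c p. f p *\<^sub>R Y c p) d q
        = avg q (\<lambda>n. f q *\<^sub>R trans (C n) d q (local_nabla (C n) (G n) X Y q) + vderiv X f d q *\<^sub>R Y d q)"
        unfolding glued_nabla_def using True by (auto intro!: avg_cong)
      also have "\<dots> = f q *\<^sub>R glued_nabla X Y d q + vderiv X f d q *\<^sub>R Y d q"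
        using True avg_linear[of "\<lambda>z. f q *\<^sub>R z" q "\<lambda>n. trans (C n) d q (local_nabla (C n) (G n) X Y q)"]
        by (simp add: avg_add avg_const glued_nabla_def linear_iff scaleR_add_right mult.commute)
      finally show ?thesis .
    next
      case False
      then show ?thesis using vector_fieldD(3)[OF Y open_UNIV, of d q] by (auto simp: glued_nabla_def)
    qed
  qed
qed

text \<open>At each point two local derivatives with X and Y exchanged differ by the bracket, which
  transforms as a vector and so does not depend on n; the average keeps the difference.\<close>

private lemma torsion_free_glued_nabla:
  assumes "integrable_distribution A (tensor_image \<Theta>)"
  shows "torsion_free A glued_nabla"
  unfolding torsion_free_def
proof (intro allI impI ballI)
  fix X Y d q assume X: "vector_field A X" and Y: "vector_field A Y" and d: "d \<in> A" "q \<in> chart_dom d"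
  have "glued_nabla X Y d q = avg q (\<lambda>n. trans (C n) d q (local_nabla (C n) (G n) Y X q) + lie_bracket X Y d q)"
    using d unfolding glued_nabla_def
  proof (simp, intro avg_cong)
    fix n assume q: "q \<in> V n"
    have "lie_bracket X Y d q = trans (C n) d q (lie_bracket X Y (C n) q)"
      by (rule lie_bracket_trans[OF X Y open_UNIV UNIV_I C(1) d(1) C(2)[OF q] d(2)])
    then show "trans (C n) d q (local_nabla (C n) (G n) X Y q)
      = trans (C n) d q (local_nabla (C n) (G n) Y X q) + lie_bracket X Y d q"
      by (simp add: local_nabla_torsion[OF G q assms, symmetric] blinfun.diff_right)
  qed
  then show "glued_nabla X Y d q - glued_nabla Y X d q = lie_bracket X Y d q"
    using d by (simp add: avg_add avg_const glued_nabla_def)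
qed

text \<open>By \<open>cov_deriv_tensor20_eq\<close> the condition equates an expression linear in
  the connection with a function that does not involve it, so it passes to averages.\<close>

private lemma parallel_glued_nabla: "parallel A glued_nabla \<Theta>"
  unfolding parallel_def
proof (intro allI impI ballI)
  fix X and \<xi> \<eta> :: "('a, 'e) form1" and d q
  assume X: "vector_field A X" and \<xi>: "one_form A \<xi>" and \<eta>: "one_form A \<eta>" and d: "d \<in> A" "q \<in> chart_dom d"
  have avg: "\<xi> d q (glued_nabla X Y d q) = avg q (\<lambda>n. \<xi> (C n) q (local_nabla (C n) (G n) X Y q))"
    if \<xi>: "one_form A \<xi>" for \<xi> and Y :: "('a, 'e) vfield"
  proof -
    have "\<xi> d q (glued_nabla X Y d q) = avg q (\<lambda>n. \<xi> d q (trans (C n) d q (local_nabla (C n) (G n) X Y q)))"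
      using d by (simp add: glued_nabla_def avg_linear[OF linear_blinfun])
    also have "\<dots> = avg q (\<lambda>n. \<xi> (C n) q (local_nabla (C n) (G n) X Y q))"
      by (rule avg_cong) (simp add: one_formD(2)[OF \<xi> C(1) d(1) C(2) d(2)])
    finally show ?thesis .
  qed
  have "\<xi> d q (glued_nabla X (sharp \<eta>) d q) + \<eta> d q (glued_nabla X (sharp \<xi>) d q)
    = avg q (\<lambda>n. \<xi> (C n) q (local_nabla (C n) (G n) X (sharp \<eta>) q) + \<eta> (C n) q (local_nabla (C n) (G n) X (sharp \<xi>) q))"
    by (simp only: avg[OF \<xi>] avg[OF \<eta>] avg_add)
  also have "\<dots> = avg q (\<lambda>n. vderiv X (\<lambda>q. \<Theta> d q (\<xi> d q) (\<eta> d q)) d q)"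
    by (rule avg_cong)
      (simp add: local_nabla_parallel[OF G _ \<xi> \<eta>] vderiv_tensor_forms_chart[OF \<xi> \<eta> X C(1) d(1) C(2) d(2)])
  finally show "cov_deriv_tensor20 A glued_nabla X \<Theta> \<xi> \<eta> d q = 0"
    unfolding cov_deriv_tensor20_eq[OF connection_glued_nabla X \<xi> \<eta> d] by (simp add: avg_const)
qed

lemma integrable_tensorI:
  assumes "integrable_distribution A (tensor_image \<Theta>)"
  shows "integrable_tensor A \<Theta>"
  unfolding integrable_tensor_def
  using connection_glued_nabla torsion_free_glued_nabla[OF assms] parallel_glued_nabla by blast

end

lemma distribution_imp_integrable_tensor:
  assumes "integrable_distribution A (tensor_image \<Theta>)"
  shows "integrable_tensor A \<Theta>"
proof -
  let ?\<V> = "{W. \<exists>c G. ginverse_on c W G}"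
  have "\<exists>V\<in>?\<V>. open V \<and> p \<in> V" for p
  proof -
    obtain c where c: "c \<in> A" "p \<in> chart_dom c" using ex_chart .
    obtain W G where "ginverse_on c W G" "p \<in> W" using ex_ginverse[OF c] .
    then show ?thesis using ginverse_onD(2) by blast
  qed
  then show ?thesis
  proof (rule ex_partition_of_unity)
    fix \<phi> :: "nat \<Rightarrow> 'a \<Rightarrow> real" and V
    assume V: "\<And>n. V n \<in> ?\<V>" "\<And>n. cutoff (V n) (\<phi> n)"
      "\<And>p. \<exists>W m. open W \<and> p \<in> W \<and> (\<forall>q\<in>W. (\<forall>n\<ge>m. \<phi> n q = 0) \<and> (\<Sum>n<m. \<phi> n q) = 1)"
    have "\<forall>n. \<exists>x. ginverse_on (fst x) (V n) (snd x)" using V(1) by simp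
    from choice[OF this] obtain x where "\<And>n. ginverse_on (fst (x n)) (V n) (snd (x n))" by blast
    then show ?thesis by (rule integrable_tensorI[OF V(2) _ V(3) assms])
  qed
qed

end

theorem propositionE:
  fixes A :: "('a::{t2_space, second_countable_topology}, 'e::real_inner) chart set"
    and \<Theta> :: "('a, 'e) tensor20"
  assumes "smooth_manifold A"
    and "symmetric_tensor20 A \<Theta>"
    and "constant_rank A \<Theta>"
  shows "integrable_tensor A \<Theta> \<longleftrightarrow> integrable_distribution A (tensor_image \<Theta>)"
proof -
  interpret symmetric_tensor_manifold A \<Theta>
    by (intro symmetric_tensor_manifold.intro symmetric_tensor_manifold_axioms.intro assms)
  show ?thesis
    using integrable_tensor_imp_distribution distribution_imp_integrable_tensor by blast
qed

end
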